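(* Let $z\in\mathbb{R}\setminus(\tau/2)\mathbb{Z}$. For every $1<r<\infty$ and every function $u:\mathcal{X}\to\mathbb{C}$: $u=\mathcal{P}_{z}F$ for some $F\in L^{r}(\Omega)$ if and only if $u\in\mathcal{H}^{r}_{\ast}(\mathcal{X})$ and $\mathcal{L}u=\gamma(z)u$. Moreover, for every $1<r<\infty$, there exist positive constants $C_{1,r}$ and $C_{2,r}$, independent of $z$, such that $$C_{1,r}|\mathbf{c}(z)|\,\|F\|_{L^{r}(\Omega)}\leq\|\mathcal{P}_{z}F\|_{\mathcal{H}^{r}_{\ast}(\mathcal{X})}\leq C_{2,r}|\mathbf{c}(z)|\,\|F\|_{L^{r}(\Omega)}\quad\text{for all }F\in L^{r}(\Omega).$$
   Context: Fix an integer $q\geq 2$. $\mathcal{X}$ is (the vertex set of) the homogeneous tree of degree $q+1$, i.e. the connected graph without cycles in which every vertex has exactly $q+1$ neighbours; $d$ is the graph distance, $o\in\mathcal{X}$ is a fixed reference vertex, $|x|=d(o,x)$. Since $q$ is fixed throughout, constants may depend on $q$. Put $\tau=2\pi/\log q$. Boundary: $\Omega$ is the set of infinite geodesic rays $\omega=\{o=x_0,x_1,x_2,\ldots\}$ starting at $o$. For $x\in\mathcal{X}$ and $\omega\in\Omega$, $c(x,\omega)$ is the last vertex on the geodesic path from $o$ to $x$ which lies on $\omega$. $E(x)=\{\omega\in\Omega: |c(x,\omega)|=|x|\}$ is the set of rays passing through $x$; the sets $E(x)$, $x\in\mathcal X$, generate the topology and the $\sigma$-algebra of $\Omega$. $\nu$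 is the probability measure on $\Omega$ with $\nu(E(o))=1$ and $\nu(E(x))=1/((q+1)q^{|x|-1})$ for $x\neq o$. $L^r(\Omega)=L^r(\Omega,\nu)$. Poisson kernel and transform: $p(x,\omega)=q^{2|c(x,\omega)|-|x|}$. For $z\in\mathbb{C}$ and $F\in L^1(\Omega)$, $\mathcal{P}_zF(x)=\int_\Omega p(x,\omega)^{1/2+iz}F(\omega)\,d\nu(\omega)$, $x\in\mathcal{X}$. Laplacian: $\mathcal{L}u(x)=u(x)-\frac{1}{q+1}\sum_{y:d(x,y)=1}u(y)$, and $\gamma(z)=1-\frac{q^{1/2+iz}+q^{1/2-iz}}{q+1}$. Harish-Chandra's c-function: $\mathbf{c}(z)=\frac{q^{1/2}}{q+1}\,\frac{q^{1/2+iz}-q^{-1/2-iz}}{q^{iz}-q^{-iz}}$ for $z\in\mathbb{C}\setminus(\tau/2)\mathbb{Z}$. Hardy-type space: let $K$ be the compact group of isometries of $\mathcal{X}$ fixing $o$, with normalized Haar measure $dk$, and let $\omega_o=\{\omega_0,\omega_1,\ldots\}\in\Omega$ be a fixed ray, so $|\omega_n|=n$. Then $\int_K f(k\cdot\omega_n)\,dk$ is the average of $f$ over the sphere $\{y\in\mathcal{X}:|y|=n\}$. For $1\leq r<\infty$, $\mathcal{H}^r_\ast(\mathcal{X})$ is the space of functions $u:\mathcal{X}\to\mathbb{C}$ with $$\|u\|_{\mathcal{H}^r_\ast(\mathcal{X})}=\sup_{n\geq 0}\ q^{n/2}\Big(\int_K|u(k\cdot\omega_n)|^r\,dk\Big)^{1/r}<\infty.$$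 *)

theory Defs
  imports "HOL-Analysis.Analysis" "HOL-Probability.Probability_Measure"
begin

text \<open>
  A graph is given by its adjacency relation; its vertex set is the whole type \<open>'v\<close>.
  The parameter \<open>x0\<close> is the reference vertex written $o$ in the literature.
\<close>

definition is_cycle :: "('v \<Rightarrow> 'v \<Rightarrow> bool) \<Rightarrow> 'v list \<Rightarrow> bool" where
  "is_cycle adj xs \<longleftrightarrow>
     3 \<le> length xs \<and> distinct xs \<and> successively adj xs \<and> adj (last xs) (hd xs)"

text \<open>Local finiteness is part of the degree condition: an infinite set has \<open>card\<close> zero.\<close>

definition homogeneous_tree :: "nat \<Rightarrow> ('v \<Rightarrow> 'v \<Rightarrow> bool) \<Rightarrow> bool" where
  "homogeneous_tree q adj \<longleftrightarrow>
     symp adj \<and> irreflp adj \<and> (\<forall>x y. adj\<^sup>*\<^sup>* x y) \<and>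
     (\<nexists>xs. is_cycle adj xs) \<and> (\<forall>x. card {y. adj x y} = q + 1)"

definition gdist :: "('v \<Rightarrow> 'v \<Rightarrow> bool) \<Rightarrow> 'v \<Rightarrow> 'v \<Rightarrow> nat" where
  "gdist adj x y = (LEAST n. (adj ^^ n) x y)"

definition rays :: "('v \<Rightarrow> 'v \<Rightarrow> bool) \<Rightarrow> 'v \<Rightarrow> (nat \<Rightarrow> 'v) set" where
  "rays adj x0 =
     {\<omega>. \<omega> 0 = x0 \<and> (\<forall>m n. m \<le> n \<longrightarrow> gdist adj (\<omega> m) (\<omega> n) = n - m)}"

text \<open>The vertices of the geodesic path from \<open>x\<close> to \<open>y\<close>.\<close>

definition geodesic :: "('v \<Rightarrow> 'v \<Rightarrow> bool) \<Rightarrow> 'v \<Rightarrow> 'v \<Rightarrow> 'v set" where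
  "geodesic adj x y = {w. gdist adj x w + gdist adj w y = gdist adj x y}"

text \<open>
  \<open>confluent adj x0 x \<omega>\<close> is the last vertex (the one farthest from \<open>x0\<close>) on the geodesic path
  from \<open>x0\<close> to \<open>x\<close> which lies on \<open>\<omega>\<close>. The maximum is over a finite set containing \<open>x0\<close>.
\<close>

definition confluent :: "('v \<Rightarrow> 'v \<Rightarrow> bool) \<Rightarrow> 'v \<Rightarrow> 'v \<Rightarrow> (nat \<Rightarrow> 'v) \<Rightarrow> 'v" where
  "confluent adj x0 x \<omega> =
     (ARG_MAX (gdist adj x0) w. w \<in> geodesic adj x0 x \<and> w \<in> range \<omega>)"

definition rays_through :: "('v \<Rightarrow> 'v \<Rightarrow> bool) \<Rightarrow> 'v \<Rightarrow> 'v \<Rightarrow> (nat \<Rightarrow> 'v) set" where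
  "rays_through adj x0 x =
     {\<omega> \<in> rays adj x0. gdist adj x0 (confluent adj x0 x \<omega>) = gdist adj x0 x}"

text \<open>The conditions determine \<open>\<nu>\<close> uniquely.\<close>

definition boundary_measure ::
  "nat \<Rightarrow> ('v \<Rightarrow> 'v \<Rightarrow> bool) \<Rightarrow> 'v \<Rightarrow> (nat \<Rightarrow> 'v) measure \<Rightarrow> bool" where
  "boundary_measure q adj x0 \<nu> \<longleftrightarrow>
     prob_space \<nu> \<and>
     space \<nu> = rays adj x0 \<and>
     sets \<nu> = sigma_sets (rays adj x0) (range (rays_through adj x0)) \<and>
     measure \<nu> (rays_through adj x0 x0) = 1 \<and>
     (\<forall>x. x \<noteq> x0 \<longrightarrow> measure \<nu> (rays_through adj x0 x)
            = 1 / ((real q + 1) * real q ^ (gdist adj x0 x - 1)))"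

definition Lr_space :: "'a measure \<Rightarrow> real \<Rightarrow> ('a \<Rightarrow> complex) set" where
  "Lr_space M r = {F \<in> borel_measurable M. integrable M (\<lambda>\<omega>. norm (F \<omega>) powr r)}"

definition Lr_norm :: "'a measure \<Rightarrow> real \<Rightarrow> ('a \<Rightarrow> complex) \<Rightarrow> real" where
  "Lr_norm M r F = (\<integral>\<omega>. norm (F \<omega>) powr r \<partial>M) powr (1 / r)"

definition poisson_kernel ::
  "nat \<Rightarrow> ('v \<Rightarrow> 'v \<Rightarrow> bool) \<Rightarrow> 'v \<Rightarrow> 'v \<Rightarrow> (nat \<Rightarrow> 'v) \<Rightarrow> real" where
  "poisson_kernel q adj x0 x \<omega> =
     real q powi (2 * int (gdist adj x0 (confluent adj x0 x \<omega>)) - int (gdist adj x0 x))"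

definition poisson_transform ::
  "nat \<Rightarrow> ('v \<Rightarrow> 'v \<Rightarrow> bool) \<Rightarrow> 'v \<Rightarrow> (nat \<Rightarrow> 'v) measure \<Rightarrow> complex
     \<Rightarrow> ((nat \<Rightarrow> 'v) \<Rightarrow> complex) \<Rightarrow> 'v \<Rightarrow> complex" where
  "poisson_transform q adj x0 \<nu> z F x =
     (\<integral>\<omega>. complex_of_real (poisson_kernel q adj x0 x \<omega>) powr (1/2 + \<i> * z) * F \<omega> \<partial>\<nu>)"

definition laplacian ::
  "nat \<Rightarrow> ('v \<Rightarrow> 'v \<Rightarrow> bool) \<Rightarrow> ('v \<Rightarrow> complex) \<Rightarrow> 'v \<Rightarrow> complex" where
  "laplacian q adj u x = u x - 1 / (of_nat q + 1) * (\<Sum>y | gdist adj x y = 1. u y)"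

definition laplace_gamma :: "nat \<Rightarrow> complex \<Rightarrow> complex" where
  "laplace_gamma q z =
     1 - (of_nat q powr (1/2 + \<i> * z) + of_nat q powr (1/2 - \<i> * z)) / (of_nat q + 1)"

definition tau :: "nat \<Rightarrow> real" where
  "tau q = 2 * pi / ln (real q)"

text \<open>Meaningful off the half-period lattice only; on it the value is the junk value zero.\<close>

definition c_function :: "nat \<Rightarrow> complex \<Rightarrow> complex" where
  "c_function q z =
     of_nat q powr (1/2) / (of_nat q + 1) *
     ((of_nat q powr (1/2 + \<i> * z) - of_nat q powr (- (1/2) - \<i> * z)) /
      (of_nat q powr (\<i> * z) - of_nat q powr (- (\<i> * z))))"

definition stabilizer :: "('v \<Rightarrow> 'v \<Rightarrow> bool) \<Rightarrow> 'v \<Rightarrow> ('v \<Rightarrow> 'v) set" where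
  "stabilizer adj x0 =
     {k. bij k \<and> (\<forall>x y. gdist adj (k x) (k y) = gdist adj x y) \<and> k x0 = x0}"

text \<open>The topology of pointwise convergence, for which the stabilizer is a compact group.\<close>

definition stabilizer_topology :: "('v \<Rightarrow> 'v \<Rightarrow> bool) \<Rightarrow> 'v \<Rightarrow> ('v \<Rightarrow> 'v) topology" where
  "stabilizer_topology adj x0 =
     subtopology (product_topology (\<lambda>_. discrete_topology UNIV) UNIV) (stabilizer adj x0)"

text \<open>
  The normalized Haar measure on the Borel sets of the stabilizer: the left-invariant probability
  measure. It is unique, and regularity is automatic since the group is compact and metrizable.
\<close>

definition normalized_haar ::
  "('v \<Rightarrow> 'v \<Rightarrow> bool) \<Rightarrow> 'v \<Rightarrow> ('v \<Rightarrow> 'v) measure \<Rightarrow> bool" where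
  "normalized_haar adj x0 \<mu> \<longleftrightarrow>
     prob_space \<mu> \<and>
     space \<mu> = stabilizer adj x0 \<and>
     sets \<mu> = sigma_sets (stabilizer adj x0) {U. openin (stabilizer_topology adj x0) U} \<and>
     (\<forall>g \<in> stabilizer adj x0. \<forall>A \<in> sets \<mu>. emeasure \<mu> ((\<lambda>k. g \<circ> k) ` A) = emeasure \<mu> A)"

text \<open>
  The norm is extended-real valued so that the supremum may be infinite. For each \<open>n\<close> the
  integrand takes finitely many values, hence is integrable.
\<close>

definition hardy_norm ::
  "nat \<Rightarrow> ('v \<Rightarrow> 'v) measure \<Rightarrow> (nat \<Rightarrow> 'v) \<Rightarrow> real \<Rightarrow> ('v \<Rightarrow> complex) \<Rightarrow> ennreal" where
  "hardy_norm q \<mu> \<omega>0 r u =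
     (SUP n. ennreal (real q powr (real n / 2) *
        (\<integral>k. norm (u (k (\<omega>0 n))) powr r \<partial>\<mu>) powr (1 / r)))"

definition hardy_space ::
  "nat \<Rightarrow> ('v \<Rightarrow> 'v) measure \<Rightarrow> (nat \<Rightarrow> 'v) \<Rightarrow> real \<Rightarrow> ('v \<Rightarrow> complex) set" where
  "hardy_space q \<mu> \<omega>0 r = {u. hardy_norm q \<mu> \<omega>0 r u < \<infinity>}"

end

theory Submission
  imports Defs
begin

text \<open>
  Write \<open>x\<^sub>j\<close> for the vertex at distance \<open>j\<close> from the root on the geodesic to \<open>x\<close>, and put
  \<open>w = q powr (2 i z)\<close>, a complex number of modulus one. An integrable function \<open>F\<close> on the boundary is
  recorded by its averages \<open>f x\<close> over the rays through \<open>x\<close>; these form a martingale on the tree, that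
  is, \<open>f x\<close> is the mean of \<open>f\<close> over the children of \<open>x\<close>. The Poisson kernel at \<open>x\<close> depends on a ray only
  through the level at which the ray leaves the geodesic to \<open>x\<close>, so a telescoping sum gives, for \<open>x\<close> at
  level \<open>n\<close>,

  \<open>q powr (n (1/2 + i z)) * P\<^sub>z F x = f x0 + kappa w * (\<Sum>j=1..n. w ^ j * f x\<^sub>j)\<close>
  with \<open>kappa w = (q - 1 / w) / (q + 1)\<close>

  (\<open>poisson_transform_eq\<close>). Three observations turn the theorem into a statement about the sums on
  the right. Since the automorphisms fixing the root act transitively on each sphere, integration over
  the stabilizer is the uniform average over a sphere (\<open>haar_average\<close>), and the Hardy norm becomes the
  supremum over \<open>n\<close> of the \<open>L\<^sup>r\<close> norms of these sums (\<open>hardy_norm_eq\<close>). Every function \<open>u\<close> on the tree comes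
  from exactly one \<open>f\<close> in this way, and \<open>u\<close> is an eigenfunction of the Laplacian precisely when \<open>f\<close> is a
  martingale (\<open>eigenfunction_iff_martingale\<close>). Finally \<open>\<bar>c z\<bar> = \<bar>kappa w\<bar> / \<bar>w - 1\<bar>\<close>, and \<open>w = 1\<close> exactly for the
  excluded values of \<open>z\<close>.

  Upper bound: summation by parts turns \<open>(w - 1)\<close> times the geometric sum into \<open>w ^ (n+1) * f x\<close> minus
  the martingale transform of \<open>f\<close> with multipliers \<open>w ^ j\<close>, up to a multiple of \<open>f x0\<close>. Such transforms
  are bounded on \<open>L\<^sup>r\<close> with a constant depending on \<open>r\<close> only (\<open>transform_bound\<close>). For \<open>r \<ge> 2\<close> this is
  obtained from a potential that dominates the \<open>r\<close>-th moment of the transform step by step, together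
  with the maximal inequality; the case \<open>r < 2\<close> follows by duality.

  Lower bound: choose \<open>k\<close> with \<open>\<bar>w ^ k - 1\<bar> \<ge> 1\<close>. The difference of the sums at levels \<open>n + k\<close> and \<open>n\<close> has
  conditional expectation \<open>kappa w * w ^ (n+1) * (w ^ k - 1) / (w - 1) * f\<close> at level \<open>n + 1\<close>, and
  conditional expectations contract \<open>L\<^sup>r\<close> norms (\<open>spectral_sum_lower\<close>). So the \<open>L\<^sup>r\<close> norms of \<open>f\<close> on the
  spheres are at most a constant times the Hardy norm divided by \<open>\<bar>c z\<bar>\<close>.

  It remains to pass from \<open>f\<close> back to the boundary: a martingale that is bounded in \<open>L\<^sup>r\<close> consists of the
  averages of a function \<open>F\<close> in \<open>L\<^sup>r\<close> obeying the same bound (\<open>Lr_bounded_martingale_closed\<close>), and \<open>F\<close> is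
  determined by \<open>f\<close> almost everywhere (\<open>ray_avg_unique\<close>). Convergence is derived from the
  strict convexity of \<open>\<lambda>t. sqrt (1 + \<bar>t\<bar>\<^sup>2)\<close>: its means along the martingale are bounded, and
  martingale values at two levels where these means nearly agree are close in \<open>L\<^sup>1\<close>.
\<close>

section \<open>Inequalities between powers\<close>

text \<open>
  This is Young's inequality for the exponents \<open>p\<close> and \<open>p / (p - 1)\<close>, written as convexity of the
  power function.
\<close>

lemma powr_above_tangent:
  fixes a b p :: real
  assumes "1 \<le> p" "0 \<le> a" "0 \<le> b"
  shows "a powr p + p * a powr (p - 1) * (b - a) \<le> b powr p"
proof (cases "p = 1 \<or> a = 0")
  case True
  then show ?thesis using assms by auto
next
  case False
  then have p: "1 < p" and a: "0 < a" using assms by auto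
  have "b * a powr (p - 1) \<le> b powr p / p + (a powr (p - 1)) powr (p / (p - 1)) / (p / (p - 1))"
    using p a assms by (intro Youngs_inequality) (auto simp: field_simps)
  also have "(a powr (p - 1)) powr (p / (p - 1)) = a powr p"
    using p by (simp add: powr_powr)
  finally have "p * (b * a powr (p - 1)) \<le> b powr p + (p - 1) * a powr p"
    using p by (simp add: field_simps)
  moreover have "a powr p = a * a powr (p - 1)"
    using a by (simp add: powr_mult_base)
  ultimately show ?thesis by (simp add: algebra_simps)
qed

lemma powr_diff_le_max:
  fixes a b e :: real
  assumes "0 \<le> e" "0 \<le> a" "a \<le> b"
  shows "b powr e - a powr e \<le> max 1 e * b powr (e - 1) * (b - a)"
proof (cases "1 \<le> e")
  case True
  then show ?thesis using powr_above_tangent[of e b a] assms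
    by (simp add: max_def algebra_simps)
next
  case False
  show ?thesis
  proof (cases "a = 0")
    case True
    show ?thesis using assms False True
      by (cases "b = 0") (auto simp: powr_diff)
  next
    case a: False
    have "a / b = (a / b) powr 1" using a assms by auto
    also have "\<dots> \<le> (a / b) powr e"
      using a assms False by (intro powr_mono') auto
    also have "\<dots> = a powr e / b powr e" using a assms by (simp add: powr_divide)
    finally have "a * b powr e \<le> b * a powr e"
      using a assms by (simp add: field_simps)
    then show ?thesis using a assms False
      by (simp add: powr_diff field_simps)
  qed
qed

text \<open>
  A second-order Taylor bound for \<open>\<lambda>z. \<bar>z\<bar> powr p\<close> that avoids derivatives: with \<open>\<alpha> = \<bar>a\<bar>\<^sup>2\<close> and \<open>\<beta> = \<bar>b\<bar>\<^sup>2\<close>,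
  convexity of \<open>\<lambda>t. t powr (p/2)\<close> bounds its increment from \<open>\<alpha>\<close> to \<open>\<beta>\<close> by the slope at \<open>\<beta>\<close>, and replacing
  this by the slope at \<open>\<alpha>\<close> costs a difference of first order in \<open>b - a\<close>. The linear term is the one that vanishes
  when \<open>a\<close> and \<open>b\<close> are consecutive values of a martingale.
\<close>

lemma norm_powr_taylor:
  fixes a b :: complex and p M :: real
  assumes p: "2 \<le> p" and M: "norm a \<le> M" "norm b \<le> M"
  shows "norm b powr p \<le> norm a powr p + p * norm a powr (p - 2) * Re (cnj a * (b - a))
           + p\<^sup>2 * M powr (p - 2) * (norm (b - a))\<^sup>2"
proof -
  define \<alpha> \<beta> m where "\<alpha> = (norm a)\<^sup>2" and "\<beta> = (norm b)\<^sup>2" and "m = p / 2"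
  have sq: "(x\<^sup>2) powr e = x powr (2 * e)" if "0 \<le> x" for x e :: real
    using that by (cases "x = 0") (auto simp: powr_powr simp flip: powr_numeral)
  have diff: "\<beta> - \<alpha> = 2 * Re (cnj a * (b - a)) + (norm (b - a))\<^sup>2"
    unfolding \<alpha>_def \<beta>_def cmod_power2 by (simp add: power2_eq_square algebra_simps)
  have "\<beta> powr m + m * \<beta> powr (m - 1) * (\<alpha> - \<beta>) \<le> \<alpha> powr m"
    using p by (intro powr_above_tangent) (auto simp: m_def \<alpha>_def \<beta>_def)
  moreover have e: "\<beta> powr m = norm b powr p" "\<alpha> powr m = norm a powr p"
    "\<beta> powr (m - 1) = norm b powr (p - 2)" "\<alpha> powr (m - 1) = norm a powr (p - 2)"
    by (simp_all add: \<alpha>_def \<beta>_def sq m_def right_diff_distrib)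
  ultimately have 1: "norm b powr p \<le> norm a powr p + m * norm a powr (p - 2) * (\<beta> - \<alpha>)
      + m * ((norm b powr (p - 2) - norm a powr (p - 2)) * (\<beta> - \<alpha>))"
    by (simp add: algebra_simps)
  have key: "(norm y powr (p - 2) - norm x powr (p - 2)) * ((norm y)\<^sup>2 - (norm x)\<^sup>2)
      \<le> 2 * max 1 (p - 2) * M powr (p - 2) * (norm (y - x))\<^sup>2"
    if "norm x \<le> norm y" "norm y \<le> M" for x y :: complex
  proof -
    let ?N = "norm y"
    have "(?N powr (p - 2) - norm x powr (p - 2)) * ((norm y)\<^sup>2 - (norm x)\<^sup>2)
      = (?N powr (p - 2) - norm x powr (p - 2)) * ((?N - norm x) * (?N + norm x))"
      by (simp add: power2_eq_square algebra_simps)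
    also have "\<dots> \<le> (max 1 (p - 2) * ?N powr (p - 2 - 1) * (?N - norm x))
        * ((?N - norm x) * (2 * ?N))"
      using that p by (intro mult_mono powr_diff_le_max) (auto intro!: mult_nonneg_nonneg powr_mono2)
    also have "\<dots> = 2 * max 1 (p - 2) * (?N powr (p - 2 - 1) * ?N) * (?N - norm x)\<^sup>2"
      by (simp add: power2_eq_square)
    also have "?N powr (p - 2 - 1) * ?N = ?N powr (p - 2)"
      using powr_mult_base[of ?N "p - 2 - 1"] by (simp add: mult.commute)
    also have "2 * max 1 (p - 2) * ?N powr (p - 2) * (?N - norm x)\<^sup>2
      \<le> 2 * max 1 (p - 2) * M powr (p - 2) * (norm (y - x))\<^sup>2"
      using that p norm_triangle_ineq2[of y x]
      by (intro mult_mono power_mono powr_mono2) auto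
    finally show ?thesis .
  qed
  have 2: "(norm b powr (p - 2) - norm a powr (p - 2)) * (\<beta> - \<alpha>)
      \<le> 2 * max 1 (p - 2) * M powr (p - 2) * (norm (b - a))\<^sup>2"
  proof (cases "norm a \<le> norm b")
    case True
    then show ?thesis using key[of a b] M by (simp add: \<alpha>_def \<beta>_def)
  next
    case False
    then show ?thesis using key[of b a] M
      by (simp add: \<alpha>_def \<beta>_def norm_minus_commute algebra_simps)
  qed
  have 3: "norm a powr (p - 2) \<le> M powr (p - 2)"
    using p M by (intro powr_mono2) auto
  have 4: "m + m * (2 * max 1 (p - 2)) \<le> p\<^sup>2"
  proof (cases "3 \<le> p")
    case True
    then show ?thesis by (simp add: m_def max_def power2_eq_square field_simps)
  next
    case False
    have "p * 2 \<le> p * p" using p by (intro mult_left_mono) auto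
    with False p show ?thesis by (simp add: m_def max_def power2_eq_square)
  qed
  let ?X = "M powr (p - 2) * (norm (b - a))\<^sup>2"
  have "norm b powr p \<le> norm a powr p + p * norm a powr (p - 2) * Re (cnj a * (b - a))
     + m * (norm a powr (p - 2) * (norm (b - a))\<^sup>2) + m * ((norm b powr (p - 2) - norm a powr (p - 2)) * (\<beta> - \<alpha>))"
    using 1 unfolding diff by (simp add: m_def algebra_simps)
  also have "\<dots> \<le> norm a powr p + p * norm a powr (p - 2) * Re (cnj a * (b - a))
     + m * ?X + m * (2 * max 1 (p - 2) * M powr (p - 2) * (norm (b - a))\<^sup>2)"
    using 2 3 p by (intro add_mono mult_left_mono mult_right_mono) (auto simp: m_def)
  also have "\<dots> = norm a powr p + p * norm a powr (p - 2) * Re (cnj a * (b - a))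
     + (m + m * (2 * max 1 (p - 2))) * ?X"
    by (simp add: algebra_simps)
  also have "\<dots> \<le> norm a powr p + p * norm a powr (p - 2) * Re (cnj a * (b - a)) + p\<^sup>2 * ?X"
    using 4 by (intro add_mono mult_right_mono order_refl) auto
  finally show ?thesis by (simp add: mult.assoc)
qed

text \<open>
  Compare \<open>y\<close> with \<open>\<delta> * x\<close>: the first summand dominates if \<open>y\<close> is smaller, the second otherwise. It is used to
  absorb a small multiple of an \<open>r\<close>-th moment, where Hoelder's inequality would require dividing by it.
\<close>

lemma young_scaled:
  fixes x y \<delta> r :: real
  assumes "1 < r" "0 < \<delta>" "0 \<le> x" "0 \<le> y"
  shows "x powr (r - 1) * y \<le> \<delta> * x powr r + \<delta> powr (1 - r) * y powr r"
proof (cases "y \<le> \<delta> * x")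
  case True
  have "x powr (r - 1) * y \<le> x powr (r - 1) * (\<delta> * x)"
    using True by (intro mult_left_mono) auto
  also have "\<dots> = \<delta> * x powr r" using assms by (cases "x = 0") (auto simp: powr_diff)
  finally show ?thesis by (simp add: add_increasing2)
next
  case False
  then have "x powr (r - 1) \<le> (y / \<delta>) powr (r - 1)"
    using assms by (intro powr_mono2) (auto simp: field_simps)
  then have "x powr (r - 1) * y \<le> (y / \<delta>) powr (r - 1) * y"
    using assms by (intro mult_right_mono) auto
  also have "\<dots> = \<delta> powr (1 - r) * y powr r"
    using assms by (cases "y = 0") (auto simp: powr_diff powr_divide field_simps)
  finally show ?thesis using assms by (simp add: add_increasing)
qed

text \<open>
  The same case distinction with the weight distributed as \<open>p = (p - 2) + 2\<close>.
\<close>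

lemma young_scaled_square:
  fixes x y \<delta> p :: real
  assumes "2 \<le> p" "0 < \<delta>" "0 \<le> x" "0 \<le> y"
  shows "x powr (p - 2) * y\<^sup>2 \<le> \<delta>\<^sup>2 * x powr p + \<delta> powr (2 - p) * y powr p"
proof (cases "y \<le> \<delta> * x")
  case True
  have "x powr (p - 2) * y\<^sup>2 \<le> x powr (p - 2) * (\<delta> * x)\<^sup>2"
    using True assms by (intro mult_left_mono power_mono) auto
  also have "\<dots> = \<delta>\<^sup>2 * x powr p"
    using assms by (cases "x = 0") (auto simp: powr_diff power_mult_distrib)
  finally show ?thesis by (simp add: add_increasing2)
next
  case False
  then have y: "0 < y" using assms
    by (metis mult_nonneg_nonneg order_le_less_trans less_eq_real_def not_le)
  have "x powr (p - 2) \<le> (y / \<delta>) powr (p - 2)"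
    using assms False by (intro powr_mono2) (auto simp: field_simps)
  then have "x powr (p - 2) * y\<^sup>2 \<le> (y / \<delta>) powr (p - 2) * y\<^sup>2"
    using assms by (intro mult_right_mono) auto
  also have "\<dots> = \<delta> powr (2 - p) * y powr p"
    using assms y by (auto simp: powr_diff powr_divide field_simps)
  finally show ?thesis using assms by (simp add: add_increasing)
qed

text \<open>
  The bracket after \<open>2 * R ^ 3 / \<delta>\<close> is the gap between \<open>\<lambda>t. sqrt (1 + \<bar>t\<bar>\<^sup>2)\<close> at \<open>b\<close> and its tangent at \<open>a\<close>.
  Lagrange's identity for the vectors \<open>(1, a)\<close> and \<open>(1, b)\<close> bounds \<open>\<bar>b - a\<bar>\<^sup>2\<close> by that gap times a power
  of the size of \<open>a\<close> and \<open>b\<close>. This controls \<open>\<bar>b - a\<bar>\<close> as long as both sizes are at most \<open>R\<close>, while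
  values of size beyond \<open>R\<close> are paid for by the \<open>r\<close>-th moments, since \<open>r > 1\<close>.
\<close>

lemma norm_le_sqrt_bregman:
  fixes a b :: complex and \<delta> R r :: real
  defines "A \<equiv> sqrt (1 + (norm a)\<^sup>2)" and "B \<equiv> sqrt (1 + (norm b)\<^sup>2)"
  assumes \<delta>: "0 < \<delta>" and R: "1 \<le> R" and r: "1 < r"
  shows "norm (b - a) \<le> \<delta> + 2 * R ^ 3 / \<delta> * (B - A - Re (cnj a * (b - a)) / A)
           + 2 * R powr (1 - r) * (A powr r + B powr r)"
proof -
  have A1: "1 \<le> A" and B1: "1 \<le> B" unfolding A_def B_def by auto
  have AA: "A\<^sup>2 = 1 + (norm a)\<^sup>2" and BB: "B\<^sup>2 = 1 + (norm b)\<^sup>2"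
    unfolding A_def B_def by (auto simp: add_nonneg_nonneg)
  have nA: "norm a \<le> A" and nB: "norm b \<le> B"
    unfolding A_def B_def by (auto intro!: real_le_rsqrt)
  define c where "c = 1 + Re (cnj a * b)"
  define D where "D = B - A - Re (cnj a * (b - a)) / A"
  have DA: "A * D = A * B - c"
  proof -
    have "A * (Re (cnj a * (b - a)) / A) = Re (cnj a * (b - a))" using A1 by simp
    then have "A * D = A * B - A\<^sup>2 - Re (cnj a * (b - a))"
      unfolding D_def power2_eq_square right_diff_distrib by linarith
    also have "Re (cnj a * (b - a)) = Re (cnj a * b) - (norm a)\<^sup>2"
      unfolding cmod_power2 by (simp add: power2_eq_square algebra_simps)
    finally show ?thesis by (simp add: c_def AA)
  qed
  have lagrange: "(norm (b - a))\<^sup>2 \<le> (A * B)\<^sup>2 - c\<^sup>2"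
  proof -
    have "(A * B)\<^sup>2 - c\<^sup>2 = (norm (b - a))\<^sup>2 + (Im (cnj a * b))\<^sup>2"
      unfolding power_mult_distrib AA BB c_def cmod_power2
      by (simp add: power2_eq_square algebra_simps)
    then show ?thesis by simp
  qed
  have cle: "\<bar>c\<bar> \<le> A * B"
  proof -
    have "c\<^sup>2 \<le> (A * B)\<^sup>2" using lagrange zero_le_power2[of "norm (b - a)"] by linarith
    then have "\<bar>c\<bar> \<le> \<bar>A * B\<bar>" by (simp only: abs_le_square_iff)
    then show ?thesis using A1 B1 by simp
  qed
  have D0: "0 \<le> D" using DA cle A1
    by (metis abs_le_iff diff_ge_0_iff_ge mult_nonneg_nonneg not_less zero_less_one order_less_le_trans zero_le_mult_iff)
  have main: "(norm (b - a))\<^sup>2 \<le> 2 * A\<^sup>2 * B * D"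
  proof -
    have "(A * B)\<^sup>2 - c\<^sup>2 = (A * B - c) * (A * B + c)"
      by (simp add: power2_eq_square algebra_simps)
    also have "\<dots> \<le> (A * B - c) * (2 * (A * B))"
      using cle by (intro mult_left_mono) auto
    also have "\<dots> = 2 * A\<^sup>2 * B * D"
      unfolding DA[symmetric] by (simp add: power2_eq_square)
    finally show ?thesis using lagrange by linarith
  qed
  have nn: "0 \<le> 2 * R ^ 3 / \<delta> * D" "0 \<le> 2 * R powr (1 - r) * (A powr r + B powr r)"
    using D0 R \<delta> by auto
  have "norm (b - a) \<le> \<delta> + 2 * R ^ 3 / \<delta> * D + 2 * R powr (1 - r) * (A powr r + B powr r)"
  proof (cases "A \<le> R \<and> B \<le> R")
    case True
    have "(norm (b - a))\<^sup>2 \<le> 2 * A\<^sup>2 * B * D" by (rule main)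
    also have "\<dots> \<le> 2 * R\<^sup>2 * R * D"
      using True A1 B1 D0 R by (intro mult_mono power_mono) auto
    finally have sq: "(norm (b - a))\<^sup>2 \<le> 2 * R ^ 3 * D"
      by (simp add: power3_eq_cube power2_eq_square)
    have "norm (b - a) \<le> \<delta> + 2 * R ^ 3 / \<delta> * D"
    proof (cases "norm (b - a) \<le> \<delta>")
      case True
      then show ?thesis using nn by linarith
    next
      case False
      have "\<delta> * norm (b - a) \<le> norm (b - a) * norm (b - a)"
        using False by (intro mult_right_mono) auto
      also have "\<dots> \<le> 2 * R ^ 3 * D" using sq by (simp add: power2_eq_square)
      finally have "norm (b - a) \<le> 2 * R ^ 3 / \<delta> * D"
        using \<delta> by (simp add: field_simps)
      then show ?thesis using \<delta> by linarith
    qed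
    then show ?thesis using nn by linarith
  next
    case False
    \<comment> \<open>At least one of the two sizes exceeds \<open>R\<close>.\<close>
    define T where "T = max A B"
    have T: "R \<le> T" "1 \<le> T" using False A1 by (auto simp: T_def)
    have "norm (b - a) \<le> 2 * T"
      using norm_triangle_ineq4[of b a] nA nB by (auto simp: T_def)
    also have "T = T powr (1 - r) * T powr r"
      using T by (simp flip: powr_add)
    also have "2 * \<dots> \<le> 2 * (R powr (1 - r) * T powr r)"
      using T R r by (intro mult_left_mono mult_right_mono powr_mono2') auto
    also have "T powr r \<le> A powr r + B powr r" by (auto simp: T_def max_def)
    finally have "norm (b - a) \<le> 2 * R powr (1 - r) * (A powr r + B powr r)"
      using R by simp
    then show ?thesis using nn \<delta> by linarith
  qed
  then show ?thesis by (simp add: D_def)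
qed

lemma powr_sum3_le:
  fixes a b c r :: real
  assumes "0 \<le> a" "0 \<le> b" "0 \<le> c" "0 \<le> r"
  shows "(a + b + c) powr r \<le> 3 powr r * (a powr r + b powr r + c powr r)"
proof -
  define m where "m = max a (max b c)"
  have "(a + b + c) powr r \<le> (3 * m) powr r"
    using assms by (intro powr_mono2) (auto simp: m_def)
  also have "\<dots> = 3 powr r * m powr r" using assms by (simp add: powr_mult m_def)
  also have "m powr r \<le> a powr r + b powr r + c powr r" by (auto simp: m_def max_def)
  finally show ?thesis by simp
qed

lemma norm_diff_powr_le:
  fixes a b :: complex
  assumes "0 \<le> r"
  shows "norm (a - b) powr r \<le> 2 powr r * (norm a powr r + norm b powr r)"
proof -
  define m where "m = max (norm a) (norm b)"
  have "norm (a - b) powr r \<le> (2 * m) powr r"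
    using assms norm_triangle_ineq4[of a b] by (intro powr_mono2) (auto simp: m_def)
  also have "\<dots> = 2 powr r * m powr r" by (simp add: powr_mult m_def)
  also have "m powr r \<le> norm a powr r + norm b powr r" by (auto simp: m_def max_def)
  finally show ?thesis by simp
qed

section \<open>Martingales on a finite set and the maximal inequality\<close>

text \<open>
  A finite set with uniform weights, filtered by increasingly fine labels: points with the same label
  at stage \<open>n\<close> are indistinguishable at that stage. The uniform measure is kept unnormalized, as a sum over \<open>X\<close>,
  because the inequalities below are homogeneous in it.
\<close>

locale finite_filtration =
  fixes X :: "'a set" and R :: "nat \<Rightarrow> 'a \<Rightarrow> 'b"
  assumes finite_X: "finite X"
    and refine: "\<lbrakk>x \<in> X; y \<in> X; R (Suc n) x = R (Suc n) y\<rbrakk> \<Longrightarrow> R n x = R n y"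
begin

definition adapted_at :: "nat \<Rightarrow> ('a \<Rightarrow> 'c) \<Rightarrow> bool" where
  "adapted_at n g \<longleftrightarrow> (\<forall>x\<in>X. \<forall>y\<in>X. R n x = R n y \<longrightarrow> g x = g y)"

text \<open>
  Conditional expectation is characterized by testing against the functions known at stage \<open>n\<close>; complex
  test functions make the later choices of multipliers immediate.
\<close>

definition is_cond_exp :: "nat \<Rightarrow> ('a \<Rightarrow> complex) \<Rightarrow> ('a \<Rightarrow> complex) \<Rightarrow> bool" where
  "is_cond_exp n h a \<longleftrightarrow>
     adapted_at n a \<and> (\<forall>c. adapted_at n c \<longrightarrow> (\<Sum>x\<in>X. c x * h x) = (\<Sum>x\<in>X. c x * a x))"

definition martingale :: "(nat \<Rightarrow> 'a \<Rightarrow> complex) \<Rightarrow> bool" where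
  "martingale f \<longleftrightarrow> (\<forall>n. is_cond_exp n (f (Suc n)) (f n))"

lemma refine_le: "\<lbrakk>m \<le> n; x \<in> X; y \<in> X; R n x = R n y\<rbrakk> \<Longrightarrow> R m x = R m y"
  by (induction n rule: dec_induct) (auto dest: refine)

lemma adapted_at_mono: "adapted_at m g \<Longrightarrow> m \<le> n \<Longrightarrow> adapted_at n g"
  unfolding adapted_at_def using refine_le by blast

lemma adapted_atD: "\<lbrakk>adapted_at n g; x \<in> X; y \<in> X; R n x = R n y\<rbrakk> \<Longrightarrow> g x = g y"
  unfolding adapted_at_def by blast

lemma adapted_at_comp: "adapted_at n g \<Longrightarrow> adapted_at n (\<lambda>x. \<phi> (g x))"
  unfolding adapted_at_def by metis

lemma adapted_at_comp2: "adapted_at n g \<Longrightarrow> adapted_at n h \<Longrightarrow> adapted_at n (\<lambda>x. \<phi> (g x) (h x))"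
  unfolding adapted_at_def by metis

lemma is_cond_expD: "is_cond_exp n h a \<Longrightarrow> adapted_at n c \<Longrightarrow> (\<Sum>x\<in>X. c x * h x) = (\<Sum>x\<in>X. c x * a x)"
  by (auto simp: is_cond_exp_def)

lemma is_cond_exp_adapted: "is_cond_exp n h a \<Longrightarrow> adapted_at n a"
  by (auto simp: is_cond_exp_def)

lemma martingale_adapted: "martingale f \<Longrightarrow> adapted_at n (f n)"
  by (auto simp: martingale_def is_cond_exp_def)

lemma martingale_cond_exp:
  assumes "martingale f" "n \<le> m"
  shows "is_cond_exp n (f m) (f n)"
  using assms(2)
proof (induction m rule: dec_induct)
  case base
  show ?case using martingale_adapted[OF assms(1)] by (auto simp: is_cond_exp_def)
next
  case (step m)
  have "is_cond_exp m (f (Suc m)) (f m)" using assms(1) by (auto simp: martingale_def)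
  with step show ?case
    unfolding is_cond_exp_def by (metis adapted_at_mono less_imp_le_nat order_refl)
qed

text \<open>
  Test the defining property with \<open>c\<close> times the conjugate sign of \<open>a\<close>.
\<close>

lemma cond_exp_weighted_norm_le:
  assumes ce: "is_cond_exp n h a" and c: "adapted_at n c" "\<And>x. x \<in> X \<Longrightarrow> (0::real) \<le> c x"
  shows "(\<Sum>x\<in>X. c x * norm (a x)) \<le> (\<Sum>x\<in>X. c x * norm (h x))"
proof -
  define s where "s x = of_real (c x) * cnj (sgn (a x))" for x
  have "adapted_at n s" unfolding s_def
    using adapted_at_comp2[OF c(1) is_cond_exp_adapted[OF ce], of "\<lambda>u v. of_real u * cnj (sgn v)"] .
  then have eq: "(\<Sum>x\<in>X. s x * h x) = (\<Sum>x\<in>X. s x * a x)" by (rule is_cond_expD[OF ce])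
  have "cnj (sgn z) * z = of_real (norm z)" for z :: complex
    by (simp add: sgn_eq complex_norm_square[symmetric] mult.commute power2_eq_square)
  then have "(\<Sum>x\<in>X. s x * a x) = of_real (\<Sum>x\<in>X. c x * norm (a x))"
    by (simp add: s_def mult.assoc)
  with eq have "(\<Sum>x\<in>X. c x * norm (a x)) \<le> norm (\<Sum>x\<in>X. s x * h x)"
    by (simp del: of_real_sum)
  also have "\<dots> \<le> (\<Sum>x\<in>X. c x * norm (h x))"
  proof (intro sum_norm_le)
    fix x assume "x \<in> X"
    have "norm (s x * h x) = c x * norm (sgn (a x)) * norm (h x)"
      using c(2)[OF \<open>x \<in> X\<close>] by (simp add: s_def norm_mult)
    also have "\<dots> \<le> c x * 1 * norm (h x)"
      using c(2)[OF \<open>x \<in> X\<close>] by (intro mult_right_mono mult_left_mono) (auto simp: norm_sgn)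
    finally show "norm (s x * h x) \<le> c x * norm (h x)" by simp
  qed
  finally show ?thesis .
qed

text \<open>
  Jensen's inequality: integrate the tangent of the power function at \<open>\<bar>a\<bar>\<close>; its linear term is
  nonnegative by the weighted bound with weight \<open>\<bar>a\<bar> powr (p - 1)\<close>.
\<close>

lemma cond_exp_contraction:
  assumes ce: "is_cond_exp n h a" and p: "1 \<le> p"
  shows "(\<Sum>x\<in>X. norm (a x) powr p) \<le> (\<Sum>x\<in>X. norm (h x) powr p)"
proof -
  have "(\<Sum>x\<in>X. norm (a x) powr (p - 1) * norm (a x)) \<le> (\<Sum>x\<in>X. norm (a x) powr (p - 1) * norm (h x))"
    using adapted_at_comp[OF is_cond_exp_adapted[OF ce], of "\<lambda>z. norm z powr (p - 1)"]
    by (intro cond_exp_weighted_norm_le[OF ce]) auto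
  then have "0 \<le> (\<Sum>x\<in>X. p * norm (a x) powr (p - 1) * (norm (h x) - norm (a x)))"
    using p by (simp add: right_diff_distrib sum_subtractf mult.assoc flip: sum_distrib_left)
  also have "\<dots> \<le> (\<Sum>x\<in>X. norm (h x) powr p - norm (a x) powr p)"
    using p powr_above_tangent by (intro sum_mono) (simp add: le_diff_eq add.commute)
  finally show ?thesis by (simp add: sum_subtractf)
qed

end

primrec running_max :: "(nat \<Rightarrow> 'a \<Rightarrow> complex) \<Rightarrow> nat \<Rightarrow> 'a \<Rightarrow> real" where
  "running_max f 0 x = norm (f 0 x)"
| "running_max f (Suc n) x = max (running_max f n x) (norm (f (Suc n) x))"

lemma norm_le_running_max: "norm (f n x) \<le> running_max f n x"
  by (cases n) auto

lemma running_max_nonneg: "0 \<le> running_max f n x"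
  by (meson norm_ge_zero norm_le_running_max order_trans)

definition doob_const :: "real \<Rightarrow> real" where
  "doob_const p = (2 * p / (p - 1)) powr p"

text \<open>
  The value that results from absorbing half of the \<open>p\<close>-th moment of the transform in
  \<open>transform_bound_ge2\<close>.
\<close>

definition transform_const_ge2 :: "real \<Rightarrow> real" where
  "transform_const_ge2 p = (10 * p\<^sup>2 * doob_const p) powr (p / 2)"

text \<open>
  For \<open>p < 2\<close> the constant is inherited from the conjugate exponent \<open>p / (p - 1) > 2\<close> by duality.
\<close>

definition transform_const :: "real \<Rightarrow> real" where
  "transform_const p =
     (if 2 \<le> p then transform_const_ge2 p
      else 2 * (2 * transform_const_ge2 (p / (p - 1))) powr (p - 1))"

definition transform :: "(nat \<Rightarrow> complex) \<Rightarrow> (nat \<Rightarrow> 'a \<Rightarrow> complex) \<Rightarrow> nat \<Rightarrow> 'a \<Rightarrow> complex" where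
  "transform w f n x = f 0 x + (\<Sum>j<n. w (Suc j) * (f (Suc j) x - f j x))"

context finite_filtration
begin

lemma running_max_adapted: "martingale f \<Longrightarrow> adapted_at n (running_max f n)"
proof (induction n)
  case 0
  have "running_max f 0 = (\<lambda>x. norm (f 0 x))" by auto
  then show ?case using adapted_at_comp[OF martingale_adapted[OF 0], of 0 norm] by simp
next
  case (Suc n)
  have "running_max f (Suc n) = (\<lambda>x. max (running_max f n x) (norm (f (Suc n) x)))" by auto
  then show ?case
    using adapted_at_comp2[OF adapted_at_mono[OF Suc.IH[OF Suc.prems]] martingale_adapted[OF Suc.prems],
        of "Suc n" "\<lambda>u v. max u (norm v)"] by simp
qed

text \<open>
  Doob's maximal inequality before its right-hand side is split. The induction on \<open>n\<close> uses two facts: where the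
  maximum increases it equals \<open>\<bar>f\<bar>\<close>, and the tangent inequality then bounds the increase of its \<open>p\<close>-th
  power; elsewhere nothing changes. The earlier weight \<open>running_max f n powr (p - 1)\<close> is known at stage \<open>n\<close>, so
  \<open>\<bar>f n\<bar>\<close> may be replaced by \<open>\<bar>f (Suc n)\<bar>\<close> against it.
\<close>

lemma doob_maximal_linear:
  assumes f: "martingale f" and p: "1 < p"
  shows "(p - 1) * (\<Sum>x\<in>X. running_max f n x powr p)
    \<le> p * (\<Sum>x\<in>X. running_max f n x powr (p - 1) * norm (f n x))"
proof (induction n)
  case 0
  have "running_max f 0 x powr p = running_max f 0 x powr (p - 1) * norm (f 0 x)" for x
    using powr_mult_base[of "norm (f 0 x)" "p - 1"] by (simp add: mult.commute)
  then have "(\<Sum>x\<in>X. running_max f 0 x powr (p - 1) * norm (f 0 x)) = (\<Sum>x\<in>X. running_max f 0 x powr p)"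
    by simp
  moreover have "0 \<le> (\<Sum>x\<in>X. running_max f 0 x powr p)" by (simp add: sum_nonneg)
  ultimately show ?case using p by (simp add: left_diff_distrib)
next
  case (Suc n)
  let ?M = "running_max f" and ?g = "\<lambda>x. norm (f (Suc n) x)"
  have step: "(p - 1) * (?M (Suc n) x powr p) \<le> (p - 1) * (?M n x powr p)
      + p * ((?M (Suc n) x powr (p - 1) - ?M n x powr (p - 1)) * ?g x)" for x
  proof (cases "?g x \<le> ?M n x")
    case False
    then have eq: "?M (Suc n) x = ?g x" by simp
    have t: "?M n x powr p + p * ?M n x powr (p - 1) * (?g x - ?M n x) \<le> ?g x powr p"
      using p running_max_nonneg[of f n x] by (intro powr_above_tangent) auto
    have a: "?M n x powr p = ?M n x powr (p - 1) * ?M n x"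
      using powr_mult_base[of "?M n x" "p - 1"] running_max_nonneg[of f n x] by (simp add: mult.commute)
    have b: "?g x powr p = ?g x powr (p - 1) * ?g x"
      using powr_mult_base[of "?g x" "p - 1"] by (simp add: mult.commute)
    show ?thesis using t unfolding eq a b by (simp add: algebra_simps)
  qed simp
  have "(\<Sum>x\<in>X. ?M n x powr (p - 1) * norm (f n x)) \<le> (\<Sum>x\<in>X. ?M n x powr (p - 1) * ?g x)"
    using f adapted_at_comp[OF running_max_adapted[OF f], of n "\<lambda>u. u powr (p - 1)"]
    by (intro cond_exp_weighted_norm_le[of n]) (auto simp: martingale_def)
  with Suc.IH p have IH: "(p - 1) * (\<Sum>x\<in>X. ?M n x powr p) \<le> p * (\<Sum>x\<in>X. ?M n x powr (p - 1) * ?g x)"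
    by (smt (verit) mult_left_mono)
  have "(p - 1) * (\<Sum>x\<in>X. ?M (Suc n) x powr p) \<le> (p - 1) * (\<Sum>x\<in>X. ?M n x powr p)
     + p * (\<Sum>x\<in>X. (?M (Suc n) x powr (p - 1) - ?M n x powr (p - 1)) * ?g x)"
    unfolding sum_distrib_left sum.distrib[symmetric] by (intro sum_mono step)
  also have "\<dots> \<le> p * (\<Sum>x\<in>X. ?M n x powr (p - 1) * ?g x)
     + p * (\<Sum>x\<in>X. (?M (Suc n) x powr (p - 1) - ?M n x powr (p - 1)) * ?g x)"
    using IH by simp
  also have "\<dots> = p * (\<Sum>x\<in>X. ?M (Suc n) x powr (p - 1) * ?g x)"
    by (simp only: left_diff_distrib sum_subtractf right_diff_distrib)
  finally show ?case .
qed

lemma doob_maximal: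
  assumes f: "martingale f" and p: "1 < p"
  shows "(\<Sum>x\<in>X. running_max f n x powr p) \<le> doob_const p * (\<Sum>x\<in>X. norm (f n x) powr p)"
proof -
  let ?M = "running_max f n"
  \<comment> \<open>With this \<open>\<delta>\<close> the term to be absorbed has coefficient \<open>p * \<delta> = (p - 1) / 2\<close>, half of that on the left.\<close>
  define \<delta> where "\<delta> = (p - 1) / (2 * p)"
  have \<delta>: "0 < \<delta>" using p by (simp add: \<delta>_def)
  have "(\<Sum>x\<in>X. ?M x powr (p - 1) * norm (f n x))
      \<le> (\<Sum>x\<in>X. \<delta> * ?M x powr p + \<delta> powr (1 - p) * norm (f n x) powr p)"
    using p \<delta> by (intro sum_mono young_scaled) (auto simp: running_max_nonneg)
  also have "\<dots> = \<delta> * (\<Sum>x\<in>X. ?M x powr p) + \<delta> powr (1 - p) * (\<Sum>x\<in>X. norm (f n x) powr p)"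
    by (simp add: sum.distrib sum_distrib_left)
  finally have *: "p * (\<Sum>x\<in>X. ?M x powr (p - 1) * norm (f n x))
     \<le> p * (\<delta> * (\<Sum>x\<in>X. ?M x powr p) + \<delta> powr (1 - p) * (\<Sum>x\<in>X. norm (f n x) powr p))"
    using p by (intro mult_left_mono) auto
  have "(p - 1) * (\<Sum>x\<in>X. ?M x powr p) \<le>
      (p - 1) / 2 * (\<Sum>x\<in>X. ?M x powr p) + p * \<delta> powr (1 - p) * (\<Sum>x\<in>X. norm (f n x) powr p)"
  proof -
    have "p * \<delta> = (p - 1) / 2" using p by (simp add: \<delta>_def)
    then have "p * (\<delta> * s + k * t) = (p - 1) / 2 * s + p * k * t" for s k t
      by (simp only: distrib_left mult.assoc[symmetric])
    then show ?thesis using doob_maximal_linear[OF f p, of n] * by simp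
  qed
  then have "(p - 1) / 2 * (\<Sum>x\<in>X. ?M x powr p) \<le> p * \<delta> powr (1 - p) * (\<Sum>x\<in>X. norm (f n x) powr p)"
    by (simp add: field_simps)
  then have "(\<Sum>x\<in>X. ?M x powr p) \<le> inverse \<delta> * \<delta> powr (1 - p) * (\<Sum>x\<in>X. norm (f n x) powr p)"
    using p by (simp add: \<delta>_def field_simps)
  also have "inverse \<delta> * \<delta> powr (1 - p) = inverse \<delta> powr p"
    using \<delta> by (simp add: powr_diff powr_divide inverse_eq_divide)
  also have "\<dots> = doob_const p" by (simp add: doob_const_def \<delta>_def)
  finally show ?thesis .
qed

lemma transform_martingale:
  assumes "martingale f"
  shows "martingale (transform w f)"
  unfolding martingale_def
proof
  fix n
  have ad: "adapted_at n (transform w f n)"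
  proof -
    have "adapted_at n (f j)" if "j \<le> n" for j
      using adapted_at_mono[OF martingale_adapted[OF assms]] that by auto
    then have e: "f j x = f j y" if "j \<le> n" "x \<in> X" "y \<in> X" "R n x = R n y" for j x y
      using that unfolding adapted_at_def by blast
    show ?thesis
      unfolding adapted_at_def
    proof (intro ballI impI)
      fix x y assume xy: "x \<in> X" "y \<in> X" "R n x = R n y"
      have "(\<Sum>j<n. w (Suc j) * (f (Suc j) x - f j x)) = (\<Sum>j<n. w (Suc j) * (f (Suc j) y - f j y))"
        using e[OF _ xy] by (intro sum.cong) (auto simp: Suc_leI)
      then show "transform w f n x = transform w f n y"
        using e[of 0, OF _ xy] by (simp add: transform_def)
    qed
  qed
  have ce: "is_cond_exp n (f (Suc n)) (f n)" using assms by (simp add: martingale_def)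
  show "is_cond_exp n (transform w f (Suc n)) (transform w f n)"
    unfolding is_cond_exp_def
  proof (intro conjI ad allI impI)
    fix c :: "'a \<Rightarrow> complex" assume c: "adapted_at n c"
    have "(\<Sum>x\<in>X. c x * transform w f (Suc n) x)
      = (\<Sum>x\<in>X. c x * transform w f n x)
        + w (Suc n) * ((\<Sum>x\<in>X. c x * f (Suc n) x) - (\<Sum>x\<in>X. c x * f n x))"
      by (simp add: transform_def algebra_simps sum.distrib sum_subtractf sum_distrib_left)
    then show "(\<Sum>x\<in>X. c x * transform w f (Suc n) x)
      = (\<Sum>x\<in>X. c x * transform w f n x)"
      using is_cond_expD[OF ce c] by simp
  qed
qed

lemma martingale_orthogonal:
  assumes f: "martingale f" and c: "adapted_at n c"
  shows "(\<Sum>x\<in>X. c x * (f (Suc n) x - f n x)) = 0"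
  using is_cond_expD[of n "f (Suc n)" "f n" c] f c
  by (simp add: martingale_def right_diff_distrib sum_subtractf)

text \<open>
  The cross term is a test of the increment against a function known at stage \<open>n\<close>.
\<close>

lemma martingale_square_increment:
  assumes f: "martingale f" and c: "adapted_at n (c :: 'a \<Rightarrow> real)"
  shows "(\<Sum>x\<in>X. c x * (norm (f (Suc n) x))\<^sup>2)
    = (\<Sum>x\<in>X. c x * (norm (f n x))\<^sup>2) + (\<Sum>x\<in>X. c x * (norm (f (Suc n) x - f n x))\<^sup>2)"
proof -
  have ad: "adapted_at n (\<lambda>x. of_real (c x) * cnj (f n x))"
    by (rule adapted_at_comp2[OF c martingale_adapted[OF f], of "\<lambda>u v. of_real u * cnj v"])
  have "(\<Sum>x\<in>X. c x * Re (cnj (f n x) * (f (Suc n) x - f n x)))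
     = Re (\<Sum>x\<in>X. of_real (c x) * cnj (f n x) * (f (Suc n) x - f n x))"
    by (simp add: mult.assoc)
  then have z: "(\<Sum>x\<in>X. c x * Re (cnj (f n x) * (f (Suc n) x - f n x))) = 0"
    using martingale_orthogonal[OF f ad] by simp
  have "(norm b)\<^sup>2 = (norm a)\<^sup>2 + 2 * Re (cnj a * (b - a)) + (norm (b - a))\<^sup>2" for a b :: complex
    unfolding cmod_power2 by (simp add: power2_eq_square algebra_simps)
  then have "(\<Sum>x\<in>X. c x * (norm (f (Suc n) x))\<^sup>2) = (\<Sum>x\<in>X. c x * ((norm (f n x))\<^sup>2
     + 2 * Re (cnj (f n x) * (f (Suc n) x - f n x)) + (norm (f (Suc n) x - f n x))\<^sup>2))"
    by (intro sum.cong refl arg_cong2[where f = "(*)"])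
  also have "\<dots> = (\<Sum>x\<in>X. c x * (norm (f n x))\<^sup>2)
     + 2 * (\<Sum>x\<in>X. c x * Re (cnj (f n x) * (f (Suc n) x - f n x)))
     + (\<Sum>x\<in>X. c x * (norm (f (Suc n) x - f n x))\<^sup>2)"
    by (simp only: distrib_left sum.distrib sum_distrib_left) (simp add: mult.left_commute)
  finally show ?thesis using z by simp
qed

end

section \<open>Boundedness of martingale transforms\<close>

context finite_filtration
begin

text \<open>
  The heart of the bound for martingale transforms. Let \<open>M\<close> and \<open>N\<close> be the running maxima of the
  transform \<open>g\<close> and of \<open>f\<close>. By the Taylor bound the \<open>p\<close>-th moment of \<open>g\<close> increases in one step by
  at most \<open>p\<^sup>2\<close> times the sum of \<open>M (Suc n) powr (p - 2) * d\<^sup>2\<close>, where \<open>d\<close> is the modulus of the increment of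
  \<open>f\<close>. The potential on the right increases by at least as much: against the weight
  \<open>M n powr (p - 2)\<close>, known at stage \<open>n\<close>, the sum of \<open>\<bar>f\<bar>\<^sup>2\<close> gains exactly that of \<open>d\<^sup>2\<close>, and the excess \<open>M (Suc n) powr (p - 2) - M n powr (p - 2)\<close> is covered by \<open>4 * N\<^sup>2\<close> because
  \<open>d \<le> 2 * N\<close>.
\<close>

lemma transform_potential:
  fixes p :: real
  assumes f: "martingale f" and p: "2 \<le> p" and w: "\<And>j. norm (w j) \<le> 1"
  defines "g \<equiv> transform w f"
  shows "(\<Sum>x\<in>X. norm (g n x) powr p)
    \<le> p\<^sup>2 * (\<Sum>x\<in>X. running_max g n x powr (p - 2) * ((norm (f n x))\<^sup>2 + 4 * (running_max f n x)\<^sup>2))"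
proof (induction n)
  case 0
  have "norm z powr p \<le> p\<^sup>2 * (norm z powr (p - 2) * ((norm z)\<^sup>2 + 4 * (norm z)\<^sup>2))" for z :: complex
  proof -
    have e: "norm z powr p = norm z powr (p - 2) * (norm z)\<^sup>2"
      by (cases "z = 0") (auto simp: powr_diff)
    have "1 * 1 \<le> p\<^sup>2 * 5" using p by (intro mult_mono) auto
    then have "1 * norm z powr p \<le> (p\<^sup>2 * 5) * norm z powr p" by (intro mult_right_mono) auto
    then show ?thesis unfolding e by (simp add: algebra_simps)
  qed
  then show ?case
    by (simp add: g_def transform_def sum_distrib_left sum_mono)
next
  case (Suc n)
  define M where "M = running_max g"
  define N where "N = running_max f"
  let ?W = "\<lambda>k x. M k x powr (p - 2)" and ?F = "\<lambda>k x. (norm (f k x))\<^sup>2"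
  define d where "d x = norm (f (Suc n) x - f n x)" for x
  have g: "martingale g" unfolding g_def by (rule transform_martingale[OF f])
  have inc: "g (Suc n) x - g n x = w (Suc n) * (f (Suc n) x - f n x)" for x
    by (simp add: g_def transform_def)
  have incd: "norm (g (Suc n) x - g n x) \<le> d x" for x
    unfolding inc norm_mult d_def using w[of "Suc n"] by (simp add: mult_left_le_one_le)
  have Mn: "0 \<le> M k x" "0 \<le> N k x" for k x by (simp_all add: M_def N_def running_max_nonneg)
  have Mmono: "M n x \<le> M (Suc n) x" "N n x \<le> N (Suc n) x" for x by (simp_all add: M_def N_def)
  have dN: "d x \<le> 2 * N (Suc n) x" for x
    using norm_triangle_ineq4[of "f (Suc n) x" "f n x"] norm_le_running_max[of f n x]
      norm_le_running_max[of f "Suc n" x] Mmono(2)[of x] unfolding d_def N_def by linarith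
  have lin: "(\<Sum>x\<in>X. norm (g n x) powr (p - 2) * Re (cnj (g n x) * (g (Suc n) x - g n x))) = 0"
  proof -
    have "adapted_at n (\<lambda>x. of_real (norm (g n x) powr (p - 2)) * cnj (g n x))"
      by (rule adapted_at_comp[OF martingale_adapted[OF g, of n], where \<phi> = "\<lambda>v. of_real (norm v powr (p - 2)) * cnj v"])
    from martingale_orthogonal[OF g this]
    have "Re (\<Sum>x\<in>X. of_real (norm (g n x) powr (p - 2)) * cnj (g n x) * (g (Suc n) x - g n x)) = 0"
      by simp
    then show ?thesis by (simp add: mult.assoc)
  qed
  have taylor: "norm (g (Suc n) x) powr p \<le> norm (g n x) powr p
      + p * (norm (g n x) powr (p - 2) * Re (cnj (g n x) * (g (Suc n) x - g n x)))
      + p\<^sup>2 * (?W (Suc n) x * (d x)\<^sup>2)" for x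
  proof -
    have "norm (g (Suc n) x) powr p \<le> norm (g n x) powr p
      + p * norm (g n x) powr (p - 2) * Re (cnj (g n x) * (g (Suc n) x - g n x))
      + p\<^sup>2 * ?W (Suc n) x * (norm (g (Suc n) x - g n x))\<^sup>2"
      using Mmono(1)[of x] norm_le_running_max[of g n x] norm_le_running_max[of g "Suc n" x]
      unfolding M_def by (intro norm_powr_taylor[OF p]) auto
    moreover have "p\<^sup>2 * ?W (Suc n) x * (norm (g (Suc n) x - g n x))\<^sup>2
       \<le> p\<^sup>2 * ?W (Suc n) x * (d x)\<^sup>2"
      using incd[of x] by (intro mult_left_mono power_mono) auto
    ultimately show ?thesis by (simp only: mult.assoc)
  qed
  have "(\<Sum>x\<in>X. norm (g (Suc n) x) powr p) \<le> (\<Sum>x\<in>X. norm (g n x) powr p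
      + p * (norm (g n x) powr (p - 2) * Re (cnj (g n x) * (g (Suc n) x - g n x)))
      + p\<^sup>2 * (?W (Suc n) x * (d x)\<^sup>2))"
    by (intro sum_mono taylor)
  also have "\<dots> = (\<Sum>x\<in>X. norm (g n x) powr p) + p\<^sup>2 * (\<Sum>x\<in>X. ?W (Suc n) x * (d x)\<^sup>2)"
    by (simp only: sum.distrib sum_distrib_left[symmetric] lin)
  also have "\<dots> \<le> p\<^sup>2 * (\<Sum>x\<in>X. ?W n x * (?F n x + 4 * (N n x)\<^sup>2))
      + p\<^sup>2 * (\<Sum>x\<in>X. ?W (Suc n) x * (d x)\<^sup>2)"
    using Suc.IH unfolding M_def N_def by simp
  also have "\<dots> = p\<^sup>2 * ((\<Sum>x\<in>X. ?W n x * ?F n x)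
      + 4 * (\<Sum>x\<in>X. ?W n x * (N n x)\<^sup>2) + (\<Sum>x\<in>X. ?W (Suc n) x * (d x)\<^sup>2))"
    by (simp add: distrib_left sum.distrib sum_distrib_left mult_ac)
  also have "(\<Sum>x\<in>X. ?W n x * ?F n x)
     = (\<Sum>x\<in>X. ?W n x * ?F (Suc n) x) - (\<Sum>x\<in>X. ?W n x * (d x)\<^sup>2)"
  proof -
    have "adapted_at n (\<lambda>x. ?W n x)"
      unfolding M_def by (rule adapted_at_comp[OF running_max_adapted[OF g]])
    from martingale_square_increment[OF f this] show ?thesis unfolding d_def by simp
  qed
  also have "(\<Sum>x\<in>X. ?W n x * ?F (Suc n) x) - (\<Sum>x\<in>X. ?W n x * (d x)\<^sup>2)
      + 4 * (\<Sum>x\<in>X. ?W n x * (N n x)\<^sup>2) + (\<Sum>x\<in>X. ?W (Suc n) x * (d x)\<^sup>2)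
      \<le> (\<Sum>x\<in>X. ?W (Suc n) x * (?F (Suc n) x + 4 * (N (Suc n) x)\<^sup>2))"
  proof -
    have "?W n x * ?F (Suc n) x - ?W n x * (d x)\<^sup>2
      + 4 * (?W n x * (N n x)\<^sup>2) + ?W (Suc n) x * (d x)\<^sup>2
      \<le> ?W (Suc n) x * (?F (Suc n) x + 4 * (N (Suc n) x)\<^sup>2)" for x
    proof -
      define A B where "A = ?W n x" and "B = ?W (Suc n) x"
      have AB: "0 \<le> A" "A \<le> B" unfolding A_def B_def
        using Mn(1)[of n x] Mmono(1)[of x] p by (auto intro: powr_mono2)
      have "A * ?F (Suc n) x \<le> B * ?F (Suc n) x"
        using AB by (intro mult_right_mono) auto
      moreover have "A * (N n x)\<^sup>2 \<le> A * (N (Suc n) x)\<^sup>2"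
        using AB Mmono(2)[of x] Mn by (intro mult_left_mono power_mono) auto
      moreover have "(B - A) * (d x)\<^sup>2 \<le> (B - A) * (2 * N (Suc n) x)\<^sup>2"
        using AB dN[of x] by (intro mult_left_mono power_mono) (auto simp: d_def)
      ultimately show ?thesis unfolding A_def[symmetric] B_def[symmetric]
        by (simp add: algebra_simps)
    qed
    then have "(\<Sum>x\<in>X. ?W n x * ?F (Suc n) x - ?W n x * (d x)\<^sup>2
      + 4 * (?W n x * (N n x)\<^sup>2) + ?W (Suc n) x * (d x)\<^sup>2)
      \<le> (\<Sum>x\<in>X. ?W (Suc n) x * (?F (Suc n) x + 4 * (N (Suc n) x)\<^sup>2))"
      by (intro sum_mono)
    then show ?thesis by (simp only: sum.distrib sum_subtractf sum_distrib_left)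
  qed
  finally show ?case unfolding M_def N_def by (simp add: mult_left_mono)
qed

text \<open>
  The potential is at most \<open>5 * M powr (p - 2) * N\<^sup>2\<close>. Splitting it by Young's inequality and applying the maximal
  inequality to \<open>g\<close> and to \<open>f\<close> leaves half of the \<open>p\<close>-th moment of \<open>g\<close> on the right.
\<close>

lemma transform_bound_ge2:
  assumes f: "martingale f" and p: "2 \<le> p" and w: "\<And>j. norm (w j) \<le> 1"
  shows "(\<Sum>x\<in>X. norm (transform w f n x) powr p)
    \<le> transform_const_ge2 p * (\<Sum>x\<in>X. norm (f n x) powr p)"
proof -
  define g where "g = transform w f"
  define D where "D = doob_const p"
  \<comment> \<open>Chosen so that \<open>5 * p\<^sup>2 * \<delta>\<^sup>2 * D = 1/2\<close>.\<close>
  define \<delta> where "\<delta> = (10 * p\<^sup>2 * D) powr (- (1/2))"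
  have D: "0 < D" using p by (simp add: D_def doob_const_def)
  have pos: "0 < 10 * p\<^sup>2 * D" using D p by simp
  have \<delta>: "0 < \<delta>" using D p by (simp add: \<delta>_def)
  have \<delta>2: "\<delta>\<^sup>2 = 1 / (10 * p\<^sup>2 * D)"
  proof -
    have "\<delta>\<^sup>2 = (10 * p\<^sup>2 * D) powr (- 1)"
      unfolding \<delta>_def power2_eq_square powr_add[symmetric] by simp
    then show ?thesis using pos by (simp only: powr_minus_divide powr_one less_imp_le)
  qed
  define S T where "S = (\<Sum>x\<in>X. norm (g n x) powr p)" and "T = (\<Sum>x\<in>X. norm (f n x) powr p)"
  have Mg: "(\<Sum>x\<in>X. running_max g n x powr p) \<le> D * S"
    unfolding S_def D_def g_def using p by (intro doob_maximal transform_martingale f) auto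
  have Nf: "(\<Sum>x\<in>X. running_max f n x powr p) \<le> D * T"
    unfolding T_def D_def using p by (intro doob_maximal f) auto
  have "S \<le> p\<^sup>2 * (\<Sum>x\<in>X. running_max g n x powr (p - 2) * ((norm (f n x))\<^sup>2 + 4 * (running_max f n x)\<^sup>2))"
    unfolding S_def g_def by (rule transform_potential[OF f p w])
  also have "\<dots> \<le> p\<^sup>2 * (\<Sum>x\<in>X. 5 * \<delta>\<^sup>2 * running_max g n x powr p + 5 * \<delta> powr (2 - p) * running_max f n x powr p)"
  proof (intro mult_left_mono sum_mono)
    fix x
    have "running_max g n x powr (p - 2) * ((norm (f n x))\<^sup>2 + 4 * (running_max f n x)\<^sup>2)
      \<le> running_max g n x powr (p - 2) * ((running_max f n x)\<^sup>2 + 4 * (running_max f n x)\<^sup>2)"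
      by (intro mult_left_mono add_mono power_mono norm_le_running_max) (auto simp: running_max_nonneg)
    also have "\<dots> = 5 * (running_max g n x powr (p - 2) * (running_max f n x)\<^sup>2)" by simp
    also have "\<dots> \<le> 5 * (\<delta>\<^sup>2 * running_max g n x powr p + \<delta> powr (2 - p) * running_max f n x powr p)"
      using p \<delta> by (intro mult_left_mono young_scaled_square) (auto simp: running_max_nonneg)
    finally show "running_max g n x powr (p - 2) * ((norm (f n x))\<^sup>2 + 4 * (running_max f n x)\<^sup>2)
      \<le> 5 * \<delta>\<^sup>2 * running_max g n x powr p + 5 * \<delta> powr (2 - p) * running_max f n x powr p" by simp
  qed auto
  also have "\<dots> = 5 * p\<^sup>2 * \<delta>\<^sup>2 * (\<Sum>x\<in>X. running_max g n x powr p)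
      + 5 * p\<^sup>2 * \<delta> powr (2 - p) * (\<Sum>x\<in>X. running_max f n x powr p)"
    by (simp only: sum.distrib sum_distrib_left distrib_left) (simp add: mult_ac)
  also have "\<dots> \<le> 5 * p\<^sup>2 * \<delta>\<^sup>2 * (D * S) + 5 * p\<^sup>2 * \<delta> powr (2 - p) * (D * T)"
    using Mg Nf by (intro add_mono mult_left_mono) auto
  also have "5 * p\<^sup>2 * \<delta>\<^sup>2 * (D * S) = S / 2"
    unfolding \<delta>2 using D p by (simp add: field_simps)
  finally have "S \<le> (10 * p\<^sup>2 * D) * \<delta> powr (2 - p) * T" by (simp add: field_simps)
  also have "(10 * p\<^sup>2 * D) * \<delta> powr (2 - p) = (10 * p\<^sup>2 * D) powr 1 * (10 * p\<^sup>2 * D) powr (- (1/2) * (2 - p))"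
    using pos by (simp add: \<delta>_def powr_powr)
  also have "\<dots> = transform_const_ge2 p"
    unfolding transform_const_ge2_def D_def[symmetric] powr_add[symmetric] by (simp add: field_simps)
  finally show ?thesis by (simp add: S_def T_def g_def)
qed

definition cond_exp :: "nat \<Rightarrow> ('a \<Rightarrow> complex) \<Rightarrow> 'a \<Rightarrow> complex" where
  "cond_exp n h x = (\<Sum>y | y \<in> X \<and> R n y = R n x. h y) / of_nat (card {y \<in> X. R n y = R n x})"

lemma cond_exp_is_cond_exp: "is_cond_exp n h (cond_exp n h)"
  unfolding is_cond_exp_def
proof (intro conjI allI impI)
  show "adapted_at n (cond_exp n h)" by (simp add: adapted_at_def cond_exp_def)
next
  fix c :: "'a \<Rightarrow> complex" assume c: "adapted_at n c"
  define N where "N x = card {y \<in> X. R n y = R n x}" for x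
  have N: "N x \<noteq> 0" if "x \<in> X" for x
    using that finite_X by (auto simp: N_def card_eq_0_iff)
  let ?t = "\<lambda>x y. c x * h y / of_nat (N x)"
  have "(\<Sum>x\<in>X. c x * cond_exp n h x)
     = (\<Sum>x\<in>X. \<Sum>y | y \<in> X \<and> R n y = R n x. ?t x y)"
    by (simp add: cond_exp_def N_def sum_distrib_left sum_divide_distrib)
  also have "\<dots> = (\<Sum>y\<in>X. \<Sum>x | x \<in> X \<and> R n y = R n x. ?t x y)"
    by (subst sum.swap_restrict[OF finite_X finite_X]) (rule refl)
  also have "\<dots> = (\<Sum>y\<in>X. c y * h y)"
  proof (rule sum.cong[OF refl])
    fix y assume y: "y \<in> X"
    have "(\<Sum>x | x \<in> X \<and> R n y = R n x. ?t x y)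
       = (\<Sum>x | x \<in> X \<and> R n y = R n x. c y * h y / of_nat (N y))"
    proof (rule sum.cong[OF refl])
      fix x assume "x \<in> {x \<in> X. R n y = R n x}"
      then have x: "x \<in> X" "R n y = R n x" by auto
      then have "N x = N y" by (simp add: N_def)
      moreover have "c x = c y" using adapted_atD[OF c x(1) y] x(2) by simp
      ultimately show "?t x y = c y * h y / of_nat (N y)" by simp
    qed
    also have "\<dots> = of_nat (card {x \<in> X. R n y = R n x}) * (c y * h y / of_nat (N y))" by simp
    also have "card {x \<in> X. R n y = R n x} = N y" by (simp add: N_def eq_commute)
    finally show "(\<Sum>x | x \<in> X \<and> R n y = R n x. ?t x y) = c y * h y"
      using N[OF y] by simp
  qed
  finally show "(\<Sum>x\<in>X. c x * h x) = (\<Sum>x\<in>X. c x * cond_exp n h x)" by simp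
qed

lemma cond_exp_martingale: "martingale (\<lambda>n. cond_exp n h)"
  unfolding martingale_def is_cond_exp_def
proof (intro allI conjI impI)
  fix n and c :: "'a \<Rightarrow> complex" assume c: "adapted_at n c"
  show "(\<Sum>x\<in>X. c x * cond_exp (Suc n) h x) = (\<Sum>x\<in>X. c x * cond_exp n h x)"
    using is_cond_expD[OF cond_exp_is_cond_exp[of n h] c]
      is_cond_expD[OF cond_exp_is_cond_exp[of "Suc n" h] adapted_at_mono[OF c, of "Suc n"]] by simp
qed (rule is_cond_exp_adapted[OF cond_exp_is_cond_exp])

lemma cond_exp_adapted:
  assumes "adapted_at n h" "x \<in> X"
  shows "cond_exp n h x = h x"
proof -
  have "(\<Sum>y | y \<in> X \<and> R n y = R n x. h y) = (\<Sum>y | y \<in> X \<and> R n y = R n x. h x)"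
    using adapted_atD[OF assms(1) _ assms(2)] by (intro sum.cong refl) auto
  moreover have "card {y \<in> X. R n y = R n x} \<noteq> 0" using assms finite_X by (auto simp: card_eq_0_iff)
  ultimately show ?thesis by (simp add: cond_exp_def)
qed

text \<open>
  Both sides pair increments of the same index only, since increments of different index are orthogonal.
\<close>

lemma transform_symmetric:
  assumes f: "martingale f" and g: "martingale g"
  shows "(\<Sum>x\<in>X. transform w f n x * g n x) = (\<Sum>x\<in>X. f n x * transform w g n x)"
proof (induction n)
  case 0
  show ?case by (simp add: transform_def)
next
  case (Suc n)
  let ?T = "transform w"
  define df dg where "df x = f (Suc n) x - f n x" and "dg x = g (Suc n) x - g n x" for x
  have T: "adapted_at n (?T f n)" "adapted_at n (?T g n)"
    using martingale_adapted[OF transform_martingale] f g by auto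
  have z: "(\<Sum>x\<in>X. ?T f n x * dg x) = 0" "(\<Sum>x\<in>X. g n x * df x) = 0"
    "(\<Sum>x\<in>X. f n x * dg x) = 0" "(\<Sum>x\<in>X. ?T g n x * df x) = 0"
    unfolding df_def dg_def using T martingale_adapted f g by (auto intro!: martingale_orthogonal)
  have s: "?T f (Suc n) x = ?T f n x + w (Suc n) * df x" "?T g (Suc n) x = ?T g n x + w (Suc n) * dg x"
    "f (Suc n) x = f n x + df x" "g (Suc n) x = g n x + dg x" for x
    by (simp_all add: transform_def df_def dg_def)
  have "(\<Sum>x\<in>X. ?T f (Suc n) x * g (Suc n) x) = (\<Sum>x\<in>X. ?T f n x * g n x) + (\<Sum>x\<in>X. ?T f n x * dg x)
     + w (Suc n) * (\<Sum>x\<in>X. g n x * df x) + w (Suc n) * (\<Sum>x\<in>X. df x * dg x)"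
    unfolding s by (simp add: algebra_simps sum.distrib sum_distrib_left)
  moreover have "(\<Sum>x\<in>X. f (Suc n) x * ?T g (Suc n) x) = (\<Sum>x\<in>X. f n x * ?T g n x) + (\<Sum>x\<in>X. ?T g n x * df x)
     + w (Suc n) * (\<Sum>x\<in>X. f n x * dg x) + w (Suc n) * (\<Sum>x\<in>X. df x * dg x)"
    unfolding s by (simp add: algebra_simps sum.distrib sum_distrib_left)
  ultimately show ?case using Suc.IH z by simp
qed

text \<open>
  Duality: pair the transform \<open>h\<close> with \<open>\<psi> = cnj (sgn h) * \<bar>h\<bar> powr (p - 1)\<close>, whose conjugate moment equals the
  \<open>p\<close>-th moment of \<open>h\<close>, and move the transform onto \<open>\<psi>\<close>, regarded as the last term of a martingale.
\<close>

lemma transform_bound_lt2: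
  assumes f: "martingale f" and p: "1 < p" "p < 2" and w: "\<And>j. norm (w j) \<le> 1"
  shows "(\<Sum>x\<in>X. norm (transform w f n x) powr p)
    \<le> 2 * (2 * transform_const_ge2 (p / (p - 1))) powr (p - 1) * (\<Sum>x\<in>X. norm (f n x) powr p)"
proof -
  define p' where "p' = p / (p - 1)"
  have p': "2 \<le> p'" using p by (simp add: p'_def field_simps)
  define K where "K = transform_const_ge2 p'"
  have K: "0 < K" using p' by (simp add: K_def transform_const_ge2_def doob_const_def)
  define \<delta> where "\<delta> = 1 / (2 * K)"
  have \<delta>: "0 < \<delta>" using K by (simp add: \<delta>_def)
  define h where "h = transform w f n"
  define \<psi> where "\<psi> x = cnj (sgn (h x)) * of_real (norm (h x) powr (p - 1))" for x
  define G where "G = (\<lambda>k. cond_exp k \<psi>)"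
  have G: "martingale G" unfolding G_def by (rule cond_exp_martingale)
  have h: "adapted_at n h" unfolding h_def
    by (rule martingale_adapted[OF transform_martingale[OF f]])
  have "adapted_at n \<psi>" unfolding \<psi>_def
    by (rule adapted_at_comp[OF h, of "\<lambda>v. cnj (sgn v) * of_real (norm v powr (p - 1))"])
  then have Gn: "G n x = \<psi> x" if "x \<in> X" for x using that by (simp add: G_def cond_exp_adapted)
  have h\<psi>: "h x * \<psi> x = of_real (norm (h x) powr p)" for x
  proof -
    have "z * cnj (sgn z) = of_real (norm z)" for z :: complex
      by (simp add: sgn_eq complex_norm_square[symmetric] power2_eq_square)
    then have "h x * \<psi> x = of_real (norm (h x) * norm (h x) powr (p - 1))"
      by (simp add: \<psi>_def mult.assoc[symmetric])
    also have "norm (h x) * norm (h x) powr (p - 1) = norm (h x) powr p"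
      using powr_mult_base[of "norm (h x)" "p - 1"] by simp
    finally show ?thesis .
  qed
  have n\<psi>: "norm (\<psi> x) powr p' = norm (h x) powr p" for x
    using p by (cases "h x = 0") (auto simp: \<psi>_def norm_mult norm_sgn powr_powr p'_def)
  define S where "S = (\<Sum>x\<in>X. norm (h x) powr p)"
  define V where "V = transform w G n"
  have "of_real S = (\<Sum>x\<in>X. h x * G n x)"
    unfolding S_def of_real_sum by (intro sum.cong) (auto simp: Gn h\<psi>)
  also have "\<dots> = (\<Sum>x\<in>X. f n x * V x)"
    unfolding h_def V_def by (rule transform_symmetric[OF f G])
  finally have "S \<le> norm (\<Sum>x\<in>X. f n x * V x)"
    by (metis abs_ge_self norm_of_real)
  also have "\<dots> \<le> (\<Sum>x\<in>X. norm (V x) * norm (f n x))"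
    by (intro sum_norm_le) (simp add: norm_mult)
  also have "\<dots> \<le> (\<Sum>x\<in>X. \<delta> * norm (V x) powr p' + \<delta> powr (1 - p) * norm (f n x) powr p)"
  proof (intro sum_mono)
    fix x
    \<comment> \<open>The exponent \<open>1 / (p - 1)\<close> makes the \<open>p\<close>-th power of the left factor the conjugate power \<open>p'\<close> of \<open>V\<close>.\<close>
    have "(norm (V x) powr (1 / (p - 1))) powr (p - 1) * norm (f n x)
      \<le> \<delta> * (norm (V x) powr (1 / (p - 1))) powr p + \<delta> powr (1 - p) * norm (f n x) powr p"
      using p \<delta> by (intro young_scaled) auto
    then show "norm (V x) * norm (f n x) \<le> \<delta> * norm (V x) powr p' + \<delta> powr (1 - p) * norm (f n x) powr p"
      using p by (simp add: powr_powr p'_def)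
  qed
  also have "\<dots> = \<delta> * (\<Sum>x\<in>X. norm (V x) powr p') + \<delta> powr (1 - p) * (\<Sum>x\<in>X. norm (f n x) powr p)"
    by (simp add: sum.distrib sum_distrib_left)
  also have "(\<Sum>x\<in>X. norm (V x) powr p') \<le> K * (\<Sum>x\<in>X. norm (G n x) powr p')"
    unfolding K_def V_def by (rule transform_bound_ge2[OF G p' w])
  also have "(\<Sum>x\<in>X. norm (G n x) powr p') = S"
    unfolding S_def by (intro sum.cong) (auto simp: Gn n\<psi>)
  also have "\<delta> * (K * S) = S / 2" using K by (simp add: \<delta>_def)
  finally have "S \<le> 2 * \<delta> powr (1 - p) * (\<Sum>x\<in>X. norm (f n x) powr p)"
    using \<delta> by simp
  also have "\<delta> powr (1 - p) = (2 * K) powr (p - 1)"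
    using K by (simp add: \<delta>_def powr_divide powr_diff)
  finally show ?thesis by (simp add: S_def h_def K_def p'_def)
qed

lemma transform_bound:
  assumes "martingale f" "1 < p" "\<And>j. norm (w j) \<le> 1"
  shows "(\<Sum>x\<in>X. norm (transform w f n x) powr p)
    \<le> transform_const p * (\<Sum>x\<in>X. norm (f n x) powr p)"
  using transform_bound_ge2[OF assms(1) _ assms(3)] transform_bound_lt2[OF assms(1,2) _ assms(3)]
  by (auto simp: transform_const_def not_le)

text \<open>
  Summed over \<open>X\<close>, the linear term of the tangent at \<open>a\<close> vanishes; what remains of the gap is the difference
  of the two convex means.
\<close>

lemma cond_exp_L1_distance:
  fixes \<delta> B r :: real
  assumes ce: "is_cond_exp n h a" and \<delta>: "0 < \<delta>" and R: "1 \<le> B" and r: "1 < r"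
  shows "(\<Sum>x\<in>X. norm (h x - a x)) \<le> \<delta> * card X
     + 2 * B ^ 3 / \<delta> * ((\<Sum>x\<in>X. sqrt (1 + (norm (h x))\<^sup>2)) - (\<Sum>x\<in>X. sqrt (1 + (norm (a x))\<^sup>2)))
     + 2 * B powr (1 - r) * (\<Sum>x\<in>X. sqrt (1 + (norm (a x))\<^sup>2) powr r + sqrt (1 + (norm (h x))\<^sup>2) powr r)"
proof -
  let ?s = "\<lambda>z::complex. sqrt (1 + (norm z)\<^sup>2)"
  define S where "S a = (\<Sum>x\<in>X. ?s (a x))" for a
  have "adapted_at n (\<lambda>x. cnj (a x) / of_real (?s (a x)))"
    by (rule adapted_at_comp[OF is_cond_exp_adapted[OF ce], of "\<lambda>z. cnj z / of_real (?s z)"])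
  from is_cond_expD[OF ce this]
  have "(\<Sum>x\<in>X. cnj (a x) / of_real (?s (a x)) * (h x - a x)) = 0"
    by (simp only: right_diff_distrib sum_subtractf diff_self)
  then have "Re (\<Sum>x\<in>X. cnj (a x) / of_real (?s (a x)) * (h x - a x)) = 0" by simp
  moreover have "Re (cnj u / of_real t * v) = Re (cnj u * v) / t" for u v :: complex and t :: real
    by (metis Re_divide_of_real times_divide_eq_left)
  ultimately have z: "(\<Sum>x\<in>X. Re (cnj (a x) * (h x - a x)) / ?s (a x)) = 0"
    by (simp only: Re_sum)
  have "(\<Sum>x\<in>X. norm (h x - a x)) \<le> (\<Sum>x\<in>X. \<delta> + 2 * B ^ 3 / \<delta>
      * (?s (h x) - ?s (a x) - Re (cnj (a x) * (h x - a x)) / ?s (a x))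
      + 2 * B powr (1 - r) * (?s (a x) powr r + ?s (h x) powr r))"
    by (intro sum_mono norm_le_sqrt_bregman \<delta> R r)
  also have "\<dots> = (\<Sum>x\<in>X. \<delta>) + 2 * B ^ 3 / \<delta> * (S h - S a
      - (\<Sum>x\<in>X. Re (cnj (a x) * (h x - a x)) / ?s (a x)))
     + 2 * B powr (1 - r) * (\<Sum>x\<in>X. ?s (a x) powr r + ?s (h x) powr r)"
    by (simp only: sum.distrib sum_distrib_left[symmetric] sum_subtractf S_def)
  also have "(\<Sum>x\<in>X. \<delta>) = \<delta> * card X" by simp
  finally show ?thesis unfolding z diff_0_right S_def .
qed

end

section \<open>The homogeneous tree as a rooted tree\<close>

text \<open>
  Rooting the tree at \<open>x0\<close> gives every other vertex a unique parent, after which all the geometry is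
  expressed by levels, parents and ancestors.
\<close>

locale rooted_tree =
  fixes q :: nat and adj :: "'v \<Rightarrow> 'v \<Rightarrow> bool" and x0 :: 'v
  assumes q_ge_2: "2 \<le> q" and tree: "homogeneous_tree q adj"
begin

abbreviation level :: "'v \<Rightarrow> nat" where "level \<equiv> gdist adj x0"

lemma adj_sym: "adj x y \<Longrightarrow> adj y x"
  using tree by (auto simp: homogeneous_tree_def dest: sympD)

lemma adj_irrefl: "\<not> adj x x"
  using tree by (auto simp: homogeneous_tree_def dest: irreflpD)

lemma no_cycle: "\<not> is_cycle adj xs"
  using tree by (auto simp: homogeneous_tree_def)

lemma card_neighbours: "card {y. adj x y} = q + 1"
  using tree by (auto simp: homogeneous_tree_def)

lemma finite_neighbours: "finite {y. adj x y}"
  using card_neighbours[of x] by (intro card_ge_0_finite) simp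

lemma gdist_walk: "(adj ^^ gdist adj x y) x y"
proof -
  have "\<exists>n. (adj ^^ n) x y"
    using tree by (auto simp: homogeneous_tree_def intro: rtranclp_imp_relpowp)
  then show ?thesis unfolding gdist_def by (rule LeastI_ex)
qed

lemma gdist_le: "(adj ^^ n) x y \<Longrightarrow> gdist adj x y \<le> n"
  unfolding gdist_def by (rule Least_le)

lemma gdist_self [simp]: "gdist adj x x = 0"
  using gdist_le[of 0 x x] by simp

lemma gdist_eq_0_iff [simp]: "gdist adj x y = 0 \<longleftrightarrow> x = y"
  using gdist_walk[of x y] by auto

lemma gdist_triangle: "gdist adj x z \<le> gdist adj x y + gdist adj y z"
  by (rule gdist_le) (meson gdist_walk relpowp_trans)

lemma gdist_adj: "adj x y \<Longrightarrow> gdist adj x y = 1"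
proof -
  assume a: "adj x y"
  then have "gdist adj x y \<le> 1" by (intro gdist_le) auto
  moreover have "x \<noteq> y" using a adj_irrefl by auto
  ultimately show ?thesis using gdist_eq_0_iff[of x y] by linarith
qed

lemma gdist_eq_1_iff: "gdist adj x y = 1 \<longleftrightarrow> adj x y"
  using gdist_adj gdist_walk[of x y] by auto

lemma level_le_Suc: "adj x y \<Longrightarrow> level y \<le> Suc (level x)"
  using gdist_triangle[of x0 y x] gdist_adj by fastforce

lemma ex_lower_neighbour:
  assumes "level x = Suc n"
  shows "\<exists>y. adj y x \<and> level y = n"
proof -
  have "(adj ^^ Suc n) x0 x" using gdist_walk[of x0 x] assms by simp
  then obtain y where y: "(adj ^^ n) x0 y" "adj y x" by (rule relpowp_Suc_E)
  then have "level y \<le> n" by (intro gdist_le)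
  moreover have "level x \<le> Suc (level y)" using y level_le_Suc by auto
  ultimately show ?thesis using y assms by auto
qed

text \<open>
  Two vertices of the same level are joined by a path through lower levels: go down to the parents, and
  continue from there if these are different. Closing such a path up would produce a cycle.
\<close>

lemma path_below_level:
  assumes "level x = n" "level y = n" "x \<noteq> y"
  shows "\<exists>ys. ys \<noteq> [] \<and> distinct ys \<and> successively adj (x # ys @ [y]) \<and> (\<forall>v\<in>set ys. level v < n)"
  using assms
proof (induction n arbitrary: x y)
  case 0
  then show ?case using gdist_eq_0_iff[of x0 x] gdist_eq_0_iff[of x0 y] by auto
next
  case (Suc n)
  obtain a where a: "adj a x" "level a = n" using ex_lower_neighbour Suc.prems by blast
  obtain b where b: "adj b y" "level b = n" using ex_lower_neighbour Suc.prems by blast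
  show ?case
  proof (cases "a = b")
    case True
    then show ?thesis using a b adj_sym by (intro exI[of _ "[a]"]) auto
  next
    case False
    from Suc.IH[OF a(2) b(2) False] obtain ys where ys: "ys \<noteq> []" "distinct ys"
      "successively adj (a # ys @ [b])" "\<forall>v\<in>set ys. level v < n" by blast
    have "successively adj (x # (a # ys @ [b]) @ [y])"
      using ys(3) a b adj_sym
      by (auto simp: successively_Cons successively_append_iff hd_append split: if_splits)
    moreover have "distinct (a # ys @ [b])" using ys a b False by auto
    moreover have "\<forall>v\<in>set (a # ys @ [b]). level v < Suc n" using ys a b by auto
    ultimately show ?thesis by blast
  qed
qed

text \<open>
  An edge inside a level would close the path of \<open>path_below_level\<close> to a cycle.
\<close>

lemma adj_level_neq:
  assumes "adj x y" shows "level x \<noteq> level y"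
proof
  assume eq: "level x = level y"
  have "x \<noteq> y" using assms adj_irrefl by auto
  from path_below_level[OF refl eq[symmetric] this] obtain ys where
    "ys \<noteq> []" "distinct ys" "successively adj (x # ys @ [y])" "\<forall>v\<in>set ys. level v < level x"
    by blast
  then have "is_cycle adj (x # ys @ [y])"
    using eq adj_sym[OF assms] \<open>x \<noteq> y\<close> by (cases ys) (auto simp: is_cycle_def)
  then show False using no_cycle by blast
qed

text \<open>
  Two lower neighbours of \<open>z\<close> would close the path of \<open>path_below_level\<close> between them to a cycle
  through \<open>z\<close>.
\<close>

lemma lower_neighbour_unique:
  assumes "adj x z" "adj y z" "level z = Suc (level x)" "level z = Suc (level y)"
  shows "x = y"
proof (rule ccontr)
  assume "x \<noteq> y"
  from path_below_level[OF refl _ this] assms obtain ys where ys: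
    "ys \<noteq> []" "distinct ys" "successively adj (x # ys @ [y])" "\<forall>v\<in>set ys. level v < level x"
    by auto
  then have "is_cycle adj (z # x # ys @ [y])"
    using assms adj_sym \<open>x \<noteq> y\<close> adj_irrefl by (auto simp: is_cycle_def)
  then show False using no_cycle by blast
qed

definition par :: "'v \<Rightarrow> 'v" where
  "par x = (SOME y. adj y x \<and> level x = Suc (level y))"

definition children :: "'v \<Rightarrow> 'v set" where
  "children x = {y. adj x y \<and> level y = Suc (level x)}"

lemma par_props: "x \<noteq> x0 \<Longrightarrow> adj (par x) x \<and> level x = Suc (level (par x))"
  unfolding par_def
proof (rule someI_ex)
  assume "x \<noteq> x0"
  then obtain n where "level x = Suc n" using gdist_eq_0_iff[of x0 x] by (cases "level x") auto
  then show "\<exists>y. adj y x \<and> level x = Suc (level y)" using ex_lower_neighbour by metis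
qed

lemma par_eqI: "adj y x \<Longrightarrow> level x = Suc (level y) \<Longrightarrow> par x = y"
  using par_props[of x] lower_neighbour_unique gdist_self[of x0] by (metis nat.distinct(1))

lemma children_iff: "y \<in> children x \<longleftrightarrow> y \<noteq> x0 \<and> par y = x"
  unfolding children_def using par_props[of y] par_eqI[of x y] gdist_self[of x0] by auto

lemma level_child: "y \<in> children x \<Longrightarrow> level y = Suc (level x)"
  by (simp add: children_def)

lemma adj_iff: "adj x y \<longleftrightarrow> y \<in> children x \<or> x \<in> children y"
  using level_le_Suc[of x y] level_le_Suc[of y x] adj_level_neq[of x y] adj_sym
  unfolding children_def by fastforce

lemma neighbours_eq: "{y. adj x y} = children x \<union> (if x = x0 then {} else {par x})"

proof (intro set_eqI)
  fix y
  have "adj x y \<longleftrightarrow> y \<in> children x \<or> (x \<noteq> x0 \<and> y = par x)"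
    using adj_iff[of x y] children_iff[of x y] by blast
  then show "y \<in> {y. adj x y} \<longleftrightarrow> y \<in> children x \<union> (if x = x0 then {} else {par x})" by simp
qed

lemma finite_children [simp]: "finite (children x)"
  using finite_neighbours[of x] by (rule finite_subset[rotated]) (auto simp: children_def)

text \<open>
  The root has no parent, hence one child more than the other vertices.
\<close>

definition branching :: "nat \<Rightarrow> nat" where
  "branching n = (if n = 0 then q + 1 else q)"

lemma card_children: "card (children x) = branching (level x)"
proof (cases "x = x0")
  case True
  then show ?thesis using card_neighbours[of x] unfolding neighbours_eq by (simp add: branching_def)
next
  case False
  have "par x \<notin> children x" using par_props[OF False] level_child[of "par x" x] by auto
  then show ?thesis using False card_neighbours[of x] gdist_eq_0_iff[of x0 x]
    unfolding neighbours_eq by (auto simp: branching_def)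
qed

definition shell :: "nat \<Rightarrow> 'v set" where "shell n = {x. level x = n}"

lemma shell_0: "shell 0 = {x0}" by (auto simp: shell_def)

lemma shell_Suc: "shell (Suc n) = (\<Union>x\<in>shell n. children x)"
proof (intro set_eqI iffI)
  fix y assume "y \<in> shell (Suc n)"
  then have "level y = Suc n" by (simp add: shell_def)
  then have "y \<noteq> x0" by auto
  then show "y \<in> (\<Union>x\<in>shell n. children x)"
    using par_props[of y] \<open>level y = Suc n\<close> by (auto simp: shell_def children_iff)
qed (auto simp: shell_def dest: level_child)

lemma finite_shell [simp]: "finite (shell n)"
  by (induction n) (auto simp: shell_0 shell_Suc)

lemma sum_shell_Suc: "(\<Sum>y\<in>shell (Suc n). g y) = (\<Sum>x\<in>shell n. \<Sum>y\<in>children x. g y)"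
  unfolding shell_Suc by (rule sum.UNION_disjoint) (auto simp: children_iff)

lemma card_shell_Suc: "card (shell (Suc n)) = branching n * card (shell n)"
proof -
  have "card (shell (Suc n)) = (\<Sum>y\<in>shell (Suc n). 1)" by simp
  also have "\<dots> = (\<Sum>x\<in>shell n. branching n)"
    unfolding sum_shell_Suc by (intro sum.cong refl) (simp add: card_children, simp add: shell_def)
  finally show ?thesis by simp
qed

lemma card_shell: "card (shell (Suc n)) = (q + 1) * q ^ n"
  by (induction n) (simp_all add: card_shell_Suc[of 0] card_shell_Suc[of "Suc _"] shell_0 branching_def algebra_simps)

lemma card_shell_pos: "0 < card (shell n)"
  using q_ge_2 by (cases n) (auto simp: card_shell shell_0)

text \<open>
  Truncated subtraction makes \<open>anc j x = x\<close> for \<open>j\<close> beyond the level of \<open>x\<close>, so that the ancestors of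
  \<open>x\<close> form an eventually constant sequence and can serve as the labels of a filtration for all indices.
\<close>

definition anc :: "nat \<Rightarrow> 'v \<Rightarrow> 'v" where
  "anc j x = (par ^^ (level x - j)) x"

lemma anc_ge: "level x \<le> j \<Longrightarrow> anc j x = x"
  by (simp add: anc_def)

lemma level_par: "level (par x) = level x - 1" if "x \<noteq> x0"
  using par_props[OF that] by simp

lemma anc_par: "j < level x \<Longrightarrow> anc j x = anc j (par x)"
proof -
  assume j: "j < level x"
  then have "x \<noteq> x0" by auto
  then have "level (par x) = level x - 1" by (rule level_par)
  moreover have "level x - j = Suc (level x - 1 - j)" using j by simp
  ultimately show ?thesis unfolding anc_def by (simp add: funpow_swap1)
qed

lemma level_anc: "level (anc j x) = min j (level x)"
proof (induction "level x - j" arbitrary: x)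
  case 0
  then show ?case by (simp add: anc_ge)
next
  case (Suc k)
  then have j: "j < level x" by simp
  then have "x \<noteq> x0" by auto
  with Suc j show ?case by (simp add: anc_par level_par)
qed

lemma anc_anc: "i \<le> j \<Longrightarrow> anc i (anc j x) = anc i x"
proof (induction "level x - j" arbitrary: x)
  case 0
  then show ?case by (simp add: anc_ge)
next
  case (Suc k)
  then have j: "j < level x" by simp
  then have "x \<noteq> x0" by auto
  with Suc j show ?case by (simp add: anc_par[of _ x] level_par)
qed

lemma par_anc_Suc: "j < level x \<Longrightarrow> par (anc (Suc j) x) = anc j x"
proof -
  assume j: "j < level x"
  have "anc j x = anc j (anc (Suc j) x)" by (simp add: anc_anc)
  also have "\<dots> = anc j (par (anc (Suc j) x))"
    using j by (intro anc_par) (simp add: level_anc)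
  also have "\<dots> = par (anc (Suc j) x)"
    using j level_anc[of "Suc j" x] by (intro anc_ge) (subst level_par, auto)
  finally show ?thesis by simp
qed

lemma anc_Suc_child: "j < level x \<Longrightarrow> anc (Suc j) x \<in> children (anc j x)"
  using par_anc_Suc[of j x] level_anc[of "Suc j" x] by (auto simp: children_iff)

lemma anc_0: "anc 0 x = x0"
  using level_anc[of 0 x] by simp

text \<open>
  A walk that gains one level per step can be retraced by taking parents.
\<close>

lemma walk_up_unique: "(adj ^^ k) w x \<Longrightarrow> level x = level w + k \<Longrightarrow> w = (par ^^ k) x"
proof (induction k arbitrary: x)
  case (Suc k)
  from Suc.prems(1) obtain y where y: "(adj ^^ k) w y" "adj y x" by (rule relpowp_Suc_E)
  have "level y \<le> level w + k" using gdist_triangle[of x0 y w] gdist_le[OF y(1)] by linarith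
  moreover have "level x \<le> Suc (level y)" using y level_le_Suc by auto
  ultimately have ly: "level y = level w + k" using Suc.prems by linarith
  then have "par x = y" using y Suc.prems by (intro par_eqI) auto
  then show ?case using Suc.IH[OF y(1) ly] by (simp add: funpow_swap1)
qed auto

lemma gdist_anc: "j \<le> level x \<Longrightarrow> gdist adj (anc j x) x = level x - j"
proof (induction "level x - j" arbitrary: x)
  case 0
  then show ?case by (simp add: anc_ge)
next
  case (Suc k)
  then have j: "j < level x" by simp
  then have "x \<noteq> x0" by auto
  note p = par_props[OF this]
  have "gdist adj (anc j x) (par x) = level (par x) - j" using Suc p j by (simp add: anc_par)
  then have "gdist adj (anc j x) x \<le> level x - j"
    using gdist_triangle[of "anc j x" x "par x"] gdist_adj[of "par x" x] p j by linarith
  moreover have "level x \<le> j + gdist adj (anc j x) x"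
    using gdist_triangle[of x0 x "anc j x"] j by (simp add: level_anc)
  ultimately show ?case by linarith
qed

lemma geodesic_eq: "geodesic adj x0 x = (\<lambda>j. anc j x) ` {..level x}"
proof (intro set_eqI iffI)
  fix w assume "w \<in> geodesic adj x0 x"
  then have e: "level w + gdist adj w x = level x" by (simp add: geodesic_def)
  then have "w = (par ^^ gdist adj w x) x" by (intro walk_up_unique gdist_walk) simp
  also have "gdist adj w x = level x - level w" using e by simp
  finally have "w = anc (level w) x" by (simp only: anc_def)
  moreover have "level w \<le> level x" using e by simp
  ultimately show "w \<in> (\<lambda>j. anc j x) ` {..level x}" by blast
qed (auto simp: geodesic_def level_anc gdist_anc)

lemma ray_level: "\<omega> \<in> rays adj x0 \<Longrightarrow> level (\<omega> n) = n"
proof -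
  assume "\<omega> \<in> rays adj x0"
  then have "\<omega> 0 = x0" "gdist adj (\<omega> 0) (\<omega> n) = n - 0" unfolding rays_def by blast+
  then show ?thesis by simp
qed

lemma ray_par: "\<omega> \<in> rays adj x0 \<Longrightarrow> par (\<omega> (Suc n)) = \<omega> n"
proof -
  assume w: "\<omega> \<in> rays adj x0"
  then have "gdist adj (\<omega> n) (\<omega> (Suc n)) = Suc n - n" unfolding rays_def by (simp del: One_nat_def)
  then have "adj (\<omega> n) (\<omega> (Suc n))" by (simp flip: gdist_eq_1_iff)
  then show ?thesis using ray_level[OF w] by (intro par_eqI) auto
qed

lemma ray_anc: "\<omega> \<in> rays adj x0 \<Longrightarrow> j \<le> n \<Longrightarrow> anc j (\<omega> n) = \<omega> j"
proof (induction n)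
  case 0
  then show ?case by (simp add: anc_ge ray_level)
next
  case (Suc n)
  show ?case
  proof (cases "j = Suc n")
    case True
    then show ?thesis using Suc.prems by (simp add: anc_ge ray_level)
  next
    case False
    then show ?thesis using Suc by (simp add: anc_par ray_level ray_par)
  qed
qed

text \<open>
  The Poisson kernel enters only through the second statement: the confluent lies at level \<open>j\<close> or beyond
  exactly when the ray still follows the geodesic at level \<open>j\<close>.
\<close>

lemma level_confluent:
  assumes w: "\<omega> \<in> rays adj x0"
  shows "level (confluent adj x0 x \<omega>) \<le> level x"
    and "j \<le> level x \<Longrightarrow> j \<le> level (confluent adj x0 x \<omega>) \<longleftrightarrow> \<omega> j = anc j x"
proof -
  let ?P = "\<lambda>v. v \<in> geodesic adj x0 x \<and> v \<in> range \<omega>"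
  define c where "c = confluent adj x0 x \<omega>"
  have in_P: "?P (anc j x) \<longleftrightarrow> \<omega> j = anc j x" if "j \<le> level x" for j
  proof
    assume "?P (anc j x)"
    then obtain i where i: "anc j x = \<omega> i" by auto
    then have "i = j" using level_anc[of j x] ray_level[OF w, of i] that by simp
    with i show "\<omega> j = anc j x" by simp
  next
    assume "\<omega> j = anc j x"
    then show "?P (anc j x)" using that by (metis (mono_tags) geodesic_eq imageI atMost_iff rangeI)
  qed
  have "\<omega> 0 = x0" using w by (simp add: rays_def)
  then have P0: "?P (anc 0 x)" using in_P[of 0] by (simp add: anc_0)
  have bnd: "\<forall>v. ?P v \<longrightarrow> level v \<le> level x" by (auto simp: geodesic_def)
  have c: "?P c" "\<And>v. ?P v \<Longrightarrow> level v \<le> level c"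
    using arg_max_nat_lemma[of ?P "anc 0 x" level "Suc (level x)"] P0 bnd
    unfolding c_def confluent_def by (auto simp: less_Suc_eq_le)
  show 1: "level (confluent adj x0 x \<omega>) \<le> level x" using c(1) bnd unfolding c_def by blast
  assume j: "j \<le> level x"
  obtain i where i: "i \<le> level x" "c = anc i x" using c(1) by (auto simp: geodesic_eq)
  have wi: "\<omega> i = anc i x" using iffD1[OF in_P[OF i(1)] c(1)[unfolded i(2)]] .
  have li: "level c = i" using i by (simp add: level_anc)
  have "\<omega> j = anc j x" if "j \<le> i"
    using ray_anc[OF w that] wi anc_anc[OF that, of x] by simp
  moreover have "j \<le> i" if "\<omega> j = anc j x"
    using c(2)[of "anc j x"] in_P[OF j] that j li by (simp add: level_anc)
  ultimately show "j \<le> level (confluent adj x0 x \<omega>) \<longleftrightarrow> \<omega> j = anc j x"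
    unfolding c_def[symmetric] li by blast
qed

lemma rays_through_eq: "rays_through adj x0 x = {\<omega> \<in> rays adj x0. \<omega> (level x) = x}"
proof -
  have "level (confluent adj x0 x \<omega>) = level x \<longleftrightarrow> \<omega> (level x) = x" if "\<omega> \<in> rays adj x0" for \<omega>
  proof -
    have "level (confluent adj x0 x \<omega>) = level x \<longleftrightarrow> level x \<le> level (confluent adj x0 x \<omega>)"
      using level_confluent(1)[OF that, of x] by linarith
    also have "\<dots> \<longleftrightarrow> \<omega> (level x) = x"
      using level_confluent(2)[OF that order_refl, of x] by (simp only: anc_ge[OF order_refl])
    finally show ?thesis .
  qed
  then show ?thesis unfolding rays_through_def by blast
qed

end

section \<open>Automorphisms and the average over the stabilizer\<close>

context rooted_tree
begin

text \<open>
  A numbering of the siblings of \<open>x\<close>, so that a vertex is addressed by the list of labels along its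
  geodesic from the root.
\<close>

definition lab :: "'v \<Rightarrow> nat" where
  "lab x = (SOME f. bij_betw f (children (par x)) {..<card (children (par x))}) x"

definition child :: "'v \<Rightarrow> nat \<Rightarrow> 'v" where
  "child v i = inv_into (children v) lab i"

lemma lab_bij: "bij_betw lab (children v) {..<branching (level v)}"
proof -
  define f where "f = (SOME f. bij_betw f (children v) {..<card (children v)})"
  have "\<exists>f. bij_betw f (children v) {..<card (children v)}"
    using ex_bij_betw_finite_nat[OF finite_children[of v]] by (simp add: atLeast0LessThan)
  then have "bij_betw f (children v) {..<card (children v)}" unfolding f_def by (rule someI_ex)
  moreover have "lab x = f x" if "x \<in> children v" for x
    using that by (simp add: lab_def f_def children_iff)
  ultimately have "bij_betw lab (children v) {..<card (children v)}"
    using bij_betw_cong[of "children v" lab f] by blast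
  then show ?thesis by (simp only: card_children)
qed

lemma child_in: "i < branching (level v) \<Longrightarrow> child v i \<in> children v"
  and lab_child: "i < branching (level v) \<Longrightarrow> lab (child v i) = i"
  and child_lab: "x \<in> children v \<Longrightarrow> child v (lab x) = x"
  and lab_less: "x \<in> children v \<Longrightarrow> lab x < branching (level v)"
  using lab_bij[of v] unfolding child_def
  by (auto simp: bij_betw_def inv_into_into f_inv_into_f)

text \<open>
  In terms of addresses, the \<open>n\<close>-th entry \<open>i\<close> becomes \<open>\<sigma> n i\<close>.
\<close>

primrec relabel :: "(nat \<Rightarrow> nat \<Rightarrow> nat) \<Rightarrow> nat \<Rightarrow> 'v \<Rightarrow> 'v" where
  "relabel \<sigma> 0 x = x0"
| "relabel \<sigma> (Suc n) x = child (relabel \<sigma> n (par x)) (\<sigma> n (lab x))"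

definition tree_aut :: "(nat \<Rightarrow> nat \<Rightarrow> nat) \<Rightarrow> 'v \<Rightarrow> 'v" where
  "tree_aut \<sigma> x = relabel \<sigma> (level x) x"

context
  fixes \<sigma> :: "nat \<Rightarrow> nat \<Rightarrow> nat"
  assumes \<sigma>_less: "\<And>n i. i < branching n \<Longrightarrow> \<sigma> n i < branching n"
    and \<sigma>_inv: "\<And>n i. \<sigma> n (\<sigma> n i) = i"
begin

lemma relabel_level: "level x = n \<Longrightarrow> level (relabel \<sigma> n x) = n"
proof (induction n arbitrary: x)
  case (Suc n)
  then have "x \<noteq> x0" by auto
  then have p: "x \<in> children (par x)" "level (par x) = n"
    using Suc.prems level_par by (auto simp: children_iff)
  then have l: "level (relabel \<sigma> n (par x)) = n" using Suc.IH by simp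
  then have "\<sigma> n (lab x) < branching (level (relabel \<sigma> n (par x)))"
    using lab_less[OF p(1)] p(2) \<sigma>_less by simp
  from level_child[OF child_in[OF this]] show ?case by (simp add: l)
qed simp

lemma relabel_child:
  assumes "level x = n" "y \<in> children x"
  shows "relabel \<sigma> (Suc n) y \<in> children (relabel \<sigma> n x)"
    and "lab (relabel \<sigma> (Suc n) y) = \<sigma> n (lab y)"
proof -
  have p: "par y = x" using assms by (simp add: children_iff)
  have "\<sigma> n (lab y) < branching (level (relabel \<sigma> n x))"
    using relabel_level[OF assms(1)] lab_less[OF assms(2)] assms(1) \<sigma>_less by simp
  then show "relabel \<sigma> (Suc n) y \<in> children (relabel \<sigma> n x)"
    "lab (relabel \<sigma> (Suc n) y) = \<sigma> n (lab y)"
    using child_in lab_child by (auto simp: p)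
qed

lemma relabel_involution: "level x = n \<Longrightarrow> relabel \<sigma> n (relabel \<sigma> n x) = x"
proof (induction n arbitrary: x)
  case (Suc n)
  then have "x \<noteq> x0" by auto
  then have p: "x \<in> children (par x)" "level (par x) = n"
    using Suc.prems level_par by (auto simp: children_iff)
  note c = relabel_child[OF p(2,1)]
  have "par (relabel \<sigma> (Suc n) x) = relabel \<sigma> n (par x)" using c(1) by (simp add: children_iff)
  then have "relabel \<sigma> (Suc n) (relabel \<sigma> (Suc n) x) = child (relabel \<sigma> n (relabel \<sigma> n (par x))) (\<sigma> n (lab (relabel \<sigma> (Suc n) x)))"
    by (simp del: relabel.simps(2) add: relabel.simps(2)[of _ _ "relabel \<sigma> (Suc n) x"])
  also have "\<dots> = child (par x) (lab x)" using Suc.IH[OF p(2)] c(2) \<sigma>_inv by simp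
  finally show ?case using child_lab[OF p(1)] by simp
qed simp

lemma tree_aut_involution: "tree_aut \<sigma> (tree_aut \<sigma> x) = x"
  by (simp add: tree_aut_def relabel_level relabel_involution)

lemma tree_aut_adj: "adj x y \<Longrightarrow> adj (tree_aut \<sigma> x) (tree_aut \<sigma> y)"
proof -
  have c: "tree_aut \<sigma> v \<in> children (tree_aut \<sigma> u)" if "v \<in> children u" for u v
    using relabel_child(1)[OF refl that] level_child[OF that] by (simp only: tree_aut_def)
  assume "adj x y"
  then show "adj (tree_aut \<sigma> x) (tree_aut \<sigma> y)"
    using c[of x y] c[of y x] adj_iff[of x y] adj_iff[of "tree_aut \<sigma> x" "tree_aut \<sigma> y"] by blast
qed

lemma tree_aut_gdist: "gdist adj (tree_aut \<sigma> x) (tree_aut \<sigma> y) = gdist adj x y"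
proof -
  have walk: "(adj ^^ n) u v \<Longrightarrow> (adj ^^ n) (tree_aut \<sigma> u) (tree_aut \<sigma> v)" for n u v
  proof (induction n arbitrary: v)
    case (Suc n)
    then show ?case by (elim relpowp_Suc_E) (meson relpowp_Suc_I tree_aut_adj)
  qed simp
  have le: "gdist adj (tree_aut \<sigma> u) (tree_aut \<sigma> v) \<le> gdist adj u v" for u v
    by (intro gdist_le walk gdist_walk)
  show ?thesis using le[of x y] le[of "tree_aut \<sigma> x" "tree_aut \<sigma> y"] by (simp add: tree_aut_involution)
qed

lemma tree_aut_stabilizer: "tree_aut \<sigma> \<in> stabilizer adj x0"
proof -
  have "bij (tree_aut \<sigma>)" using tree_aut_involution by (intro involuntory_imp_bij)
  moreover have "tree_aut \<sigma> x0 = x0" by (simp add: tree_aut_def)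
  ultimately show ?thesis by (simp add: stabilizer_def tree_aut_gdist)
qed

end

text \<open>
  At each depth interchange the label occurring in the address of \<open>x\<close> with the one in the address of
  \<open>y\<close>. These interchanges are involutions, so the resulting map is its own inverse.
\<close>

lemma stabilizer_transitive:
  assumes xy: "level x = n" "level y = n"
  shows "\<exists>g\<in>stabilizer adj x0. g x = y \<and> (\<forall>v. g (g v) = v)"
proof -
  define \<sigma> where "\<sigma> j = (\<lambda>i. if j < n
      then Transposition.transpose (lab (anc (Suc j) x)) (lab (anc (Suc j) y)) i else i)" for j
  have lab_anc: "lab (anc (Suc j) v) < branching j" if "j < level v" for j v
    using lab_less[OF anc_Suc_child[OF that]] that by (simp add: level_anc)
  have less: "\<sigma> j i < branching j" if "i < branching j" for j i
    using that lab_anc[of j x] lab_anc[of j y] xy by (auto simp: \<sigma>_def Transposition.transpose_def)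
  have inv: "\<sigma> j (\<sigma> j i) = i" for i j by (simp add: \<sigma>_def)
  have "relabel \<sigma> j (anc j x) = anc j y" if "j \<le> n" for j
    using that
  proof (induction j)
    case (Suc j)
    have "\<sigma> j (lab (anc (Suc j) x)) = lab (anc (Suc j) y)"
      using Suc.prems by (simp add: \<sigma>_def)
    then have "relabel \<sigma> (Suc j) (anc (Suc j) x) = child (anc j y) (lab (anc (Suc j) y))"
      using Suc xy by (simp add: par_anc_Suc)
    then show ?case using child_lab[OF anc_Suc_child[of j y]] Suc xy by simp
  qed (simp add: anc_0)
  from this[of n] have "tree_aut \<sigma> x = y" using xy by (simp add: tree_aut_def anc_ge)
  then show ?thesis
    using tree_aut_stabilizer[OF less inv] tree_aut_involution[OF less inv] by blast
qed

text \<open>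
  The sets of automorphisms moving \<open>v\<close> to \<open>y\<close>, for \<open>y\<close> in the sphere of \<open>v\<close>, are left translates of
  one another by transitivity, so they have equal measure and partition the group.
\<close>

lemma haar_average:
  fixes \<phi> :: "'v \<Rightarrow> real"
  assumes haar: "normalized_haar adj x0 \<mu>" and v: "level v = n"
  shows "(\<integral>k. \<phi> (k v) \<partial>\<mu>) = (\<Sum>x\<in>shell n. \<phi> x) / card (shell n)"
proof -
  interpret prob_space \<mu> using haar by (simp add: normalized_haar_def)
  have space: "space \<mu> = stabilizer adj x0"
    and sets: "sets \<mu> = sigma_sets (stabilizer adj x0) {U. openin (stabilizer_topology adj x0) U}"
    and inv: "\<And>g A. g \<in> stabilizer adj x0 \<Longrightarrow> A \<in> sets \<mu> \<Longrightarrow> emeasure \<mu> ((\<lambda>k. g \<circ> k) ` A) = emeasure \<mu> A"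
    using haar by (auto simp: normalized_haar_def)
  define A where "A y = {k \<in> stabilizer adj x0. k v = y}" for y
  have A: "A y \<in> sets \<mu>" for y
  proof -
    let ?T = "product_topology (\<lambda>_::'v. discrete_topology (UNIV::'v set)) UNIV"
    have "continuous_map ?T (discrete_topology UNIV) (\<lambda>k. k v)"
      by (rule continuous_map_product_projection) simp
    then have "openin ?T {k \<in> topspace ?T. k v \<in> {y}}"
      by (rule openin_continuous_map_preimage) simp
    moreover have "topspace ?T = UNIV" by simp
    ultimately have "openin ?T {k. k v = y}" by simp
    moreover have "A y = {k. k v = y} \<inter> stabilizer adj x0" by (auto simp: A_def)
    ultimately have "openin (stabilizer_topology adj x0) (A y)"
      unfolding stabilizer_topology_def openin_subtopology by blast
    then show ?thesis unfolding sets by (intro sigma_sets.Basic) simp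
  qed
  have eq: "measure \<mu> (A y) = measure \<mu> (A z)" if yz: "y \<in> shell n" "z \<in> shell n" for y z
  proof -
    obtain g where g: "g \<in> stabilizer adj x0" "g y = z" "\<And>v. g (g v) = v"
      using stabilizer_transitive yz unfolding shell_def by blast
    have gz: "g z = y" using g(2,3) by metis
    have comp: "g \<circ> k \<in> stabilizer adj x0" if "k \<in> stabilizer adj x0" for k
      using g(1) that by (auto simp: stabilizer_def intro: bij_comp)
    have "(\<lambda>k. g \<circ> k) ` A y = A z"
    proof (intro set_eqI iffI)
      fix k assume "k \<in> (\<lambda>k. g \<circ> k) ` A y"
      then show "k \<in> A z" using comp g(2) by (auto simp: A_def)
    next
      fix k assume k: "k \<in> A z"
      have "k = g \<circ> (g \<circ> k)" using g(3) by (auto simp: fun_eq_iff)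
      moreover have "g \<circ> k \<in> A y" using k comp gz by (simp add: A_def)
      ultimately show "k \<in> (\<lambda>k. g \<circ> k) ` A y" by blast
    qed
    then show ?thesis using inv[OF g(1) A] by (metis measure_def)
  qed
  have kv: "k v \<in> shell n" if "k \<in> stabilizer adj x0" for k
  proof -
    have "gdist adj (k x0) (k v) = level v" "k x0 = x0" using that unfolding stabilizer_def by blast+
    then show ?thesis using v by (simp add: shell_def)
  qed
  have union: "(\<Union>y\<in>shell n. A y) = space \<mu>"
    unfolding space A_def using kv by auto
  have "1 = measure \<mu> (\<Union>y\<in>shell n. A y)" unfolding union by (simp add: prob_space)
  also have "\<dots> = (\<Sum>y\<in>shell n. measure \<mu> (A y))"
    using A by (intro finite_measure_finite_Union) (auto simp: disjoint_family_on_def A_def)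
  also have "\<dots> = (\<Sum>y\<in>shell n. measure \<mu> (A v))"
    using v by (intro sum.cong refl eq) (simp_all add: shell_def)
  finally have "1 = card (shell n) * measure \<mu> (A v)" by simp
  then have mv: "measure \<mu> (A v) = 1 / card (shell n)"
    using card_shell_pos[of n] by (simp add: eq_divide_eq mult.commute del: card_0_eq)
  have m: "measure \<mu> (A y) = 1 / card (shell n)" if "y \<in> shell n" for y
    using eq[OF that, of v] v mv by (simp add: shell_def)
  have "(\<integral>k. \<phi> (k v) \<partial>\<mu>) = (\<integral>k. (\<Sum>y\<in>shell n. \<phi> y * indicator (A y) k) \<partial>\<mu>)"
  proof (rule Bochner_Integration.integral_cong[OF refl])
    fix k assume k: "k \<in> space \<mu>"
    have "(\<Sum>y\<in>shell n. \<phi> y * indicator (A y) k) = (\<Sum>y\<in>shell n. if y = k v then \<phi> y else 0)"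
      using k by (intro sum.cong) (auto simp: A_def space indicator_def)
    also have "\<dots> = \<phi> (k v)" using kv k by (simp add: space)
    finally show "\<phi> (k v) = (\<Sum>y\<in>shell n. \<phi> y * indicator (A y) k)" by simp
  qed
  also have "\<dots> = (\<Sum>y\<in>shell n. \<phi> y * measure \<mu> (A y))"
    using A by (subst Bochner_Integration.integral_sum) (auto simp: emeasure_eq_measure)
  also have "\<dots> = (\<Sum>x\<in>shell n. \<phi> x) / card (shell n)"
    by (simp add: m sum_divide_distrib)
  finally show ?thesis .
qed

end

section \<open>Martingales on the tree\<close>

context rooted_tree
begin

definition tree_martingale :: "('v \<Rightarrow> complex) \<Rightarrow> bool" where
  "tree_martingale f \<longleftrightarrow> (\<forall>x. (\<Sum>y\<in>children x. f y) = of_nat (branching (level x)) * f x)"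

definition sphere_avg :: "nat \<Rightarrow> ('v \<Rightarrow> 'b::real_normed_field) \<Rightarrow> 'b" where
  "sphere_avg n g = (\<Sum>x\<in>shell n. g x) / of_nat (card (shell n))"

abbreviation power_mean :: "real \<Rightarrow> nat \<Rightarrow> ('v \<Rightarrow> complex) \<Rightarrow> real" where
  "power_mean p n g \<equiv> sphere_avg n (\<lambda>x. norm (g x) powr p)"

lemma shell_iff [simp]: "x \<in> shell n \<longleftrightarrow> level x = n"
  by (simp add: shell_def)

lemma branching_pos: "0 < branching n"
  using q_ge_2 by (simp add: branching_def)

lemma sphere_avg_mono:
  fixes g h :: "'v \<Rightarrow> real"
  shows "(\<And>x. level x = n \<Longrightarrow> g x \<le> h x) \<Longrightarrow> sphere_avg n g \<le> sphere_avg n h"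
  unfolding sphere_avg_def by (intro divide_right_mono sum_mono) auto

lemma sphere_avg_const: "sphere_avg n (\<lambda>x. c) = c"
  using card_shell_pos[of n] by (simp add: sphere_avg_def del: card_0_eq)

lemma sphere_avg_add: "sphere_avg n (\<lambda>x. g x + h x) = sphere_avg n g + sphere_avg n h"
  by (simp add: sphere_avg_def sum.distrib add_divide_distrib)

lemma sphere_avg_cmult: "sphere_avg n (\<lambda>x. c * g x) = c * sphere_avg n g"
  by (simp add: sphere_avg_def flip: sum_distrib_left)

lemma sphere_avg_cong: "(\<And>x. level x = n \<Longrightarrow> g x = h x) \<Longrightarrow> sphere_avg n g = sphere_avg n h"
  unfolding sphere_avg_def by (intro arg_cong2[where f = "(/)"] sum.cong) auto

lemma sphere_avg_nonneg:
  fixes g :: "'v \<Rightarrow> real"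
  shows "(\<And>x. 0 \<le> g x) \<Longrightarrow> 0 \<le> sphere_avg n g"
  by (simp add: sphere_avg_def sum_nonneg)

text \<open>
  All vertices at level \<open>n\<close> have the same number of descendants at level \<open>N\<close>.
\<close>

lemma sphere_avg_anc:
  assumes "n \<le> N"
  shows "sphere_avg N (\<lambda>x. g (anc n x)) = sphere_avg n g"
  using assms
proof (induction N rule: dec_induct)
  case base
  have "(\<Sum>x\<in>shell n. g (anc n x)) = (\<Sum>x\<in>shell n. g x)"
    by (intro sum.cong) (auto simp: anc_ge)
  then show ?case by (simp add: sphere_avg_def)
next
  case (step N)
  have "(\<Sum>x\<in>shell (Suc N). g (anc n x)) = (\<Sum>v\<in>shell N. \<Sum>y\<in>children v. g (anc n y))"
    by (rule sum_shell_Suc)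
  also have "\<dots> = (\<Sum>v\<in>shell N. of_nat (branching N) * g (anc n v))"
  proof (intro sum.cong refl)
    fix v assume v: "v \<in> shell N"
    have "(\<Sum>y\<in>children v. g (anc n y)) = (\<Sum>y\<in>children v. g (anc n v))"
    proof (intro sum.cong refl)
      fix y assume y: "y \<in> children v"
      then have "par y = v" "level y = Suc N" using level_child[OF y] v by (auto simp: children_iff)
      then show "g (anc n y) = g (anc n v)" using step by (simp add: anc_par)
    qed
    then show "(\<Sum>y\<in>children v. g (anc n y)) = of_nat (branching N) * g (anc n v)"
      using v by (simp add: card_children)
  qed
  finally have "(\<Sum>x\<in>shell (Suc N). g (anc n x)) = of_nat (branching N) * (\<Sum>v\<in>shell N. g (anc n v))"
    by (simp add: sum_distrib_left)
  then show ?case using step branching_pos[of N]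
    by (simp add: sphere_avg_def card_shell_Suc)
qed

lemma sum_shell_eq: "(\<Sum>x\<in>shell n. g x) = of_nat (card (shell n)) * sphere_avg n g"
  using card_shell_pos[of n] by (simp add: sphere_avg_def)

lemma sphere_avg_Suc_children:
  "sphere_avg (Suc n) g = sphere_avg n (\<lambda>x. (\<Sum>y\<in>children x. g y) / of_nat (branching n))"
  by (simp add: sphere_avg_def sum_shell_Suc card_shell_Suc sum_divide_distrib mult.commute)

lemma anc_filtration: "finite_filtration (shell N) anc"
proof
  show "anc n x = anc n y" if "anc (Suc n) x = anc (Suc n) y" for n x y
    using that anc_anc[of n "Suc n" x] anc_anc[of n "Suc n" y] by simp
qed simp

text \<open>
  Functions known at stage \<open>n\<close> are functions of the ancestor at level \<open>n\<close>, so the test reduces to a sum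
  over level \<open>n + 1\<close>, in which the children of a vertex are grouped together.
\<close>

lemma anc_martingale:
  assumes f: "tree_martingale f"
  shows "finite_filtration.martingale (shell N) anc (\<lambda>n x. f (anc n x))"
proof -
  interpret finite_filtration "shell N" anc by (rule anc_filtration)
  show ?thesis
    unfolding martingale_def is_cond_exp_def
  proof (intro allI conjI impI)
    show "adapted_at n (\<lambda>x. f (anc n x))" for n by (simp add: adapted_at_def)
  next
    fix n and c :: "'v \<Rightarrow> complex" assume c: "adapted_at n c"
    show "(\<Sum>x\<in>shell N. c x * f (anc (Suc n) x)) = (\<Sum>x\<in>shell N. c x * f (anc n x))"
    proof (cases "n < N")
      case False
      then show ?thesis by (intro sum.cong) (auto simp: anc_ge)
    next
      case True
      \<comment> \<open>The test function as a function of the ancestor at level \<open>n\<close>.\<close>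
      define c' where "c' v = c (SOME x. x \<in> shell N \<and> anc n x = v)" for v
      have cc: "c x = c' (anc n x)" if "x \<in> shell N" for x
      proof -
        have "(SOME z. z \<in> shell N \<and> anc n z = anc n x) \<in> shell N \<and>
          anc n (SOME z. z \<in> shell N \<and> anc n z = anc n x) = anc n x"
          by (rule someI[of "\<lambda>z. z \<in> shell N \<and> anc n z = anc n x"]) (use that in simp)
        then show ?thesis unfolding c'_def using c that unfolding adapted_at_def by metis
      qed
      have "(\<Sum>x\<in>shell N. c x * f (anc (Suc n) x))
        = (\<Sum>x\<in>shell N. (\<lambda>v. c' (par v) * f v) (anc (Suc n) x))"
        using True by (intro sum.cong) (auto simp: cc par_anc_Suc)
      also have "\<dots> = of_nat (card (shell N)) * sphere_avg N (\<lambda>x. (\<lambda>v. c' (par v) * f v) (anc (Suc n) x))"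
        by (rule sum_shell_eq)
      also have "sphere_avg N (\<lambda>x. (\<lambda>v. c' (par v) * f v) (anc (Suc n) x)) = sphere_avg (Suc n) (\<lambda>v. c' (par v) * f v)"
        using True by (intro sphere_avg_anc) simp
      also have "\<dots> = sphere_avg n (\<lambda>v. c' v * f v)"
      proof -
        have "(\<Sum>y\<in>children v. c' (par y) * f y) / of_nat (branching n) = c' v * f v"
          if "level v = n" for v
        proof -
          have "(\<Sum>y\<in>children v. c' (par y) * f y) = (\<Sum>y\<in>children v. c' v * f y)"
            by (intro sum.cong) (auto simp: children_iff)
          also have "\<dots> = c' v * (of_nat (branching n) * f v)"
            using f that by (simp add: tree_martingale_def flip: sum_distrib_left)
          finally show ?thesis using branching_pos[of n] by simp
        qed
        then show ?thesis unfolding sphere_avg_Suc_children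
          by (simp add: sphere_avg_def)
      qed
      also have "\<dots> = sphere_avg N (\<lambda>x. (\<lambda>v. c' v * f v) (anc n x))"
        using True by (intro sphere_avg_anc[symmetric]) simp
      also have "of_nat (card (shell N)) * \<dots> = (\<Sum>x\<in>shell N. (\<lambda>v. c' v * f v) (anc n x))"
        by (rule sum_shell_eq[symmetric])
      also have "\<dots> = (\<Sum>x\<in>shell N. c x * f (anc n x))"
        by (intro sum.cong) (auto simp: cc)
      finally show ?thesis .
    qed
  qed
qed

lemma tree_martingale_power_mean_mono:
  assumes "tree_martingale f" "1 \<le> p" "m \<le> n"
  shows "power_mean p m f \<le> power_mean p n f"
proof -
  interpret finite_filtration "shell n" anc by (rule anc_filtration)
  have "(\<Sum>x\<in>shell n. norm (f (anc m x)) powr p) \<le> (\<Sum>x\<in>shell n. norm (f (anc n x)) powr p)"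
    by (rule cond_exp_contraction[OF martingale_cond_exp[OF anc_martingale[OF assms(1)] assms(3)] assms(2)])
  then have "sphere_avg n (\<lambda>x. norm (f (anc m x)) powr p) \<le> sphere_avg n (\<lambda>x. norm (f (anc n x)) powr p)"
    by (simp add: sphere_avg_def divide_right_mono)
  then show ?thesis using assms(3) sphere_avg_anc[of m n "\<lambda>v. norm (f v) powr p"]
      sphere_avg_anc[of n n "\<lambda>v. norm (f v) powr p"] by simp
qed

lemma tree_transform_bound:
  assumes f: "tree_martingale f" and p: "1 < p" and w: "\<And>j. norm (w j) \<le> 1"
  shows "sphere_avg n (\<lambda>x. norm (f x0 + (\<Sum>j<n. w (Suc j) * (f (anc (Suc j) x) - f (anc j x)))) powr p)
    \<le> transform_const p * power_mean p n f"
proof -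
  interpret finite_filtration "shell n" anc by (rule anc_filtration)
  have "(\<Sum>x\<in>shell n. norm (transform w (\<lambda>n x. f (anc n x)) n x) powr p)
    \<le> transform_const p * (\<Sum>x\<in>shell n. norm (f (anc n x)) powr p)"
    by (rule transform_bound[OF anc_martingale[OF f] p w])
  then have "sphere_avg n (\<lambda>x. norm (transform w (\<lambda>n x. f (anc n x)) n x) powr p)
    \<le> transform_const p * sphere_avg n (\<lambda>x. norm (f (anc n x)) powr p)"
    by (simp add: sphere_avg_def divide_right_mono)
  then show ?thesis using sphere_avg_anc[of n n "\<lambda>v. norm (f v) powr p"]
    by (simp add: transform_def anc_0)
qed

text \<open>
  The weighted sum of the values at levels at least \<open>n\<close> has conditional expectation
  \<open>(\<Sum>j\<in>J. w j) * f\<close> at level \<open>n\<close>.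
\<close>

lemma weighted_sum_lower_bound:
  assumes f: "tree_martingale f" and p: "1 \<le> p" and J: "finite J" "\<And>j. j \<in> J \<Longrightarrow> n \<le> j" and N: "n \<le> N"
  shows "norm (\<Sum>j\<in>J. w j) powr p * power_mean p n f
    \<le> sphere_avg N (\<lambda>x. norm (\<Sum>j\<in>J. w j * f (anc j x)) powr p)"
proof -
  interpret finite_filtration "shell N" anc by (rule anc_filtration)
  note m = anc_martingale[OF f, of N]
  have "is_cond_exp n (\<lambda>x. \<Sum>j\<in>J. w j * f (anc j x)) (\<lambda>x. (\<Sum>j\<in>J. w j) * f (anc n x))"
    unfolding is_cond_exp_def
  proof (intro conjI allI impI)
    show "adapted_at n (\<lambda>x. (\<Sum>j\<in>J. w j) * f (anc n x))" by (simp add: adapted_at_def)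
  next
    fix c :: "'v \<Rightarrow> complex" assume c: "adapted_at n c"
    have "(\<Sum>x\<in>shell N. c x * (\<Sum>j\<in>J. w j * f (anc j x)))
       = (\<Sum>x\<in>shell N. \<Sum>j\<in>J. w j * (c x * f (anc j x)))"
      by (simp add: sum_distrib_left mult_ac)
    also have "\<dots> = (\<Sum>j\<in>J. w j * (\<Sum>x\<in>shell N. c x * f (anc j x)))"
      unfolding sum_distrib_left by (rule sum.swap)
    also have "\<dots> = (\<Sum>j\<in>J. w j * (\<Sum>x\<in>shell N. c x * f (anc n x)))"
      using is_cond_expD[OF martingale_cond_exp[OF m J(2)] c] by (intro sum.cong) auto
    also have "\<dots> = (\<Sum>x\<in>shell N. c x * ((\<Sum>j\<in>J. w j) * f (anc n x)))"
      unfolding sum_distrib_left sum_distrib_right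
      by (subst sum.swap) (simp add: mult_ac)
    finally show "(\<Sum>x\<in>shell N. c x * (\<Sum>j\<in>J. w j * f (anc j x)))
      = (\<Sum>x\<in>shell N. c x * ((\<Sum>j\<in>J. w j) * f (anc n x)))" .
  qed
  from cond_exp_contraction[OF this p]
  have "norm (\<Sum>j\<in>J. w j) powr p * (\<Sum>x\<in>shell N. norm (f (anc n x)) powr p)
    \<le> (\<Sum>x\<in>shell N. norm (\<Sum>j\<in>J. w j * f (anc j x)) powr p)"
    by (simp add: norm_mult powr_mult sum_distrib_left)
  then have "norm (\<Sum>j\<in>J. w j) powr p * sphere_avg N (\<lambda>x. norm (f (anc n x)) powr p)
    \<le> sphere_avg N (\<lambda>x. norm (\<Sum>j\<in>J. w j * f (anc j x)) powr p)"
    by (simp add: sphere_avg_def divide_right_mono)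
  then show ?thesis using sphere_avg_anc[OF N, of "\<lambda>v. norm (f v) powr p"] by simp
qed

lemma tree_martingale_L1_distance:
  fixes \<delta> B r :: real
  assumes f: "tree_martingale f" and "0 < \<delta>" "1 \<le> B" "1 < r" and nm: "n \<le> m"
  defines "s \<equiv> \<lambda>x. sqrt (1 + (norm (f x))\<^sup>2)"
  shows "sphere_avg m (\<lambda>x. norm (f x - f (anc n x))) \<le> \<delta>
     + 2 * B ^ 3 / \<delta> * (sphere_avg m s - sphere_avg n s)
     + 2 * B powr (1 - r) * (sphere_avg n (\<lambda>x. s x powr r) + sphere_avg m (\<lambda>x. s x powr r))"
proof -
  interpret finite_filtration "shell m" anc by (rule anc_filtration)
  define S where "S = card (shell m)"
  have S: "0 < real S" using card_shell_pos by (simp add: S_def)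
  have a: "f (anc m x) = f x" "s (anc m x) = s x" if "x \<in> shell m" for x
    using that by (simp_all add: anc_ge)
  have n: "(\<Sum>x\<in>shell m. g (anc n x)) = real S * sphere_avg n g" for g :: "'v \<Rightarrow> real"
    using sum_shell_eq[of "\<lambda>x. g (anc n x)" m] sphere_avg_anc[OF nm, of g] by (simp add: S_def)
  have m: "(\<Sum>x\<in>shell m. g (anc m x)) = real S * sphere_avg m g" for g :: "'v \<Rightarrow> real"
    using sum_shell_eq[of "\<lambda>x. g (anc m x)" m] sphere_avg_anc[of m m g] by (simp add: S_def)
  have "(\<Sum>x\<in>shell m. norm (f (anc m x) - f (anc n x))) \<le> \<delta> * card (shell m)
     + 2 * B ^ 3 / \<delta> * ((\<Sum>x\<in>shell m. sqrt (1 + (norm (f (anc m x)))\<^sup>2)) - (\<Sum>x\<in>shell m. sqrt (1 + (norm (f (anc n x)))\<^sup>2)))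
     + 2 * B powr (1 - r) * (\<Sum>x\<in>shell m. sqrt (1 + (norm (f (anc n x)))\<^sup>2) powr r + sqrt (1 + (norm (f (anc m x)))\<^sup>2) powr r)"
    by (rule cond_exp_L1_distance[OF martingale_cond_exp[OF anc_martingale[OF f] nm] assms(2-4)])
  then have "(\<Sum>x\<in>shell m. norm (f (anc m x) - f (anc n x))) \<le> \<delta> * real S
     + 2 * B ^ 3 / \<delta> * ((\<Sum>x\<in>shell m. s (anc m x)) - (\<Sum>x\<in>shell m. s (anc n x)))
     + 2 * B powr (1 - r) * ((\<Sum>x\<in>shell m. s (anc n x) powr r) + (\<Sum>x\<in>shell m. s (anc m x) powr r))"
    unfolding s_def S_def sum.distrib .
  moreover have "(\<Sum>x\<in>shell m. norm (f (anc m x) - f (anc n x))) = real S * sphere_avg m (\<lambda>x. norm (f x - f (anc n x)))"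
    using sum_shell_eq[of "\<lambda>x. norm (f x - f (anc n x))" m] by (simp add: a S_def)
  ultimately have "real S * sphere_avg m (\<lambda>x. norm (f x - f (anc n x))) \<le> \<delta> * real S
     + 2 * B ^ 3 / \<delta> * (real S * sphere_avg m s - real S * sphere_avg n s)
     + 2 * B powr (1 - r) * (real S * sphere_avg n (\<lambda>x. s x powr r) + real S * sphere_avg m (\<lambda>x. s x powr r))"
    by (simp only: n[of s] m[of s] n[of "\<lambda>x. s x powr r"] m[of "\<lambda>x. s x powr r"])
  also have "\<dots> = real S * (\<delta> + 2 * B ^ 3 / \<delta> * (sphere_avg m s - sphere_avg n s)
     + 2 * B powr (1 - r) * (sphere_avg n (\<lambda>x. s x powr r) + sphere_avg m (\<lambda>x. s x powr r)))"
  proof -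
    have "d * t + k * (t * u - t * v) + l * (t * x + t * y) = t * (d + k * (u - v) + l * (x + y))"
      for d t k u v l x y :: real by (simp add: algebra_simps)
    then show ?thesis .
  qed
  finally show ?thesis using S by simp
qed

end

section \<open>The boundary and the averages of its functions\<close>

text \<open>
  The usual proof of completeness of \<open>L\<^sup>1\<close>: the series of increments converges absolutely almost everywhere, and
  its sum of norms dominates all partial sums. The almost everywhere convergence is kept because it
  yields moment bounds for the limit.
\<close>

lemma L1_fast_cauchy_limit:
  fixes g :: "nat \<Rightarrow> 'a \<Rightarrow> 'b::{banach, second_countable_topology}"
  assumes g: "\<And>k. integrable M (g k)"
    and fast: "\<And>k. (\<integral>x. norm (g (Suc k) x - g k x) \<partial>M) \<le> (1/2) ^ k"
  obtains F where "F \<in> borel_measurable M" "AE x in M. (\<lambda>k. g k x) \<longlonglongrightarrow> F x"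
    "\<And>A. A \<in> sets M \<Longrightarrow> (\<lambda>k. LINT x:A|M. g k x) \<longlonglongrightarrow> (LINT x:A|M. F x)"
proof -
  define d where "d k x = g (Suc k) x - g k x" for k x
  define F where "F x = g 0 x + (\<Sum>k. d k x)" for x
  define W where "W x = norm (g 0 x) + (\<Sum>k. norm (d k x))" for x
  have d: "integrable M (d k)" for k unfolding d_def using g by auto
  have gm: "g k \<in> borel_measurable M" "d k \<in> borel_measurable M" for k using g d by auto
  have dn: "(\<integral>\<^sup>+x. norm (d k x) \<partial>M) \<le> ennreal ((1/2) ^ k)" for k
    unfolding d_def using g fast by (subst nn_integral_eq_integral) (auto intro!: ennreal_leI)
  have "(\<integral>\<^sup>+x. (\<Sum>k. ennreal (norm (d k x))) \<partial>M) = (\<Sum>k. \<integral>\<^sup>+x. norm (d k x) \<partial>M)"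
    using gm by (intro nn_integral_suminf) auto
  also have "\<dots> \<le> (\<Sum>k. ennreal ((1/2) ^ k))" by (intro suminf_le dn) auto
  also have "\<dots> = ennreal (\<Sum>k. (1/2) ^ k)"
    by (intro suminf_ennreal2) (auto intro!: summable_geometric)
  finally have "(\<integral>\<^sup>+x. (\<Sum>k. ennreal (norm (d k x))) \<partial>M) \<noteq> \<infinity>"
    by (metis ennreal_less_top infinity_ennreal_def not_le top.not_eq_extremum)
  then have "AE x in M. (\<Sum>k. ennreal (norm (d k x))) \<noteq> \<infinity>"
    using gm by (intro nn_integral_noteq_infinite) auto
  then have sm: "AE x in M. summable (\<lambda>k. norm (d k x))"
    by eventually_elim (auto intro: summable_suminf_not_top)
  have si: "summable (\<lambda>k. \<integral>x. norm (d k x) \<partial>M)"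
    using fast by (intro summable_comparison_test'[OF summable_geometric[of "1/2::real"], of 0])
      (auto simp: d_def)
  have "integrable M (\<lambda>x. \<Sum>k. norm (d k x))"
    using d sm si by (intro integrable_suminf) auto
  then have W: "integrable M W" unfolding W_def using g by auto
  have g_eq: "g n x = g 0 x + (\<Sum>k<n. d k x)" for n x
    using sum_lessThan_telescope[of "\<lambda>k. g k x" n] by (simp add: d_def)
  have lim: "AE x in M. (\<lambda>k. g k x) \<longlonglongrightarrow> F x"
    using sm
  proof eventually_elim
    fix x assume "summable (\<lambda>k. norm (d k x))"
    then have "summable (\<lambda>k. d k x)" by (rule summable_norm_cancel)
    then have "(\<lambda>n. g 0 x + (\<Sum>k<n. d k x)) \<longlonglongrightarrow> F x"
      unfolding F_def by (intro tendsto_add tendsto_const summable_LIMSEQ)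
    then show "(\<lambda>k. g k x) \<longlonglongrightarrow> F x" by (simp flip: g_eq)
  qed
  have bound: "AE x in M. norm (g n x) \<le> W x" for n
    using sm
  proof eventually_elim
    fix x assume s: "summable (\<lambda>k. norm (d k x))"
    have "norm (g n x) \<le> norm (g 0 x) + (\<Sum>k<n. norm (d k x))"
      unfolding g_eq[of n x] by (rule norm_triangle_mono[OF order_refl norm_sum])
    also have "(\<Sum>k<n. norm (d k x)) \<le> (\<Sum>k. norm (d k x))"
      using s by (intro sum_le_suminf) auto
    finally show "norm (g n x) \<le> W x" by (simp add: W_def)
  qed
  have Fm: "F \<in> borel_measurable M" unfolding F_def using gm by measurable
  have "(\<lambda>k. LINT x:A|M. g k x) \<longlonglongrightarrow> (LINT x:A|M. F x)" if A: "A \<in> sets M" for A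
    unfolding set_lebesgue_integral_def
  proof (rule integral_dominated_convergence[where w = W])
    show "AE x in M. (\<lambda>k. indicat_real A x *\<^sub>R g k x) \<longlonglongrightarrow> indicat_real A x *\<^sub>R F x"
      using lim by eventually_elim (intro tendsto_scaleR tendsto_const)
    show "AE x in M. norm (indicat_real A x *\<^sub>R g k x) \<le> W x" for k
      using bound[of k] by eventually_elim (auto simp: indicator_def intro: order_trans[OF norm_ge_zero])
  qed (use Fm gm A W in auto)
  with Fm lim show ?thesis by (rule that)
qed

lemma integrable_imp_set_integrable:
  fixes f :: "'a \<Rightarrow> 'b::{banach, second_countable_topology}"
  shows "integrable M f \<Longrightarrow> A \<in> sets M \<Longrightarrow> set_integrable M A f"
  unfolding set_integrable_def by (rule integrable_mult_indicator)

locale tree_boundary = rooted_tree q adj x0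
  for q :: nat and adj :: "'v \<Rightarrow> 'v \<Rightarrow> bool" and x0 :: 'v +
  fixes \<nu> :: "(nat \<Rightarrow> 'v) measure"
  assumes boundary: "boundary_measure q adj x0 \<nu>"
begin

sublocale prob_space \<nu> using boundary by (simp add: boundary_measure_def)

abbreviation E :: "'v \<Rightarrow> (nat \<Rightarrow> 'v) set" where "E \<equiv> rays_through adj x0"

lemma space_boundary: "space \<nu> = rays adj x0"
  and sets_boundary: "sets \<nu> = sigma_sets (rays adj x0) (range E)"
  using boundary by (auto simp: boundary_measure_def)

lemma E_sets [measurable]: "E x \<in> sets \<nu>"
  unfolding sets_boundary by (intro sigma_sets.Basic) simp

lemma mem_E: "\<omega> \<in> E x \<longleftrightarrow> \<omega> \<in> rays adj x0 \<and> \<omega> (level x) = x"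
  by (simp add: rays_through_eq)

lemma E_root: "E x0 = space \<nu>"
proof -
  have "\<omega> 0 = x0" if "\<omega> \<in> rays adj x0" for \<omega> using that unfolding rays_def by blast
  then show ?thesis by (auto simp: mem_E space_boundary)
qed

lemma measure_E: "measure \<nu> (E x) = 1 / card (shell (level x))"
proof (cases "x = x0")
  case True
  then show ?thesis using boundary by (simp add: boundary_measure_def shell_0)
next
  case False
  then obtain n where n: "level x = Suc n" using gdist_eq_0_iff[of x0 x] by (cases "level x") auto
  have "measure \<nu> (E x) = 1 / ((real q + 1) * real q ^ (level x - 1))"
    using boundary False by (simp add: boundary_measure_def)
  then show ?thesis unfolding n by (simp add: card_shell algebra_simps)
qed

lemma eval_eq_sum_indicator:
  assumes "\<omega> \<in> space \<nu>"
  shows "\<phi> (\<omega> n) = (\<Sum>x\<in>shell n. indicat_real (E x) \<omega> *\<^sub>R (\<phi> x :: 'b::real_vector))"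
proof -
  have w: "\<omega> \<in> rays adj x0" using assms by (simp add: space_boundary)
  have "(\<Sum>x\<in>shell n. indicat_real (E x) \<omega> *\<^sub>R \<phi> x) = (\<Sum>x\<in>shell n. if x = \<omega> n then \<phi> x else 0)"
    using w by (intro sum.cong) (auto simp: mem_E indicator_def)
  also have "\<dots> = \<phi> (\<omega> n)" using ray_level[OF w] by simp
  finally show ?thesis by simp
qed

text \<open>
  The rays through the vertices of a level partition the boundary into sets of equal measure.
\<close>

lemma eval_has_integral:
  fixes \<phi> :: "'v \<Rightarrow> 'b::{banach, second_countable_topology, real_normed_field}"
  shows "has_bochner_integral \<nu> (\<lambda>\<omega>. \<phi> (\<omega> n)) (sphere_avg n \<phi>)"
proof -
  have "has_bochner_integral \<nu> (\<lambda>\<omega>. \<Sum>x\<in>shell n. indicat_real (E x) \<omega> *\<^sub>R \<phi> x)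
      (\<Sum>x\<in>shell n. measure \<nu> (E x) *\<^sub>R \<phi> x)"
    by (intro has_bochner_integral_sum has_bochner_integral_scaleR_left has_bochner_integral_real_indicator)
      (auto simp: emeasure_eq_measure)
  also have "(\<Sum>x\<in>shell n. measure \<nu> (E x) *\<^sub>R \<phi> x) = sphere_avg n \<phi>"
    unfolding sphere_avg_def sum_divide_distrib
    by (intro sum.cong) (auto simp: measure_E scaleR_conv_of_real)
  finally show ?thesis
    by (subst has_bochner_integral_cong[OF refl eval_eq_sum_indicator refl])
qed

lemma eval_integral:
  fixes \<phi> :: "'v \<Rightarrow> 'b::{banach, second_countable_topology, real_normed_field}"
  shows "integrable \<nu> (\<lambda>\<omega>. \<phi> (\<omega> n))" and "(\<integral>\<omega>. \<phi> (\<omega> n) \<partial>\<nu>) = sphere_avg n \<phi>"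
  using eval_has_integral[of \<phi> n] by (auto simp: has_bochner_integral_iff)

text \<open>
  The average of \<open>F\<close> over the rays through \<open>x\<close>: the factor is the reciprocal of their measure.
\<close>

definition ray_avg :: "((nat \<Rightarrow> 'v) \<Rightarrow> complex) \<Rightarrow> 'v \<Rightarrow> complex" where
  "ray_avg F x = of_nat (card (shell (level x))) * (LINT \<omega>:E x|\<nu>. F \<omega>)"

lemma E_children: "E x = (\<Union>y\<in>children x. E y)"
proof (intro set_eqI iffI)
  fix \<omega> assume w: "\<omega> \<in> E x"
  then have r: "\<omega> \<in> rays adj x0" "\<omega> (level x) = x" by (auto simp: mem_E)
  let ?y = "\<omega> (Suc (level x))"
  have ly: "level ?y = Suc (level x)" using ray_level[OF r(1)] .
  then have "?y \<noteq> x0" by auto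
  then have "?y \<in> children x" using ray_par[OF r(1), of "level x"] r(2) by (simp add: children_iff)
  moreover have "\<omega> \<in> E ?y" using r(1) ly by (simp add: mem_E)
  ultimately show "\<omega> \<in> (\<Union>y\<in>children x. E y)" by blast
next
  fix \<omega> assume "\<omega> \<in> (\<Union>y\<in>children x. E y)"
  then obtain y where y: "y \<in> children x" "\<omega> \<in> rays adj x0" "\<omega> (level y) = y" by (auto simp: mem_E)
  then have "\<omega> (level x) = x"
    using ray_par[OF y(2), of "level x"] level_child[OF y(1)] y(1) by (simp add: children_iff)
  then show "\<omega> \<in> E x" using y by (simp add: mem_E)
qed

lemma E_disjoint: "level x = level y \<Longrightarrow> x \<noteq> y \<Longrightarrow> E x \<inter> E y = {}"
  by (auto simp: mem_E)

lemma integral_E_children: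
  fixes F :: "(nat \<Rightarrow> 'v) \<Rightarrow> 'b::{banach, second_countable_topology}"
  assumes "integrable \<nu> F"
  shows "(LINT \<omega>:E x|\<nu>. F \<omega>) = (\<Sum>y\<in>children x. LINT \<omega>:E y|\<nu>. F \<omega>)"
proof -
  have "(LINT \<omega>:(\<Union>y\<in>children x. E y)|\<nu>. F \<omega>) = (\<Sum>y\<in>children x. LINT \<omega>:E y|\<nu>. F \<omega>)"
  proof (rule set_integral_finite_Union)
    show "disjoint_family_on E (children x)"
      unfolding disjoint_family_on_def by (intro ballI impI E_disjoint) (simp_all add: level_child)
  qed (auto intro!: integrable_imp_set_integrable assms)
  then show ?thesis by (simp flip: E_children)
qed

lemma ray_avg_tree_martingale:
  assumes "integrable \<nu> F"
  shows "tree_martingale (ray_avg F)"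
  unfolding tree_martingale_def
proof
  fix x
  have "(\<Sum>y\<in>children x. ray_avg F y)
     = (\<Sum>y\<in>children x. of_nat (card (shell (Suc (level x)))) * (LINT \<omega>:E y|\<nu>. F \<omega>))"
    by (intro sum.cong refl) (simp add: ray_avg_def level_child)
  also have "\<dots> = of_nat (card (shell (Suc (level x)))) * (LINT \<omega>:E x|\<nu>. F \<omega>)"
    by (subst integral_E_children[OF assms]) (simp add: sum_distrib_left)
  finally show "(\<Sum>y\<in>children x. ray_avg F y) = of_nat (branching (level x)) * ray_avg F x"
    by (simp add: ray_avg_def card_shell_Suc)
qed

lemma integral_sum_E:
  fixes F :: "(nat \<Rightarrow> 'v) \<Rightarrow> 'b::{banach, second_countable_topology}"
  assumes "integrable \<nu> F"
  shows "(\<Sum>x\<in>shell n. LINT \<omega>:E x|\<nu>. F \<omega>) = (\<integral>\<omega>. F \<omega> \<partial>\<nu>)"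
proof (induction n)
  case 0
  have "(LINT \<omega>:space \<nu>|\<nu>. F \<omega>) = (\<integral>\<omega>. F \<omega> \<partial>\<nu>)"
    using assms by (rule set_integral_space)
  then show ?case by (simp add: shell_0 E_root)
next
  case (Suc n)
  then show ?case by (simp add: sum_shell_Suc flip: integral_E_children[OF assms])
qed

lemma Lr_integrable:
  assumes "F \<in> Lr_space \<nu> r" "1 \<le> r"
  shows "integrable \<nu> F"
proof (rule Bochner_Integration.integrable_bound[where f = "\<lambda>\<omega>. 1 + norm (F \<omega>) powr r"])
  show "integrable \<nu> (\<lambda>\<omega>. 1 + norm (F \<omega>) powr r)" "F \<in> borel_measurable \<nu>"
    using assms by (auto simp: Lr_space_def)
  have "norm (F \<omega>) \<le> 1 + norm (F \<omega>) powr r" for \<omega>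
  proof (cases "norm (F \<omega>) \<le> 1")
    case False
    then have "norm (F \<omega>) powr 1 \<le> norm (F \<omega>) powr r" using assms by (intro powr_mono) auto
    then show ?thesis using False by auto
  qed (simp add: add_increasing2)
  then show "AE \<omega> in \<nu>. norm (F \<omega>) \<le> norm (1 + norm (F \<omega>) powr r)"
    by (intro AE_I2) (simp add: abs_of_nonneg add_nonneg_nonneg)
qed

text \<open>
  Jensen's inequality on each set of rays through a vertex: integrate the tangent of the power function at
  the average of \<open>\<bar>F\<bar>\<close>.
\<close>

lemma ray_avg_Lr_bound:
  assumes F: "F \<in> Lr_space \<nu> r" and r: "1 \<le> r"
  shows "power_mean r n (ray_avg F) \<le> (\<integral>\<omega>. norm (F \<omega>) powr r \<partial>\<nu>)"
proof -
  note Fi = Lr_integrable[OF F r]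
  have Fr: "integrable \<nu> (\<lambda>\<omega>. norm (F \<omega>) powr r)" using F by (simp add: Lr_space_def)
  define N where "N = real (card (shell n))"
  have N: "0 < N" using card_shell_pos by (simp add: N_def)
  have "norm (ray_avg F x) powr r \<le> N * (LINT \<omega>:E x|\<nu>. norm (F \<omega>) powr r)"
    if x: "x \<in> shell n" for x
  proof -
    have lx: "level x = n" using x by simp
    have iF: "set_integrable \<nu> (E x) (\<lambda>\<omega>. norm (F \<omega>))" "set_integrable \<nu> (E x) (\<lambda>\<omega>. norm (F \<omega>) powr r)"
       "set_integrable \<nu> (E x) (\<lambda>\<omega>. c::real)" for c
      using Fi Fr by (auto intro!: integrable_imp_set_integrable)
    define I where "I = (LINT \<omega>:E x|\<nu>. norm (F \<omega>))"
    define s where "s = N * I"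
    have I: "0 \<le> I" unfolding I_def set_lebesgue_integral_def by (intro integral_nonneg_AE) auto
    have const: "(LINT \<omega>:E x|\<nu>. c::real) = c / N" for c
      unfolding set_lebesgue_integral_def N_def by (simp add: measure_E lx)
    have "norm (ray_avg F x) \<le> s"
      unfolding ray_avg_def lx s_def N_def I_def norm_mult
      using Fi by (simp, intro mult_left_mono set_integral_norm_bound)
        (auto intro!: integrable_imp_set_integrable)
    then have "norm (ray_avg F x) powr r \<le> s powr r"
      using r by (intro powr_mono2) auto
    also have "s powr r / N = (LINT \<omega>:E x|\<nu>. s powr r + r * s powr (r - 1) * (norm (F \<omega>) - s))"
    proof -
      have "(LINT \<omega>:E x|\<nu>. s powr r + r * s powr (r - 1) * (norm (F \<omega>) - s))
        = s powr r / N + r * s powr (r - 1) * (I - s / N)"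
        using iF const by (simp add: I_def set_integral_add set_integral_diff)
      then show ?thesis using N by (simp add: s_def)
    qed
    also have "\<dots> \<le> (LINT \<omega>:E x|\<nu>. norm (F \<omega>) powr r)"
      using iF r powr_above_tangent[of r s] I N by (intro set_integral_mono set_integral_add) (auto simp: s_def)
    finally show ?thesis using N by (simp add: field_simps)
  qed
  then have "(\<Sum>x\<in>shell n. norm (ray_avg F x) powr r)
     \<le> (\<Sum>x\<in>shell n. N * (LINT \<omega>:E x|\<nu>. norm (F \<omega>) powr r))"
    by (intro sum_mono)
  also have "\<dots> = N * (\<integral>\<omega>. norm (F \<omega>) powr r \<partial>\<nu>)"
    by (simp add: integral_sum_E[OF Fr] flip: sum_distrib_left)
  finally show ?thesis using N by (simp add: sphere_avg_def N_def field_simps)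
qed

text \<open>
  The averages determine the integrals over the sets \<open>E x\<close>, which, with the empty set, are closed under
  intersection and generate the \<open>\<sigma>\<close>-algebra; a Dynkin system argument extends the equality to all
  measurable sets.
\<close>

lemma ray_avg_unique:
  assumes F: "integrable \<nu> F" and G: "integrable \<nu> G"
    and eq: "\<And>x. ray_avg F x = ray_avg G x"
  shows "AE \<omega> in \<nu>. F \<omega> = G \<omega>"
proof -
  have E_eq: "(LINT \<omega>:E x|\<nu>. F \<omega>) = (LINT \<omega>:E x|\<nu>. G \<omega>)" for x
    using eq[of x] card_shell_pos[of "level x"] by (simp add: ray_avg_def del: card_0_eq)
  have int: "set_integrable \<nu> A F" "set_integrable \<nu> A G" if "A \<in> sets \<nu>" for A
    using F G that by (auto intro: integrable_imp_set_integrable)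
  let ?G = "insert {} (range E)"
  have stable: "Int_stable ?G"
  proof (rule Int_stableI)
    fix A B assume "A \<in> ?G" "B \<in> ?G"
    moreover have "E x \<inter> E y \<in> ?G" if "level x \<le> level y" for x y
    proof (cases "anc (level x) y = x")
      case True
      have "E y \<subseteq> E x"
      proof
        fix \<omega> assume "\<omega> \<in> E y"
        then show "\<omega> \<in> E x" using ray_anc[of \<omega> "level x" "level y"] that True by (auto simp: mem_E)
      qed
      then have "E x \<inter> E y = E y" by blast
      then show ?thesis by simp
    next
      case False
      have "E x \<inter> E y = {}"
        using ray_anc[of _ "level x" "level y"] that False by (fastforce simp: mem_E)
      then show ?thesis by simp
    qed
    moreover have "E x \<inter> E y \<in> ?G" for x y
      using calculation(3)[of x y] calculation(3)[of y x] by (cases "level x \<le> level y") (auto simp: Int_commute)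
    ultimately show "A \<inter> B \<in> ?G" by auto
  qed
  have all: "(LINT \<omega>:A|\<nu>. F \<omega>) = (LINT \<omega>:A|\<nu>. G \<omega>)" if A: "A \<in> sets \<nu>" for A
  proof -
    have Gsub: "?G \<subseteq> Pow (rays adj x0)" by (auto simp: mem_E)
    have sig: "sigma_sets (rays adj x0) ?G = sets \<nu>"
      unfolding sets_boundary
    proof (intro antisym)
      show "sigma_sets (rays adj x0) ?G \<subseteq> sigma_sets (rays adj x0) (range E)"
        by (rule sigma_sets_mono) (auto intro: sigma_sets.intros)
    qed (rule sigma_sets_mono', auto)
    have "A \<in> sigma_sets (rays adj x0) ?G" using A sig by simp
    from stable Gsub this show ?thesis
    proof (induction rule: sigma_sets_induct_disjoint)
      case (basic A)
      then show ?case using E_eq by (auto simp: set_lebesgue_integral_def)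
    next
      case empty
      show ?case by (simp add: set_lebesgue_integral_def)
    next
      case (compl A)
      then have A: "A \<in> sets \<nu>" by (simp add: sig)
      have c: "(LINT \<omega>:(space \<nu> - A)|\<nu>. H \<omega>) = (LINT \<omega>:E x0|\<nu>. H \<omega>) - (LINT \<omega>:A|\<nu>. H \<omega>)"
        if H: "integrable \<nu> H" for H :: "(nat \<Rightarrow> 'v) \<Rightarrow> complex"
      proof -
        have "(LINT \<omega>:(space \<nu> - A) \<union> A|\<nu>. H \<omega>) = (LINT \<omega>:(space \<nu> - A)|\<nu>. H \<omega>) + (LINT \<omega>:A|\<nu>. H \<omega>)"
          using A H by (intro set_integral_Un) (auto intro!: integrable_imp_set_integrable)
        moreover have "(space \<nu> - A) \<union> A = E x0" using sets.sets_into_space[OF A] by (auto simp: E_root)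
        ultimately show ?thesis by simp
      qed
      show ?case using c[OF F] c[OF G] compl E_eq[of x0] by (simp add: space_boundary)
    next
      case (union A)
      then have A: "A i \<in> sets \<nu>" for i using sig by blast
      have "(LINT \<omega>:(\<Union>i. A i)|\<nu>. H \<omega>) = (\<Sum>i. LINT \<omega>:A i|\<nu>. H \<omega>)"
        if H: "integrable \<nu> H" for H :: "(nat \<Rightarrow> 'v) \<Rightarrow> complex"
        using union(1) A H by (intro lebesgue_integral_countable_add)
          (auto simp: disjoint_family_on_def intro!: integrable_imp_set_integrable)
      then show ?case using F G union by simp
    qed
  qed
  have "AE \<omega> in \<nu>. Re (F \<omega>) = Re (G \<omega>)"
  proof (rule density_unique_real)
    fix A assume A: "A \<in> sets \<nu>"
    show "(LINT \<omega>:A|\<nu>. Re (F \<omega>)) = (LINT \<omega>:A|\<nu>. Re (G \<omega>))"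
      using arg_cong[OF all[OF A], of Re] int[OF A]
      by (simp add: set_lebesgue_integral_def set_integrable_def flip: integral_Re)
  qed (use F G in auto)
  moreover have "AE \<omega> in \<nu>. Im (F \<omega>) = Im (G \<omega>)"
  proof (rule density_unique_real)
    fix A assume A: "A \<in> sets \<nu>"
    show "(LINT \<omega>:A|\<nu>. Im (F \<omega>)) = (LINT \<omega>:A|\<nu>. Im (G \<omega>))"
      using arg_cong[OF all[OF A], of Im] int[OF A]
      by (simp add: set_lebesgue_integral_def set_integrable_def flip: integral_Im)
  qed (use F G in auto)
  ultimately show ?thesis by eventually_elim (simp add: complex_eq_iff)
qed

end

section \<open>Convergence of bounded martingales\<close>

context rooted_tree
begin

text \<open>
  The means of \<open>s = sqrt (1 + \<bar>f\<bar>\<^sup>2)\<close> over the spheres are bounded. Taking \<open>n\<close> where this mean almost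
  attains its supremum over all levels from \<open>N\<close> on, later means exceed it by very little, and
  \<open>tree_martingale_L1_distance\<close> bounds the \<open>L\<^sup>1\<close> distance to every later level.
\<close>

lemma Lr_bounded_cauchy_step:
  fixes \<epsilon> r C :: real
  assumes f: "tree_martingale f" and r: "1 < r"
    and C: "\<And>n. power_mean r n f \<le> C" and \<epsilon>: "0 < \<epsilon>"
  shows "\<exists>n\<ge>N. \<forall>m\<ge>n. sphere_avg m (\<lambda>x. norm (f x - f (anc n x))) \<le> \<epsilon>"
proof -
  define s where "s x = sqrt (1 + (norm (f x))\<^sup>2)" for x
  define C' where "C' = 2 powr r * (1 + C)"
  have s1: "1 \<le> s x" for x by (simp add: s_def)
  have sr: "s x powr r \<le> 2 powr r * (1 + norm (f x) powr r)" for x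
  proof -
    have "s x \<le> sqrt ((1 + norm (f x))\<^sup>2)"
      unfolding s_def by (intro real_sqrt_le_mono) (simp add: power2_eq_square algebra_simps)
    then have "s x \<le> 2 * max 1 (norm (f x))" by auto
    then have "s x powr r \<le> (2 * max 1 (norm (f x))) powr r"
      using s1[of x] r by (intro powr_mono2) auto
    also have "\<dots> = 2 powr r * max 1 (norm (f x)) powr r" by (simp add: powr_mult)
    also have "max 1 (norm (f x)) powr r \<le> 1 + norm (f x) powr r" by (simp add: max_def)
    finally show ?thesis by simp
  qed
  have avg_r: "sphere_avg n (\<lambda>x. s x powr r) \<le> C'" for n
  proof -
    have "sphere_avg n (\<lambda>x. s x powr r) \<le> sphere_avg n (\<lambda>x. 2 powr r * (1 + norm (f x) powr r))"
      by (intro sphere_avg_mono sr)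
    also have "\<dots> = 2 powr r * (1 + power_mean r n f)"
      by (simp only: sphere_avg_cmult sphere_avg_add sphere_avg_const)
    also have "\<dots> \<le> C'" unfolding C'_def using C[of n] by (intro mult_left_mono) auto
    finally show ?thesis .
  qed
  have avg_1: "sphere_avg n s \<le> C'" for n
  proof -
    have "s x \<le> s x powr r" for x
      using powr_mono[of 1 r "s x"] s1[of x] r by simp
    then show ?thesis using sphere_avg_mono[of n s "\<lambda>x. s x powr r"] avg_r[of n] by force
  qed
  have C'0: "0 \<le> C'" using avg_r[of 0] sphere_avg_nonneg[of "\<lambda>x. s x powr r" 0] by force
  \<comment> \<open>The tail term of the distance bound is at most \<open>\<epsilon> / 3\<close> once the truncation height \<open>B\<close> is large.\<close>
  obtain B where B: "1 \<le> B" "4 * B powr (1 - r) * C' \<le> \<epsilon> / 3"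
  proof -
    have "((\<lambda>B. 4 * B powr (1 - r) * C') \<longlongrightarrow> 4 * 0 * C') at_top"
      using r by (intro tendsto_intros tendsto_neg_powr filterlim_ident) auto
    then have "\<forall>\<^sub>F B in at_top. 4 * B powr (1 - r) * C' < \<epsilon> / 3"
      using \<epsilon> by (intro order_tendstoD(2)[of _ 0]) auto
    then have "\<forall>\<^sub>F B in at_top. 1 \<le> B \<and> 4 * B powr (1 - r) * C' \<le> \<epsilon> / 3"
      using eventually_ge_at_top[of "1::real"] by eventually_elim auto
    then show thesis using that eventually_happens by fastforce
  qed
  define \<delta> where "\<delta> = \<epsilon> / 3"
  have \<delta>: "0 < \<delta>" using \<epsilon> by (simp add: \<delta>_def)
  define K where "K = 2 * B ^ 3 / \<delta>"
  have K: "0 < K" using B \<delta> by (simp add: K_def)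
  define L where "L = (SUP n\<in>{N..}. sphere_avg n s)"
  have bdd: "bdd_above ((\<lambda>n. sphere_avg n s) ` {N..})"
    using avg_1 by (intro bdd_aboveI[of _ C']) auto
  have "\<exists>n\<in>{N..}. L - \<epsilon> / 3 / K < sphere_avg n s"
    unfolding L_def using \<epsilon> K bdd
    by (intro less_cSUP_iff[THEN iffD1]) (auto simp: field_simps)
  then obtain n where n: "N \<le> n" "L - \<epsilon> / 3 / K < sphere_avg n s" by auto
  have "sphere_avg m (\<lambda>x. norm (f x - f (anc n x))) \<le> \<epsilon>" if m: "n \<le> m" for m
  proof -
    have "sphere_avg m s \<le> L"
      unfolding L_def using m n by (intro cSUP_upper bdd) auto
    then have "sphere_avg m s - sphere_avg n s \<le> \<epsilon> / 3 / K" using n by simp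
    then have "K * (sphere_avg m s - sphere_avg n s) \<le> K * (\<epsilon> / 3 / K)"
      using K by (intro mult_left_mono) auto
    then have 1: "K * (sphere_avg m s - sphere_avg n s) \<le> \<epsilon> / 3" using K by simp
    have "2 * B powr (1 - r) * (sphere_avg n (\<lambda>x. s x powr r) + sphere_avg m (\<lambda>x. s x powr r))
      \<le> 2 * B powr (1 - r) * (C' + C')"
      using avg_r by (intro mult_left_mono add_mono) auto
    also have "\<dots> \<le> \<epsilon> / 3" using B by simp
    finally show ?thesis
      using tree_martingale_L1_distance[OF f \<delta> B(1) r m] 1
      unfolding s_def[symmetric] K_def[symmetric] using \<delta>_def by linarith
  qed
  with n(1) show ?thesis by blast
qed

end

context tree_boundary
begin

text \<open>
  Pair the martingale with the indicator of the descendants of \<open>x\<close>, which is known at the level of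
  \<open>x\<close>.
\<close>

lemma tree_martingale_integral_E:
  assumes f: "tree_martingale f" and N: "level x \<le> N"
  shows "(LINT \<omega>:E x|\<nu>. f (\<omega> N)) = f x / of_nat (card (shell (level x)))"
proof -
  interpret finite_filtration "shell N" anc by (rule anc_filtration)
  define n where "n = level x"
  define c where "c y = (if anc n y = x then 1 else 0 :: complex)" for y
  have "(LINT \<omega>:E x|\<nu>. f (\<omega> N)) = (\<integral>\<omega>. c (\<omega> N) * f (\<omega> N) \<partial>\<nu>)"
    unfolding set_lebesgue_integral_def
  proof (intro Bochner_Integration.integral_cong refl)
    fix \<omega> assume "\<omega> \<in> space \<nu>"
    then have w: "\<omega> \<in> rays adj x0" by (simp add: space_boundary)
    show "indicat_real (E x) \<omega> *\<^sub>R f (\<omega> N) = c (\<omega> N) * f (\<omega> N)"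
      using ray_anc[OF w N] w by (auto simp: c_def mem_E n_def indicator_def)
  qed
  also have "\<dots> = sphere_avg N (\<lambda>y. c y * f y)" by (rule eval_integral(2)[of "\<lambda>y. c y * f y"])
  also have "\<dots> = sphere_avg N (\<lambda>y. c y * f (anc n y))"
  proof -
    have "adapted_at n c" by (simp add: adapted_at_def c_def)
    from is_cond_expD[OF martingale_cond_exp[OF anc_martingale[OF f] N[folded n_def]] this]
    have "(\<Sum>y\<in>shell N. c y * f (anc N y)) = (\<Sum>y\<in>shell N. c y * f (anc n y))" .
    moreover have "(\<Sum>y\<in>shell N. c y * f (anc N y)) = (\<Sum>y\<in>shell N. c y * f y)"
      by (intro sum.cong) (auto simp: anc_ge)
    ultimately show ?thesis by (simp add: sphere_avg_def)
  qed
  also have "\<dots> = sphere_avg N (\<lambda>y. (\<lambda>v. if v = x then f v else 0) (anc n y))"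
    by (intro sphere_avg_cong) (simp add: c_def)
  also have "\<dots> = sphere_avg n (\<lambda>v. if v = x then f v else 0)"
    by (rule sphere_avg_anc[OF N[folded n_def]])
  also have "\<dots> = f x / of_nat (card (shell n))"
    by (simp add: sphere_avg_def n_def)
  finally show ?thesis by (simp add: n_def)
qed

text \<open>
  Along a rapidly converging subsequence of levels the functions \<open>\<lambda>\<omega>. f (\<omega> n)\<close> converge in \<open>L\<^sup>1\<close> and almost
  everywhere. Convergence of the integrals over \<open>E x\<close> identifies the averages of the limit, and Fatou's
  lemma bounds its \<open>r\<close>-th moment.
\<close>

lemma Lr_bounded_martingale_closed:
  fixes r C :: real
  assumes f: "tree_martingale f" and r: "1 < r"
    and C: "\<And>n. power_mean r n f \<le> C"
  obtains F where "F \<in> Lr_space \<nu> r" "ray_avg F = f" "(\<integral>\<omega>. norm (F \<omega>) powr r \<partial>\<nu>) \<le> C"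
proof -
  have "\<exists>\<sigma>. \<forall>k. (\<forall>m\<ge>\<sigma> k. sphere_avg m (\<lambda>x. norm (f x - f (anc (\<sigma> k) x))) \<le> (1/2) ^ k) \<and> \<sigma> k < \<sigma> (Suc k)"
  proof (rule dependent_nat_choice)
    show "\<exists>n. \<forall>m\<ge>n. sphere_avg m (\<lambda>x. norm (f x - f (anc n x))) \<le> (1/2) ^ 0"
      using Lr_bounded_cauchy_step[OF f r C, of 1 0] by auto
    show "\<exists>n'. (\<forall>m\<ge>n'. sphere_avg m (\<lambda>x. norm (f x - f (anc n' x))) \<le> (1/2) ^ Suc k) \<and> n < n'" for n k
      using Lr_bounded_cauchy_step[OF f r C, of "(1/2) ^ Suc k" "Suc n"] by auto
  qed
  then obtain \<sigma> where
    \<sigma>: "\<And>k m. \<sigma> k \<le> m \<Longrightarrow> sphere_avg m (\<lambda>x. norm (f x - f (anc (\<sigma> k) x))) \<le> (1/2) ^ k"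
    and mono: "strict_mono \<sigma>" by (auto simp: strict_mono_Suc_iff)
  define g where "g k \<omega> = f (\<omega> (\<sigma> k))" for k \<omega>
  have gi: "integrable \<nu> (g k)" for k unfolding g_def by (rule eval_integral(1))
  have fast: "(\<integral>\<omega>. norm (g (Suc k) \<omega> - g k \<omega>) \<partial>\<nu>) \<le> (1/2) ^ k" for k
  proof -
    have le: "\<sigma> k \<le> \<sigma> (Suc k)" using mono by (simp add: strict_mono_less_eq)
    have "(\<integral>\<omega>. norm (g (Suc k) \<omega> - g k \<omega>) \<partial>\<nu>)
      = (\<integral>\<omega>. (\<lambda>v. norm (f v - f (anc (\<sigma> k) v))) (\<omega> (\<sigma> (Suc k))) \<partial>\<nu>)"
      by (intro Bochner_Integration.integral_cong refl)
        (simp add: g_def space_boundary ray_anc[OF _ le])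
    also have "\<dots> = sphere_avg (\<sigma> (Suc k)) (\<lambda>v. norm (f v - f (anc (\<sigma> k) v)))"
      by (rule eval_integral(2)[of "\<lambda>v. norm (f v - f (anc (\<sigma> k) v))"])
    also have "\<dots> \<le> (1/2) ^ k" by (rule \<sigma>[OF le])
    finally show ?thesis .
  qed
  obtain F where Fm: "F \<in> borel_measurable \<nu>" and lim: "AE \<omega> in \<nu>. (\<lambda>k. g k \<omega>) \<longlonglongrightarrow> F \<omega>"
    and limI: "\<And>A. A \<in> sets \<nu> \<Longrightarrow> (\<lambda>k. LINT \<omega>:A|\<nu>. g k \<omega>) \<longlonglongrightarrow> (LINT \<omega>:A|\<nu>. F \<omega>)"
    using L1_fast_cauchy_limit[OF gi fast] by blast
  have C0: "0 \<le> C" using C[of 0] sphere_avg_nonneg[of "\<lambda>x. norm (f x) powr r" 0] by force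
  let ?m = "\<lambda>F \<omega>. ennreal (norm (F \<omega>) powr r)"
  have nnF: "(\<integral>\<^sup>+\<omega>. ?m F \<omega> \<partial>\<nu>) \<le> ennreal C"
  proof -
    have "(\<integral>\<^sup>+\<omega>. ?m F \<omega> \<partial>\<nu>) = (\<integral>\<^sup>+\<omega>. liminf (\<lambda>k. ?m (g k) \<omega>) \<partial>\<nu>)"
    proof (rule nn_integral_cong_AE)
      show "AE \<omega> in \<nu>. ?m F \<omega> = liminf (\<lambda>k. ?m (g k) \<omega>)"
        using lim
      proof eventually_elim
        fix \<omega> assume "(\<lambda>k. g k \<omega>) \<longlonglongrightarrow> F \<omega>"
        then have "(\<lambda>k. norm (g k \<omega>) powr r) \<longlonglongrightarrow> norm (F \<omega>) powr r"
          using r by (intro tendsto_powr' tendsto_norm tendsto_const) auto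
        then have "(\<lambda>k. ?m (g k) \<omega>) \<longlonglongrightarrow> ?m F \<omega>"
          by (rule tendsto_ennrealI)
        then show "?m F \<omega> = liminf (\<lambda>k. ?m (g k) \<omega>)"
          by (intro lim_imp_Liminf[symmetric]) auto
      qed
    qed
    also have "\<dots> \<le> liminf (\<lambda>k. \<integral>\<^sup>+\<omega>. ?m (g k) \<omega> \<partial>\<nu>)"
      using gi by (intro nn_integral_liminf) auto
    also have "\<dots> \<le> liminf (\<lambda>k. ennreal C)"
    proof (intro Liminf_mono always_eventually allI)
      fix k
      have "(\<integral>\<^sup>+\<omega>. ?m (g k) \<omega> \<partial>\<nu>) = ennreal (power_mean r (\<sigma> k) f)"
        using eval_integral[of "\<lambda>v. norm (f v) powr r" "\<sigma> k"]
        by (subst nn_integral_eq_integral) (auto simp: g_def)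
      also have "\<dots> \<le> ennreal C" by (intro ennreal_leI C)
      finally show "(\<integral>\<^sup>+\<omega>. ?m (g k) \<omega> \<partial>\<nu>) \<le> ennreal C" .
    qed
    also have "\<dots> = ennreal C" by (intro lim_imp_Liminf) auto
    finally show ?thesis .
  qed
  have Fr: "integrable \<nu> (\<lambda>\<omega>. norm (F \<omega>) powr r)"
    using Fm nnF by (intro integrableI_bounded) (auto intro: le_less_trans)
  have "ennreal (\<integral>\<omega>. norm (F \<omega>) powr r \<partial>\<nu>) \<le> ennreal C"
    using nnF Fr by (subst nn_integral_eq_integral[symmetric]) auto
  then have le: "(\<integral>\<omega>. norm (F \<omega>) powr r \<partial>\<nu>) \<le> C" using C0 by simp
  have "ray_avg F x = f x" for x
  proof -
    have "(\<lambda>k. LINT \<omega>:E x|\<nu>. g k \<omega>) \<longlonglongrightarrow> (LINT \<omega>:E x|\<nu>. F \<omega>)" by (rule limI) simp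
    moreover have "(\<lambda>k. LINT \<omega>:E x|\<nu>. g k \<omega>) \<longlonglongrightarrow> f x / of_nat (card (shell (level x)))"
    proof (rule tendsto_eventually)
      have "level x \<le> \<sigma> k" if "level x \<le> k" for k
        using strict_mono_imp_increasing[OF mono, of k] that by linarith
      then show "\<forall>\<^sub>F k in sequentially. (LINT \<omega>:E x|\<nu>. g k \<omega>) = f x / of_nat (card (shell (level x)))"
        unfolding g_def using tree_martingale_integral_E[OF f]
        by (intro eventually_sequentiallyI[of "level x"]) auto
    qed
    ultimately have "(LINT \<omega>:E x|\<nu>. F \<omega>) = f x / of_nat (card (shell (level x)))"
      by (rule LIMSEQ_unique)
    then show ?thesis using card_shell_pos[of "level x"]
      by (simp add: ray_avg_def del: card_0_eq)
  qed
  then have "ray_avg F = f" by auto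
  moreover have "F \<in> Lr_space \<nu> r" using Fm Fr by (simp add: Lr_space_def)
  ultimately show ?thesis using le that by blast
qed

text \<open>
  The function constructed from the averages of \<open>F\<close> agrees with \<open>F\<close> almost everywhere and obeys the
  bound.
\<close>

lemma integral_powr_le_of_martingale:
  fixes r C :: real
  assumes F: "F \<in> Lr_space \<nu> r" and r: "1 < r"
    and C: "\<And>n. power_mean r n (ray_avg F) \<le> C"
  shows "(\<integral>\<omega>. norm (F \<omega>) powr r \<partial>\<nu>) \<le> C"
proof -
  have Fi: "integrable \<nu> F" using Lr_integrable[OF F] r by simp
  obtain G where G: "G \<in> Lr_space \<nu> r" "ray_avg G = ray_avg F"
    "(\<integral>\<omega>. norm (G \<omega>) powr r \<partial>\<nu>) \<le> C"
    using Lr_bounded_martingale_closed[OF ray_avg_tree_martingale[OF Fi] r C] by blast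
  have Gi: "integrable \<nu> G" using Lr_integrable[OF G(1)] r by simp
  have "AE \<omega> in \<nu>. F \<omega> = G \<omega>"
    by (rule ray_avg_unique[OF Fi Gi]) (simp add: G(2))
  then have "(\<integral>\<omega>. norm (F \<omega>) powr r \<partial>\<nu>) = (\<integral>\<omega>. norm (G \<omega>) powr r \<partial>\<nu>)"
    using F G(1) by (intro integral_cong_AE) (auto simp: Lr_space_def)
  then show ?thesis using G(3) by simp
qed

end

section \<open>Geometrically weighted sums along a martingale\<close>

text \<open>
  If all powers of \<open>w\<close> stayed within distance \<open>1\<close> of \<open>1\<close>, they would have real part above \<open>1/2\<close>, and squaring
  would multiply the distance to \<open>1\<close> by at least \<open>3/2\<close> each time.
\<close>

lemma unit_power_far_from_1:
  fixes w :: complex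
  assumes w: "norm w = 1" "w \<noteq> 1"
  shows "\<exists>k. 1 \<le> norm (w ^ k - 1)"
proof (rule ccontr)
  assume "\<not> ?thesis"
  then have lt: "norm (w ^ k - 1) < 1" for k by (auto simp: not_le)
  have step: "3/2 * norm (w ^ k - 1) \<le> norm (w ^ (2 * k) - 1)" for k
  proof -
    define v where "v = w ^ k"
    have "norm v = 1" by (simp add: v_def norm_power w)
    then have v: "(Re v)\<^sup>2 + (Im v)\<^sup>2 = 1" by (simp add: cmod_def)
    have "(norm (v - 1))\<^sup>2 < 1" using lt[of k] by (simp add: v_def power_less_one_iff)
    then have "(Re v - 1)\<^sup>2 + (Im v)\<^sup>2 < 1" by (simp add: cmod_power2)
    then have "1/2 < Re v" using v by (simp add: power2_eq_square algebra_simps)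
    then have "3/2 \<le> norm (v + 1)" using complex_Re_le_cmod[of "v + 1"] by simp
    then have "3/2 * norm (v - 1) \<le> norm (v + 1) * norm (v - 1)" by (intro mult_right_mono) auto
    also have "\<dots> = norm (v * v - 1)" by (simp add: norm_mult[symmetric] algebra_simps)
    finally show ?thesis by (simp add: v_def mult_2 power_add)
  qed
  have grow: "(3/2) ^ n * norm (w - 1) \<le> norm (w ^ (2 ^ n) - 1)" for n
  proof (induction n)
    case (Suc n)
    have "(3/2) ^ Suc n * norm (w - 1) = 3/2 * ((3/2) ^ n * norm (w - 1))" by simp
    also have "\<dots> \<le> 3/2 * norm (w ^ (2 ^ n) - 1)" by (intro mult_left_mono Suc.IH) simp
    also have "\<dots> \<le> norm (w ^ (2 ^ Suc n) - 1)" using step[of "2 ^ n"] by simp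
    finally show ?case .
  qed simp
  have "0 < norm (w - 1)" using w by simp
  obtain n where "1 / norm (w - 1) < (3/2) ^ n" using real_arch_pow[of "3/2" "1 / norm (w - 1)"] by auto
  then have "1 < (3/2) ^ n * norm (w - 1)" using \<open>0 < norm (w - 1)\<close> by (simp add: field_simps)
  with grow[of n] lt[of "2 ^ n"] show False by linarith
qed

lemma summation_by_parts_geometric:
  fixes w :: "'a::comm_ring_1"
  shows "(w - 1) * (\<Sum>j<n. w ^ Suc j * a (Suc j))
    = w ^ Suc n * a n - (a 0 + (\<Sum>j<n. w ^ Suc j * (a (Suc j) - a j))) - (w - 1) * a 0"
  by (induction n) (simp_all add: algebra_simps)

context rooted_tree
begin

definition kappa :: "complex \<Rightarrow> complex" where
  "kappa w = (of_nat q - inverse w) / (of_nat q + 1)"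

text \<open>
  Up to the factor \<open>q powr (n (1/2 + i z))\<close> this is the Poisson transform at a vertex of level \<open>n\<close>, when \<open>f\<close>
  consists of the averages of a boundary function and \<open>w = q powr (2 i z)\<close>.
\<close>

definition spectral_sum :: "complex \<Rightarrow> ('v \<Rightarrow> complex) \<Rightarrow> 'v \<Rightarrow> complex" where
  "spectral_sum w f x = f x0 + kappa w * (\<Sum>j<level x. w ^ Suc j * f (anc (Suc j) x))"

lemma kappa_mult:
  assumes "w \<noteq> 0"
  shows "kappa w * w * (of_nat q + 1) = of_nat q * w - 1"
proof -
  have "of_nat q + (1::complex) \<noteq> 0" by (metis of_nat_Suc of_nat_neq_0 add.commute)
  then have "kappa w * (of_nat q + 1) = of_nat q - inverse w" by (simp add: kappa_def)
  then have "w * (kappa w * (of_nat q + 1)) = w * (of_nat q - inverse w)" by simp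
  then show ?thesis using assms by (simp add: right_diff_distrib mult_ac)
qed

text \<open>
  Since \<open>q \<ge> 2\<close>, \<open>kappa w\<close> is bounded away from zero on the unit circle, which makes the constants
  uniform in \<open>z\<close>.
\<close>

lemma kappa_bounds:
  assumes "norm w = 1"
  shows "(real q - 1) / (real q + 1) \<le> norm (kappa w)" and "norm (1 - kappa w) \<le> 2 / (real q + 1)"
    and "kappa w \<noteq> 0"
proof -
  have nq: "norm (of_nat q + 1 :: complex) = real q + 1"
    by (metis norm_of_nat of_nat_Suc add.commute)
  have q1: "of_nat q + (1::complex) \<noteq> 0" using nq by (metis norm_zero of_nat_0_le_iff add_nonneg_eq_0_iff zero_neq_one zero_le_one)
  have "real q - 1 \<le> norm (of_nat q - inverse w)"
    using norm_triangle_ineq2[of "of_nat q" "inverse w"] assms by (simp add: norm_inverse)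
  then show 1: "(real q - 1) / (real q + 1) \<le> norm (kappa w)"
    unfolding kappa_def norm_divide nq by (intro divide_right_mono) auto
  have "1 - kappa w = (1 + inverse w) / (of_nat q + 1)"
    using q1 by (simp add: kappa_def field_simps)
  moreover have "norm (1 + inverse w) \<le> 2"
    using norm_triangle_ineq[of 1 "inverse w"] assms by (simp add: norm_inverse)
  ultimately show "norm (1 - kappa w) \<le> 2 / (real q + 1)"
    by (simp add: norm_divide nq divide_right_mono)
  have "0 < (real q - 1) / (real q + 1)" using q_ge_2 by auto
  with 1 show "kappa w \<noteq> 0" by auto
qed

definition upper_const :: "real \<Rightarrow> real" where
  "upper_const r = 3 powr r * (1 + transform_const r + 4 powr r)"

text \<open>
  Summation by parts exhibits \<open>(w - 1) * spectral_sum w f\<close> as \<open>kappa w\<close> times the difference of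
  \<open>w ^ Suc n * f\<close> and the martingale transform \<open>g\<close> of \<open>f\<close> with multipliers \<open>w ^ j\<close>, plus a multiple of the
  value at the root whose coefficient is at most \<open>4 * \<bar>kappa w\<bar>\<close> in modulus.
\<close>

lemma spectral_sum_upper:
  fixes r :: real
  assumes f: "tree_martingale f" and r: "1 < r" and w: "norm w = 1" "w \<noteq> 1"
  shows "power_mean r n (spectral_sum w f)
    \<le> upper_const r * (norm (kappa w) / norm (w - 1)) powr r * power_mean r n f"
proof -
  define c where "c = norm (kappa w) / norm (w - 1)"
  define g where "g x = f x0 + (\<Sum>j<n. w ^ Suc j * (f (anc (Suc j) x) - f (anc j x)))" for x
  define S where "S = power_mean r n f"
  have w1: "0 < norm (w - 1)" using w by simp
  have k0: "0 < norm (kappa w)" using kappa_bounds(3)[OF w(1)] by simp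
  have c0: "0 < c" using w1 k0 by (simp add: c_def)
  let ?v = "spectral_sum w f" and ?K = "norm (kappa w)"
  have bound: "norm (?v x) \<le> c * (norm (f x) + norm (g x) + 4 * norm (f x0))"
    if x: "level x = n" for x
  proof -
    have parts: "(w - 1) * (\<Sum>j<n. w ^ Suc j * f (anc (Suc j) x)) = w ^ Suc n * f x - g x - (w - 1) * f x0"
      using summation_by_parts_geometric[of w "\<lambda>j. f (anc j x)" n] x by (simp add: g_def anc_ge anc_0)
    have "(w - 1) * ?v x = (w - 1) * f x0 + kappa w * ((w - 1) * (\<Sum>j<n. w ^ Suc j * f (anc (Suc j) x)))"
      unfolding spectral_sum_def x by (simp add: algebra_simps)
    also have "\<dots> = kappa w * (w ^ Suc n * f x - g x) + (w - 1) * (1 - kappa w) * f x0"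
      unfolding parts by (simp add: algebra_simps)
    finally have e: "(w - 1) * ?v x = kappa w * (w ^ Suc n * f x - g x) + (w - 1) * (1 - kappa w) * f x0" .
    have "norm (w - 1) * norm (1 - kappa w) \<le> 2 * (2 / (real q + 1))"
      using norm_triangle_ineq4[of w 1] w kappa_bounds(2)[OF w(1)] by (intro mult_mono) auto
    also have "\<dots> = 4 / (real q + 1)" by simp
    also have "\<dots> \<le> (4 * (real q - 1)) / (real q + 1)" using q_ge_2 by (intro divide_right_mono) auto
    also have "\<dots> = 4 * ((real q - 1) / (real q + 1))" by simp
    also have "\<dots> \<le> 4 * ?K" by (intro mult_left_mono kappa_bounds(1)[OF w(1)]) simp
    finally have k4: "norm (w - 1) * norm (1 - kappa w) \<le> 4 * ?K" .
    have "norm (w - 1) * norm (?v x) = norm (kappa w * (w ^ Suc n * f x - g x) + (w - 1) * (1 - kappa w) * f x0)"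
      by (metis e norm_mult)
    also have "\<dots> \<le> ?K * norm (w ^ Suc n * f x - g x) + (norm (w - 1) * norm (1 - kappa w)) * norm (f x0)"
      by (metis norm_triangle_ineq norm_mult)
    also have "\<dots> \<le> ?K * (norm (f x) + norm (g x)) + (4 * ?K) * norm (f x0)"
    proof (intro add_mono mult_left_mono mult_right_mono k4)
      show "norm (w ^ Suc n * f x - g x) \<le> norm (f x) + norm (g x)"
        using norm_triangle_ineq4[of "w ^ Suc n * f x" "g x"] w by (simp add: norm_mult norm_power del: power_Suc)
    qed auto
    finally show ?thesis using w1 by (simp add: c_def field_simps)
  qed
  have "power_mean r n (?v)
    \<le> sphere_avg n (\<lambda>x. c powr r * 3 powr r * (norm (f x) powr r + norm (g x) powr r + 4 powr r * norm (f x0) powr r))"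
  proof (rule sphere_avg_mono)
    fix x assume x: "level x = n"
    have "norm (?v x) powr r \<le> (c * (norm (f x) + norm (g x) + 4 * norm (f x0))) powr r"
      using bound[OF x] r by (intro powr_mono2) auto
    also have "\<dots> = c powr r * (norm (f x) + norm (g x) + 4 * norm (f x0)) powr r"
      using c0 by (simp add: powr_mult)
    also have "\<dots> \<le> c powr r * (3 powr r * (norm (f x) powr r + norm (g x) powr r + (4 * norm (f x0)) powr r))"
      using r by (intro mult_left_mono powr_sum3_le) auto
    finally show "norm (?v x) powr r \<le> c powr r * 3 powr r * (norm (f x) powr r + norm (g x) powr r + 4 powr r * norm (f x0) powr r)"
      by (simp add: powr_mult mult.assoc)
  qed
  also have "\<dots> = c powr r * 3 powr r * (S + power_mean r n g + 4 powr r * norm (f x0) powr r)"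
    by (simp only: sphere_avg_cmult sphere_avg_add sphere_avg_const S_def)
  also have "\<dots> \<le> c powr r * 3 powr r * (S + transform_const r * S + 4 powr r * S)"
  proof (intro mult_left_mono add_mono order_refl)
    show "power_mean r n g \<le> transform_const r * S"
      unfolding g_def S_def by (rule tree_transform_bound[OF f r, of "\<lambda>j. w ^ j"]) (simp add: norm_power w)
    show "norm (f x0) powr r \<le> S"
      using tree_martingale_power_mean_mono[OF f, of r 0 n] r by (simp add: S_def sphere_avg_def[of 0] shell_0)
  qed auto
  also have "\<dots> = upper_const r * c powr r * S"
    by (simp add: upper_const_def algebra_simps)
  finally show ?thesis by (simp add: c_def S_def)
qed

lemma spectral_sum_anc:
  assumes "n \<le> level x"
  shows "spectral_sum w f (anc n x) = f x0 + kappa w * (\<Sum>j<n. w ^ Suc j * f (anc (Suc j) x))"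
  using assms by (simp add: spectral_sum_def level_anc anc_anc)

text \<open>
  With \<open>\<bar>w ^ k - 1\<bar> \<ge> 1\<close> the weights \<open>w ^ j\<close>, \<open>n < j \<le> n + k\<close>, have a sum of modulus at least
  \<open>1 / \<bar>w - 1\<bar>\<close>. The difference of the sums at levels \<open>n + k\<close> and \<open>n\<close> is the weighted sum of the values in between,
  whose moments bound those of \<open>f\<close> at level \<open>n + 1\<close>. The constant is therefore the same for all \<open>w\<close>,
  however large \<open>k\<close> has to be.
\<close>

lemma spectral_sum_lower:
  fixes r M :: real
  assumes f: "tree_martingale f" and r: "1 < r" and w: "norm w = 1" "w \<noteq> 1"
    and M: "\<And>n. power_mean r n (spectral_sum w f) \<le> M"
  shows "(norm (kappa w) / norm (w - 1)) powr r * power_mean r n f \<le> 4 powr r * M"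
proof -
  let ?v = "spectral_sum w f"
  obtain k where k: "1 \<le> norm (w ^ k - 1)" using unit_power_far_from_1[OF w] by blast
  then have "k \<noteq> 0" by (intro notI) simp
  define m where "m = n + k"
  have w1: "0 < norm (w - 1)" using w by simp
  let ?s = "norm (\<Sum>j\<in>{n<..m}. w ^ j)" and ?a = "\<lambda>x j. w ^ Suc j * f (anc (Suc j) x)"
  have geo: "1 / norm (w - 1) \<le> ?s"
  proof -
    have "(\<Sum>j\<in>{n<..m}. w ^ j) = (\<Sum>j<k. w ^ (j + Suc n))"
      by (rule sum.reindex_bij_witness[of _ "\<lambda>j. j + Suc n" "\<lambda>j. j - Suc n"]) (auto simp: m_def)
    also have "\<dots> = w ^ Suc n * (\<Sum>j<k. w ^ j)" by (simp add: power_add sum_distrib_left mult_ac)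
    also have "(\<Sum>j<k. w ^ j) = (w ^ k - 1) / (w - 1)" using w by (simp add: geometric_sum)
    finally have "?s = norm (w ^ k - 1) / norm (w - 1)"
      using w by (simp add: norm_mult norm_divide norm_power del: power_Suc)
    then show ?thesis using k w1 by (simp add: divide_right_mono)
  qed
  have diff: "?v x - ?v (anc n x) = kappa w * (\<Sum>j\<in>{n<..m}. w ^ j * f (anc j x))" if x: "level x = m" for x
  proof -
    have "(\<Sum>j<m. ?a x j) - (\<Sum>j<n. ?a x j)
      = (\<Sum>j\<in>{n..<m}. ?a x j)"
      using sum_diff_nat_ivl[of 0 n m "\<lambda>j. ?a x j"] by (simp add: m_def lessThan_atLeast0)
    also have "\<dots> = (\<Sum>j\<in>{n<..m}. w ^ j * f (anc j x))"
      by (rule sum.reindex_bij_witness[of _ "\<lambda>j. j - 1" Suc]) auto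
    finally have sums: "(\<Sum>j<m. ?a x j) - (\<Sum>j<n. ?a x j)
      = (\<Sum>j\<in>{n<..m}. w ^ j * f (anc j x))" .
    have "?v x = f x0 + kappa w * (\<Sum>j<m. ?a x j)"
      by (simp only: spectral_sum_def x)
    moreover have "?v (anc n x) = f x0 + kappa w * (\<Sum>j<n. ?a x j)"
      using x by (intro spectral_sum_anc) (simp add: m_def)
    ultimately show ?thesis by (simp only: sums[symmetric] right_diff_distrib add_diff_cancel_left)
  qed
  let ?S = "\<lambda>n. power_mean r n f"
  have "(norm (kappa w) / norm (w - 1)) powr r * ?S n \<le> (norm (kappa w) * ?s) powr r * ?S (Suc n)"
  proof (intro mult_mono powr_mono2)
    show "norm (kappa w) / norm (w - 1) \<le> norm (kappa w) * ?s"
      using mult_left_mono[OF geo, of "norm (kappa w)"] by simp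
    show "?S n \<le> ?S (Suc n)" using r by (intro tree_martingale_power_mean_mono[OF f]) auto
  qed (use r in \<open>auto intro: sphere_avg_nonneg\<close>)
  also have "\<dots> = norm (kappa w) powr r * (?s powr r * ?S (Suc n))"
    by (simp add: powr_mult)
  also have "\<dots> \<le> norm (kappa w) powr r * sphere_avg m (\<lambda>x. norm (\<Sum>j\<in>{n<..m}. w ^ j * f (anc j x)) powr r)"
    using r \<open>k \<noteq> 0\<close> by (intro mult_left_mono weighted_sum_lower_bound[OF f]) (auto simp: m_def)
  also have "\<dots> = sphere_avg m (\<lambda>x. norm (?v x - ?v (anc n x)) powr r)"
    unfolding sphere_avg_cmult[symmetric] by (intro sphere_avg_cong) (simp add: diff norm_mult powr_mult)
  also have "\<dots> \<le> sphere_avg m (\<lambda>x. 2 powr r * (norm (?v x) powr r + norm (?v (anc n x)) powr r))"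
    using r by (intro sphere_avg_mono norm_diff_powr_le) auto
  also have "\<dots> = 2 powr r * (power_mean r m ?v + power_mean r n ?v)"
    using sphere_avg_anc[of n m "\<lambda>v. norm (?v v) powr r"]
    by (simp add: sphere_avg_cmult sphere_avg_add m_def)
  also have "\<dots> \<le> 2 powr r * (M + M)" using M by (intro mult_left_mono add_mono) auto
  also have "\<dots> \<le> 2 powr r * (2 powr r * M)"
  proof (intro mult_left_mono)
    have "0 \<le> M" using M[of 0] sphere_avg_nonneg[of "\<lambda>x. norm (?v x) powr r" 0] by force
    moreover have "2 powr 1 \<le> 2 powr r" using r by (intro powr_mono) auto
    ultimately show "M + M \<le> 2 powr r * M" using mult_right_mono[of 2 "2 powr r" M] by simp
  qed auto
  also have "\<dots> = 4 powr r * M"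
    using powr_mult[of 2 2 r] by simp
  finally show ?thesis .
qed

text \<open>
  The increments of \<open>v\<close> from a vertex to its children are the multiples of \<open>f\<close> prescribed by \<open>inc\<close>.
  Clearing the powers of \<open>Q\<close>, the eigenvalue equation at \<open>x\<close> says that the sum of these increments is
  \<open>q * w\<close> times the increment from the parent to \<open>x\<close>, which is the martingale property at \<open>x\<close>. At the
  root the missing parent and the extra child are balanced by \<open>kappa_mult\<close>.
\<close>

lemma eigenfunction_iff_martingale:
  assumes w: "norm w = 1" and Q: "Q \<noteq> 0" "Q\<^sup>2 = of_nat q * w"
    and v0: "v x0 = f x0"
    and inc: "\<And>x y. y \<in> children x \<Longrightarrow> v y = v x + kappa w * w ^ Suc (level x) * f y"
  shows "(\<forall>x. (\<Sum>y | adj x y. v y / Q ^ level y) = (Q + of_nat q / Q) * (v x / Q ^ level x))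
    \<longleftrightarrow> tree_martingale f"
  unfolding tree_martingale_def
proof (intro iff_allI)
  fix x
  let ?L = "\<Sum>y | adj x y. v y / Q ^ level y" and ?R = "(Q + of_nat q / Q) * (v x / Q ^ level x)"
  define n where "n = level x"
  define S where "S = (\<Sum>y\<in>children x. f y)"
  have w0: "w \<noteq> 0" using w by auto
  have k0: "kappa w \<noteq> 0" using kappa_bounds(3)[OF w] .
  note kw = kappa_mult[OF w0]
  have child_sum: "(\<Sum>y\<in>children x. v y / Q ^ level y)
     = (of_nat (branching n) * v x + kappa w * w ^ Suc n * S) / Q ^ Suc n"
  proof -
    have "(\<Sum>y\<in>children x. v y / Q ^ level y) = (\<Sum>y\<in>children x. (v x + kappa w * w ^ Suc n * f y) / Q ^ Suc n)"
      by (intro sum.cong refl) (simp add: inc level_child n_def)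
    then show ?thesis
      by (simp add: sum.distrib sum_distrib_left S_def card_children n_def flip: sum_divide_distrib)
  qed
  have rhs: "(Q + of_nat q / Q) * (v x / Q ^ n) = (of_nat q * w + of_nat q) * v x / Q ^ Suc n"
  proof -
    have "(Q + of_nat q / Q) * (v x / Q ^ n) = (Q\<^sup>2 + of_nat q) * v x / Q ^ Suc n"
      using Q(1) by (simp add: field_simps power2_eq_square)
    then show ?thesis by (simp add: Q(2))
  qed
  show "?L = ?R
    \<longleftrightarrow> (\<Sum>y\<in>children x. f y) = of_nat (branching (level x)) * f x"
  proof (cases "x = x0")
    case True
    then have n: "n = 0" by (simp add: n_def)
    have "?L = ((of_nat q + 1) * v x + kappa w * w * S) / Q"
      unfolding neighbours_eq using True child_sum n by (simp add: branching_def)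
    moreover have "?R = (of_nat q * w + of_nat q) * v x / Q"
      using rhs n by (simp add: n_def)
    ultimately have "?L = ?R
      \<longleftrightarrow> (of_nat q + 1) * v x + kappa w * w * S = (of_nat q * w + of_nat q) * v x"
      using Q(1) by simp
    also have "\<dots> \<longleftrightarrow> kappa w * w * S = (of_nat q * w - 1) * v x"
      by (auto simp: algebra_simps)
    also have "\<dots> \<longleftrightarrow> (kappa w * w) * S = (kappa w * w) * ((of_nat q + 1) * f x)"
      unfolding kw[symmetric] using True v0 by (simp add: mult_ac)
    also have "\<dots> \<longleftrightarrow> S = (of_nat q + 1) * f x" using k0 w0 by simp
    finally show ?thesis using n by (simp add: S_def n_def branching_def add.commute)
  next
    case False
    then obtain k where k: "n = Suc k" using gdist_eq_0_iff[of x0 x] by (cases n) (auto simp: n_def)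
    have c: "x \<in> children (par x)" using False by (simp add: children_iff)
    have lp: "level (par x) = k" using level_par[OF False] k by (simp add: n_def)
    have vp: "v x = v (par x) + kappa w * w ^ n * f x" using inc[OF c] lp k by simp
    have "par x \<notin> children x" using level_child[of "par x" x] lp k by (auto simp: n_def)
    then have "?L = (of_nat q * v x + kappa w * w ^ Suc n * S) / Q ^ Suc n + v (par x) / Q ^ k"
      unfolding neighbours_eq using False child_sum lp k by (simp add: branching_def add.commute)
    also have "v (par x) / Q ^ k = of_nat q * w * v (par x) / Q ^ Suc n"
      unfolding Q(2)[symmetric] k using Q(1) by (simp add: field_simps power2_eq_square)
    finally have "?L
      = (of_nat q * v x + kappa w * w ^ Suc n * S + of_nat q * w * v (par x)) / Q ^ Suc n"
      by (simp add: add_divide_distrib)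
    then have "?L = ?R
      \<longleftrightarrow> of_nat q * v x + kappa w * w ^ Suc n * S + of_nat q * w * v (par x) = (of_nat q * w + of_nat q) * v x"
      using rhs Q(1) by (simp add: n_def)
    also have "\<dots> \<longleftrightarrow> kappa w * w ^ Suc n * S = of_nat q * w * (v x - v (par x))"
      by (auto simp: algebra_simps)
    also have "\<dots> \<longleftrightarrow> (kappa w * w ^ Suc n) * S = (kappa w * w ^ Suc n) * (of_nat q * f x)"
      using vp by (simp add: mult_ac)
    also have "\<dots> \<longleftrightarrow> S = of_nat q * f x" using k0 w0 by simp
    finally show ?thesis using k by (simp add: S_def n_def branching_def)
  qed
qed

lemma spectral_sum_child:
  assumes "y \<in> children x"
  shows "spectral_sum w f y = spectral_sum w f x + kappa w * w ^ Suc (level x) * f y"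
proof -
  have l: "level y = Suc (level x)" using level_child[OF assms] .
  have "par y = x" using assms by (simp add: children_iff)
  then have "anc (level x) y = x" using anc_par[of "level x" y] l by (simp add: anc_ge)
  then have "spectral_sum w f x = f x0 + kappa w * (\<Sum>j<level x. w ^ Suc j * f (anc (Suc j) y))"
    using spectral_sum_anc[of "level x" y w f] l by simp
  moreover have "spectral_sum w f y = f x0 + kappa w * (\<Sum>j<level x. w ^ Suc j * f (anc (Suc j) y))
      + kappa w * w ^ Suc (level x) * f y"
    by (simp add: spectral_sum_def l anc_ge distrib_left mult.assoc)
  ultimately show ?thesis by simp
qed

lemma spectral_sum_x0: "spectral_sum w f x0 = f x0"
  by (simp add: spectral_sum_def)

text \<open>
  The increments of \<open>v\<close> along the edges can be prescribed arbitrarily, because \<open>kappa w\<close> and \<open>w\<close> are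
  nonzero.
\<close>

lemma ex_spectral_sum:
  assumes w: "norm w = 1"
  shows "\<exists>f. spectral_sum w f = v"
proof -
  define f where "f x = (if x = x0 then v x else (v x - v (par x)) / (kappa w * w ^ level x))" for x
  have nz: "kappa w \<noteq> 0" "w \<noteq> 0" using kappa_bounds(3)[OF w] w by auto
  have "spectral_sum w f x = v x" if "level x = n" for n x
    using that
  proof (induction n arbitrary: x)
    case 0
    then have "x = x0" using gdist_eq_0_iff[of x0 x] by simp
    then show ?case by (simp add: spectral_sum_x0 f_def)
  next
    case (Suc n)
    then have "x \<noteq> x0" by auto
    then have c: "x \<in> children (par x)" and l: "level (par x) = n"
      using Suc.prems level_par by (auto simp: children_iff)
    have "kappa w * w ^ Suc n * f x = v x - v (par x)"
      using nz \<open>x \<noteq> x0\<close> Suc.prems by (simp add: f_def)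
    then show ?case using spectral_sum_child[OF c] Suc.IH[OF l] l by simp
  qed
  then show ?thesis by blast
qed

end

section \<open>Poisson transform, Laplacian and Hardy norm\<close>

context rooted_tree
begin

text \<open>
  The number \<open>Q\<close> whose powers normalize the Poisson transform; its square is \<open>q * w\<close>.
\<close>

definition spectral_root :: "real \<Rightarrow> complex" where
  "spectral_root z = of_nat q powr (1/2 + \<i> * of_real z)"

text \<open>
  The number \<open>w = q powr (2 i z)\<close>, in a form that makes its modulus evident.
\<close>

definition phase :: "real \<Rightarrow> complex" where
  "phase z = cis (2 * (z * ln (real q)))"

lemma q_powr_eq:
  "(of_nat q :: complex) powr (of_real a + \<i> * of_real t) = of_real (real q powr a) * cis (t * ln (real q))"
proof -
  have q: "0 < real q" using q_ge_2 by simp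
  have "(of_nat q :: complex) powr (of_real a + \<i> * of_real t)
     = exp ((of_real a + \<i> * of_real t) * of_real (ln (real q)))"
    using q Ln_of_real[OF q] by (simp add: powr_def)
  also have "\<dots> = exp (of_real (a * ln (real q))) * exp (\<i> * of_real (t * ln (real q)))"
    by (simp add: exp_add[symmetric] algebra_simps)
  also have "exp (of_real (a * ln (real q)) :: complex) = of_real (real q powr a)"
    using q by (simp add: powr_def del: of_real_mult flip: exp_of_real)
  finally show ?thesis by (simp add: cis_conv_exp)
qed

lemma spectral_root_eq: "spectral_root z = of_real (real q powr (1/2)) * cis (z * ln (real q))"
  unfolding spectral_root_def using q_powr_eq[of "1/2" z] by simp

lemma norm_spectral_root: "norm (spectral_root z) = real q powr (1/2)"
  by (simp add: spectral_root_eq norm_mult)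

lemma spectral_root_nonzero: "spectral_root z \<noteq> 0"
  using norm_spectral_root[of z] q_ge_2 by auto

lemma spectral_root_square: "(spectral_root z)\<^sup>2 = of_nat q * phase z"
proof -
  have "(real q powr (1/2))\<^sup>2 = real q" using q_ge_2 by (simp add: powr_half_sqrt)
  then have "(of_real (real q powr (1/2)) :: complex)\<^sup>2 = of_nat q"
    by (metis of_real_of_nat_eq of_real_power)
  then show ?thesis
    by (simp add: spectral_root_eq power_mult_distrib Complex.DeMoivre phase_def)
qed

lemma norm_phase: "norm (phase z) = 1"
  by (simp add: phase_def)

lemma phase_eq_1_iff: "phase z = 1 \<longleftrightarrow> z \<in> range (\<lambda>k::int. tau q / 2 * of_int k)"
proof -
  have l: "0 < ln (real q)" using q_ge_2 by simp
  have "phase z = 1 \<longleftrightarrow> (\<exists>k::int. 2 * (z * ln (real q)) = of_int (2 * k) * pi)"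
    unfolding phase_def cis_conv_exp exp_eq_1 by simp
  also have "\<dots> \<longleftrightarrow> (\<exists>k::int. z = tau q / 2 * of_int k)"
    using l by (intro ex_cong1) (auto simp: tau_def field_simps)
  finally show ?thesis by auto
qed

text \<open>
  Writing \<open>h = q powr (i z)\<close>, numerator and denominator of the \<open>c\<close>-function are multiplied by \<open>h\<close> to
  obtain \<open>w * kappa w / (w - 1)\<close> for \<open>w = h * h\<close>.
\<close>

lemma norm_c_function:
  assumes "phase z \<noteq> 1"
  shows "norm (c_function q (of_real z)) = norm (kappa (phase z)) / norm (phase z - 1)"
proof -
  define a where "a = (of_real (real q powr (1/2)) :: complex)"
  define h where "h = cis (z * ln (real q))"
  have w: "phase z = h * h" by (simp add: phase_def h_def cis_mult)
  have q0: "0 < real q" using q_ge_2 by simp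
  have h0: "h \<noteq> 0" by (simp add: h_def)
  have a0: "a \<noteq> 0" using q0 by (simp add: a_def)
  have aa: "a * a = of_nat q"
    using q0 by (simp add: a_def powr_half_sqrt flip: of_real_mult)
  have ih: "cis (- (z * ln (real q))) = inverse h" by (simp add: h_def)
  have ia: "(of_real (real q powr (- (1/2))) :: complex) = inverse a"
    unfolding a_def powr_minus by simp
  have e: "(of_nat q :: complex) powr (1/2) = a"
    "(of_nat q :: complex) powr (1/2 + \<i> * of_real z) = a * h"
    "(of_nat q :: complex) powr (- (1/2) - \<i> * of_real z) = inverse a * inverse h"
    "(of_nat q :: complex) powr (\<i> * of_real z) = h"
    "(of_nat q :: complex) powr (- (\<i> * of_real z)) = inverse h"
    using q_powr_eq[of "1/2" 0] q_powr_eq[of "1/2" z] q_powr_eq[of "- (1/2)" "- z"]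
      q_powr_eq[of 0 z] q_powr_eq[of 0 "- z"] q0
    by (simp_all add: a_def[symmetric] h_def[symmetric] ih ia)
  have n1: "(of_nat q + 1 :: complex) \<noteq> 0" by (metis of_nat_Suc of_nat_neq_0 add.commute)
  have w1: "h * h - 1 \<noteq> 0" using assms w by simp
  have num: "a * (a * h - inverse a * inverse h) = of_nat q * h - inverse h"
    using a0 aa by (simp add: right_diff_distrib mult.assoc[symmetric])
  have "c_function q (of_real z) = (of_nat q * h - inverse h) / ((of_nat q + 1) * (h - inverse h))"
    unfolding c_function_def e using num by simp
  also have "\<dots> = (h * (of_nat q * h - inverse h)) / (h * ((of_nat q + 1) * (h - inverse h)))"
    using h0 by simp
  also have "h * (of_nat q * h - inverse h) = h * h * (of_nat q - inverse (h * h))"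
    using h0 by (simp add: algebra_simps)
  also have "h * ((of_nat q + 1) * (h - inverse h)) = (of_nat q + 1) * (h * h - 1)"
    using h0 by (simp add: algebra_simps)
  finally have "c_function q (of_real z) = h * h * kappa (h * h) / (h * h - 1)"
    by (simp add: kappa_def)
  then show ?thesis by (simp add: w norm_mult norm_divide h_def)
qed

text \<open>
  The two exponentials in \<open>\<gamma>(z)\<close> are \<open>Q\<close> and \<open>q / Q\<close>.
\<close>

lemma laplacian_eigen_iff:
  "laplacian q adj u = (\<lambda>x. laplace_gamma q (of_real z) * u x)
   \<longleftrightarrow> (\<forall>x. (\<Sum>y | adj x y. u y) = (spectral_root z + of_nat q / spectral_root z) * u x)"
proof -
  let ?Q = "spectral_root z"
  have q0: "0 < real q" using q_ge_2 by simp
  have n1: "(of_nat q + 1 :: complex) \<noteq> 0" by (metis of_nat_Suc of_nat_neq_0 add.commute)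
  have "?Q * (of_nat q powr (1/2 - \<i> * of_real z)) = of_nat q"
  proof -
    have "(of_nat q :: complex) powr (1/2 - \<i> * of_real z) = of_real (real q powr (1/2)) * cis (- (z * ln (real q)))"
      using q_powr_eq[of "1/2" "- z"] by simp
    then have "?Q * (of_nat q powr (1/2 - \<i> * of_real z))
      = of_real (real q powr (1/2) * real q powr (1/2)) * (cis (z * ln (real q)) * cis (- (z * ln (real q))))"
      by (simp add: spectral_root_eq)
    then show ?thesis using q0 by (simp add: cis_mult flip: powr_add)
  qed
  then have Q': "of_nat q powr (1/2 - \<i> * of_real z) = of_nat q / ?Q"
    using spectral_root_nonzero by (simp add: field_simps)
  have "laplacian q adj u x = laplace_gamma q (of_real z) * u x
    \<longleftrightarrow> (\<Sum>y | adj x y. u y) = (?Q + of_nat q / ?Q) * u x" for x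
  proof -
    have s: "{y. gdist adj x y = 1} = {y. adj x y}" using gdist_eq_1_iff by blast
    have "laplacian q adj u x = laplace_gamma q (of_real z) * u x
      \<longleftrightarrow> (\<Sum>y | adj x y. u y) / (of_nat q + 1) = (?Q + of_nat q / ?Q) * u x / (of_nat q + 1)"
      unfolding laplacian_def laplace_gamma_def s Q' spectral_root_def[symmetric]
      by (auto simp: algebra_simps)
    then show ?thesis using n1 by simp
  qed
  then show ?thesis by (simp add: fun_eq_iff)
qed

text \<open>
  The weight \<open>q powr (n/2)\<close> of the Hardy norm cancels the decay of \<open>u\<close>.
\<close>

lemma hardy_norm_eq:
  assumes haar: "normalized_haar adj x0 \<mu>" and \<omega>0: "\<omega>0 \<in> rays adj x0" and r: "0 < r"
    and u: "\<And>x. norm (u x) = norm (v x) / real q powr (real (level x) / 2)"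
  shows "hardy_norm q \<mu> \<omega>0 r u = (SUP n. ennreal (power_mean r n v powr (1 / r)))"
proof -
  let ?J = "\<lambda>n. \<integral>k. norm (u (k (\<omega>0 n))) powr r \<partial>\<mu>"
  have "real q powr (real n / 2) * ?J n powr (1 / r)
     = power_mean r n v powr (1 / r)" for n
  proof -
    define b where "b = real q powr (real n / 2)"
    have b: "0 < b" using q_ge_2 by (simp add: b_def)
    have "?J n = power_mean r n u"
      using haar_average[OF haar ray_level[OF \<omega>0], of "\<lambda>x. norm (u x) powr r" n]
      by (simp add: sphere_avg_def)
    also have "\<dots> = sphere_avg n (\<lambda>x. inverse (b powr r) * norm (v x) powr r)"
    proof (rule sphere_avg_cong)
      fix x assume "level x = n"
      then have "norm (u x) = norm (v x) / b" using u[of x] by (simp add: b_def)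
      then have "norm (u x) powr r = norm (v x) powr r / b powr r" using b by (simp add: powr_divide)
      then show "norm (u x) powr r = inverse (b powr r) * norm (v x) powr r"
        by (simp add: divide_inverse mult.commute)
    qed
    also have "\<dots> = inverse (b powr r) * power_mean r n v"
      by (rule sphere_avg_cmult)
    also have "inverse (b powr r) = inverse b powr r" using b by (simp add: inverse_powr)
    finally have "?J n powr (1 / r)
      = inverse b * power_mean r n v powr (1 / r)"
      using b r by (simp add: powr_mult powr_powr)
    then show ?thesis using b by (simp add: b_def)
  qed
  then show ?thesis unfolding hardy_norm_def by simp
qed

end

context tree_boundary
begin

lemma poisson_kernel_powr:
  assumes "\<omega> \<in> rays adj x0"
  shows "complex_of_real (poisson_kernel q adj x0 x \<omega>) powr (1/2 + \<i> * of_real z)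
    = spectral_root z ^ (2 * level (confluent adj x0 x \<omega>)) / spectral_root z ^ level x"
proof -
  define m where "m = 2 * int (level (confluent adj x0 x \<omega>)) - int (level x)"
  have q: "0 < real q" using q_ge_2 by simp
  have pos: "0 < real q powi m" using q by simp
  have "complex_of_real (real q powi m) powr (1/2 + \<i> * of_real z)
     = exp ((1/2 + \<i> * of_real z) * of_real (ln (real q powi m)))"
    using q Ln_of_real[OF pos] by (simp add: powr_def)
  also have "ln (real q powi m) = of_int m * ln (real q)"
    using q by (simp add: ln_powr flip: powr_real_of_int')
  also have "(1/2 + \<i> * of_real z) * of_real (of_int m * ln (real q))
     = of_int m * ((1/2 + \<i> * of_real z) * of_real (ln (real q)))" by simp
  also have "exp \<dots> = exp ((1/2 + \<i> * of_real z) * of_real (ln (real q))) powi m"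
    by (rule exp_power_int[symmetric])
  also have "exp ((1/2 + \<i> * of_real z) * of_real (ln (real q))) = spectral_root z"
    using q Ln_of_real[OF q] by (simp add: spectral_root_def powr_def)
  also have "spectral_root z powi m
    = spectral_root z powi int (2 * level (confluent adj x0 x \<omega>)) / spectral_root z powi int (level x)"
    using spectral_root_nonzero[of z] by (simp add: m_def power_int_diff)
  also have "\<dots> = spectral_root z ^ (2 * level (confluent adj x0 x \<omega>)) / spectral_root z ^ level x"
    by (simp only: power_int_of_nat)
  finally show ?thesis by (simp add: poisson_kernel_def m_def)
qed

text \<open>
  The kernel at \<open>x\<close> is \<open>Q ^ (2 * m) / Q ^ n\<close>, where \<open>m\<close> is the level of the confluent. Telescoping, \<open>Q ^ (2 * m)\<close> is
  \<open>1\<close> plus the sum of the steps \<open>Q ^ (2 * Suc j) - Q ^ (2 * j)\<close> over those \<open>j\<close> for which the ray passes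
  through the ancestor of \<open>x\<close> at level \<open>Suc j\<close>. Integration turns these conditions into averages of \<open>F\<close>,
  and \<open>kappa_mult\<close> collects the constants.
\<close>

lemma poisson_transform_eq:
  assumes F: "integrable \<nu> F"
  shows "poisson_transform q adj x0 \<nu> (of_real z) F x
    = spectral_sum (phase z) (ray_avg F) x / spectral_root z ^ level x"
proof -
  define Q where "Q = spectral_root z"
  define w where "w = phase z"
  define n where "n = level x"
  define f where "f = ray_avg F"
  define c where "c j = Q ^ (2 * Suc j) - Q ^ (2 * j)" for j
  have Q0: "Q \<noteq> 0" and QQ: "Q\<^sup>2 = of_nat q * w"
    using spectral_root_nonzero spectral_root_square by (auto simp: Q_def w_def)
  have w0: "w \<noteq> 0" using norm_phase[of z] by (auto simp: w_def)
  let ?I = "\<lambda>j \<omega>. indicat_real (E (anc (Suc j) x)) \<omega>"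
  have kernel: "Q ^ (2 * level (confluent adj x0 x \<omega>)) = 1 + (\<Sum>j<n. ?I j \<omega> *\<^sub>R c j)"
    if w: "\<omega> \<in> rays adj x0" for \<omega>
  proof -
    define m where "m = level (confluent adj x0 x \<omega>)"
    have mn: "m \<le> n" using level_confluent(1)[OF w, of x] by (simp add: m_def n_def)
    have ind: "?I j \<omega> = (if j < m then 1 else 0)" if "j < n" for j
      using level_confluent(2)[OF w, of "Suc j" x] that w
      by (simp add: m_def n_def mem_E indicator_def level_anc Suc_le_eq)
    have "(\<Sum>j<n. ?I j \<omega> *\<^sub>R c j) = (\<Sum>j<n. if j < m then c j else 0)"
      by (intro sum.cong) (auto simp: ind)
    also have "\<dots> = (\<Sum>j<m. c j)"
      using mn by (intro sum.mono_neutral_cong_right) auto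
    also have "\<dots> = Q ^ (2 * m) - 1"
      unfolding c_def using sum_lessThan_telescope[of "\<lambda>j. Q ^ (2 * j)" m] by simp
    finally show ?thesis by (simp add: m_def)
  qed
  define G where "G j \<omega> = ?I j \<omega> *\<^sub>R F \<omega>" for j \<omega>
  have Gi: "integrable \<nu> (G j)" for j
    unfolding G_def using F by (intro integrable_mult_indicator) auto
  have "poisson_transform q adj x0 \<nu> (of_real z) F x
    = (\<integral>\<omega>. (F \<omega> + (\<Sum>j<n. c j * G j \<omega>)) / Q ^ n \<partial>\<nu>)"
    unfolding poisson_transform_def
  proof (intro Bochner_Integration.integral_cong refl)
    fix \<omega> assume "\<omega> \<in> space \<nu>"
    then have w: "\<omega> \<in> rays adj x0" by (simp add: space_boundary)
    have "complex_of_real (poisson_kernel q adj x0 x \<omega>) powr (1/2 + \<i> * of_real z) * F \<omega>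
      = (1 + (\<Sum>j<n. ?I j \<omega> *\<^sub>R c j)) * F \<omega> / Q ^ n"
      unfolding poisson_kernel_powr[OF w] Q_def[symmetric] kernel[OF w] by (simp add: n_def)
    also have "(1 + (\<Sum>j<n. ?I j \<omega> *\<^sub>R c j)) * F \<omega>
      = F \<omega> + (\<Sum>j<n. c j * G j \<omega>)"
      by (simp add: G_def distrib_right sum_distrib_right)
    finally show "complex_of_real (poisson_kernel q adj x0 x \<omega>) powr (1/2 + \<i> * of_real z) * F \<omega>
      = (F \<omega> + (\<Sum>j<n. c j * G j \<omega>)) / Q ^ n" .
  qed
  also have "\<dots> = ((\<integral>\<omega>. F \<omega> \<partial>\<nu>) + (\<Sum>j<n. c j * (LINT \<omega>:E (anc (Suc j) x)|\<nu>. F \<omega>))) / Q ^ n"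
    using F Gi by (simp add: set_lebesgue_integral_def flip: G_def)
  also have "(\<integral>\<omega>. F \<omega> \<partial>\<nu>) = f x0"
    using integral_sum_E[OF F, of 0] by (simp add: f_def ray_avg_def shell_0)
  also have "(\<Sum>j<n. c j * (LINT \<omega>:E (anc (Suc j) x)|\<nu>. F \<omega>)) = kappa w * (\<Sum>j<n. w ^ Suc j * f (anc (Suc j) x))"
    unfolding sum_distrib_left
  proof (intro sum.cong refl)
    fix j assume "j \<in> {..<n}"
    then have l: "level (anc (Suc j) x) = Suc j" by (simp add: level_anc n_def)
    define I where "I = (LINT \<omega>:E (anc (Suc j) x)|\<nu>. F \<omega>)"
    have f: "f (anc (Suc j) x) = (of_nat q + 1) * of_nat q ^ j * I"
      unfolding f_def ray_avg_def l I_def by (simp add: card_shell algebra_simps)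
    have pow: "Q ^ (2 * k) = of_nat q ^ k * w ^ k" for k
      by (simp add: power_mult QQ power_mult_distrib)
    have "c j = (of_nat q * w - 1) * (of_nat q ^ j * w ^ j)"
      unfolding c_def pow by (simp add: algebra_simps)
    \<comment> \<open>The factor \<open>q + 1\<close> is the one that turns the integral into an average over \<open>(q + 1) * q ^ j\<close> vertices.\<close>
    also have "of_nat q * w - 1 = kappa w * w * (of_nat q + 1)"
      by (rule kappa_mult[OF w0, symmetric])
    finally show "c j * (LINT \<omega>:E (anc (Suc j) x)|\<nu>. F \<omega>) = kappa w * (w ^ Suc j * f (anc (Suc j) x))"
      unfolding f I_def[symmetric] by (simp add: mult_ac)
  qed
  finally show ?thesis by (simp add: spectral_sum_def Q_def w_def n_def f_def)
qed

end

section \<open>The characterization of Poisson transforms\<close>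

context rooted_tree
begin

text \<open>
  The function built from \<open>f\<close> as the Poisson transform is built from the averages of a boundary
  function. Every function on the tree has this form for exactly one \<open>f\<close>.
\<close>

definition eigenmode :: "real \<Rightarrow> ('v \<Rightarrow> complex) \<Rightarrow> 'v \<Rightarrow> complex" where
  "eigenmode z f x = spectral_sum (phase z) f x / spectral_root z ^ level x"

lemma eigenmode_eigenfunction_iff:
  "laplacian q adj (eigenmode z f) = (\<lambda>x. laplace_gamma q (of_real z) * eigenmode z f x) \<longleftrightarrow> tree_martingale f"
  unfolding laplacian_eigen_iff unfolding eigenmode_def
  by (rule eigenfunction_iff_martingale[OF norm_phase spectral_root_nonzero spectral_root_square])
    (simp_all add: spectral_sum_x0 spectral_sum_child)

lemma c_function_pos:
  assumes "phase z \<noteq> 1"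
  shows "0 < norm (c_function q (of_real z))"
  unfolding norm_c_function[OF assms] using kappa_bounds(3)[OF norm_phase[of z]] assms by simp

lemma ex_eigenmode: "\<exists>f. eigenmode z f = u"
proof -
  obtain f where f: "spectral_sum (phase z) f = (\<lambda>x. u x * spectral_root z ^ level x)"
    using ex_spectral_sum[OF norm_phase] by blast
  have "eigenmode z f = u" by (rule ext) (simp add: eigenmode_def f spectral_root_nonzero)
  then show ?thesis by blast
qed

context
  fixes \<mu> :: "('v \<Rightarrow> 'v) measure" and \<omega>0 :: "nat \<Rightarrow> 'v" and r :: real
  assumes haar: "normalized_haar adj x0 \<mu>" and \<omega>0: "\<omega>0 \<in> rays adj x0" and r: "1 < r"
begin

lemma hardy_norm_eigenmode:
  "hardy_norm q \<mu> \<omega>0 r (eigenmode z f)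
    = (SUP n. ennreal (power_mean r n (spectral_sum (phase z) f) powr (1 / r)))"
proof (rule hardy_norm_eq[OF haar \<omega>0])
  show "0 < r" using r by simp
  have "(real q powr (1/2)) ^ n = real q powr (real n / 2)" for n
    using q_ge_2 by (simp add: powr_powr flip: powr_realpow)
  then show "norm (eigenmode z f x) = norm (spectral_sum (phase z) f x) / real q powr (real (level x) / 2)" for x
    by (simp add: eigenmode_def norm_divide norm_power norm_spectral_root)
qed

lemma hardy_norm_eigenmode_upper:
  assumes z: "phase z \<noteq> 1" and f: "tree_martingale f"
    and I: "\<And>n. power_mean r n f \<le> I"
  shows "hardy_norm q \<mu> \<omega>0 r (eigenmode z f)
    \<le> ennreal (upper_const r powr (1 / r) * norm (c_function q (of_real z)) * I powr (1 / r))"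
  unfolding hardy_norm_eigenmode norm_c_function[OF z]
proof (intro SUP_least ennreal_leI)
  fix n
  let ?M = "power_mean r n (spectral_sum (phase z) f)"
  define c where "c = norm (kappa (phase z)) / norm (phase z - 1)"
  have U: "0 \<le> upper_const r"
    by (auto simp: upper_const_def transform_const_def transform_const_ge2_def)
  have "?M
    \<le> upper_const r * c powr r * power_mean r n f"
    unfolding c_def by (rule spectral_sum_upper[OF f r norm_phase z])
  also have "\<dots> \<le> upper_const r * c powr r * I" using I U by (intro mult_left_mono) auto
  finally have "?M powr (1 / r)
    \<le> (upper_const r * c powr r * I) powr (1 / r)"
    using r by (intro powr_mono2 sphere_avg_nonneg) auto
  also have "\<dots> = upper_const r powr (1 / r) * c * I powr (1 / r)"
    using r by (simp add: powr_mult powr_powr c_def)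
  finally show "?M powr (1 / r)
    \<le> upper_const r powr (1 / r) * (norm (kappa (phase z)) / norm (phase z - 1)) * I powr (1 / r)"
    by (simp add: c_def)
qed

text \<open>
  Applied to the martingale extracted from an eigenfunction in the Hardy space, this is the bound from which
  its boundary function is constructed.
\<close>

lemma hardy_norm_eigenmode_lower:
  assumes z: "phase z \<noteq> 1" and f: "tree_martingale f"
    and B: "0 \<le> B" "hardy_norm q \<mu> \<omega>0 r (eigenmode z f) \<le> ennreal B"
  shows "power_mean r n f \<le> (4 * B / norm (c_function q (of_real z))) powr r"
proof -
  define c where "c = norm (c_function q (of_real z))"
  have c: "0 < c" unfolding c_def by (rule c_function_pos[OF z])
  have "power_mean r m (spectral_sum (phase z) f) \<le> B powr r" for m
  proof -
    define S where "S = power_mean r m (spectral_sum (phase z) f)"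
    have S: "0 \<le> S" unfolding S_def by (rule sphere_avg_nonneg) simp
    have "ennreal (S powr (1 / r)) \<le> ennreal B"
      using B(2) unfolding hardy_norm_eigenmode S_def by (rule order_trans[OF SUP_upper, rotated]) simp
    then have "S powr (1 / r) \<le> B" using B(1) by simp
    then have "(S powr (1 / r)) powr r \<le> B powr r" using r by (intro powr_mono2) auto
    then show ?thesis using S r by (simp add: powr_powr S_def)
  qed
  from spectral_sum_lower[OF f r norm_phase z this, of n]
  have "c powr r * power_mean r n f \<le> 4 powr r * B powr r"
    by (simp only: c_def norm_c_function[OF z])
  then have "power_mean r n f \<le> 4 powr r * B powr r / c powr r"
    using c by (simp add: pos_le_divide_eq mult.commute)
  also have "\<dots> = (4 * B / c) powr r" using B(1) c by (simp add: powr_mult powr_divide)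
  finally show ?thesis by (simp add: c_def)
qed

end

end

context tree_boundary
begin

abbreviation poisson :: "real \<Rightarrow> ((nat \<Rightarrow> 'v) \<Rightarrow> complex) \<Rightarrow> 'v \<Rightarrow> complex" where
  "poisson z \<equiv> poisson_transform q adj x0 \<nu> (of_real z)"

abbreviation eigenfunction :: "real \<Rightarrow> ('v \<Rightarrow> complex) \<Rightarrow> bool" where
  "eigenfunction z u \<equiv> laplacian q adj u = (\<lambda>x. laplace_gamma q (of_real z) * u x)"

abbreviation c_abs :: "real \<Rightarrow> real" where "c_abs z \<equiv> norm (c_function q (of_real z))"

lemma poisson_transform_eigenmode:
  "integrable \<nu> F \<Longrightarrow> poisson z F = eigenmode z (ray_avg F)"
  by (rule ext) (simp add: poisson_transform_eq eigenmode_def)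

context
  fixes \<mu> :: "('v \<Rightarrow> 'v) measure" and \<omega>0 :: "nat \<Rightarrow> 'v" and r z :: real
  assumes haar: "normalized_haar adj x0 \<mu>" and \<omega>0: "\<omega>0 \<in> rays adj x0" and r: "1 < r"
    and z: "z \<notin> range (\<lambda>k::int. tau q / 2 * of_int k)"
begin

lemma phase_neq_1: "phase z \<noteq> 1"
  using z by (simp add: phase_eq_1_iff)

lemma poisson_transform_upper:
  assumes F: "F \<in> Lr_space \<nu> r"
  shows "hardy_norm q \<mu> \<omega>0 r (poisson z F)
    \<le> ennreal (upper_const r powr (1 / r) * c_abs z * Lr_norm \<nu> r F)"
proof -
  have Fi: "integrable \<nu> F" using Lr_integrable[OF F] r by simp
  show ?thesis
    unfolding poisson_transform_eigenmode[OF Fi] Lr_norm_def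
    using r by (intro hardy_norm_eigenmode_upper[OF haar \<omega>0 r phase_neq_1]
      ray_avg_tree_martingale[OF Fi] ray_avg_Lr_bound[OF F]) auto
qed

lemma poisson_transform_lower:
  assumes F: "F \<in> Lr_space \<nu> r"
  shows "ennreal (1 / 4 * c_abs z * Lr_norm \<nu> r F)
    \<le> hardy_norm q \<mu> \<omega>0 r (poisson z F)"
proof -
  have Fi: "integrable \<nu> F" using Lr_integrable[OF F] r by simp
  note m = ray_avg_tree_martingale[OF Fi]
  define c where "c = c_abs z"
  have c: "0 < c" unfolding c_def by (rule c_function_pos[OF phase_neq_1])
  show ?thesis
  proof (cases "hardy_norm q \<mu> \<omega>0 r (poisson z F)")
    case (real B)
    have "(\<integral>\<omega>. norm (F \<omega>) powr r \<partial>\<nu>) \<le> (4 * B / c) powr r"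
      unfolding c_def
    proof (rule integral_powr_le_of_martingale[OF F r])
      show "power_mean r n (ray_avg F)
        \<le> (4 * B / c_abs z) powr r" for n
        using real by (intro hardy_norm_eigenmode_lower[OF haar \<omega>0 r phase_neq_1 m])
          (simp_all flip: poisson_transform_eigenmode[OF Fi])
    qed
    then have "Lr_norm \<nu> r F \<le> ((4 * B / c) powr r) powr (1 / r)"
      unfolding Lr_norm_def using r by (intro powr_mono2 integral_nonneg_AE) auto
    also have "\<dots> = 4 * B / c" using real c r by (simp add: powr_powr)
    finally have "1 / 4 * c * Lr_norm \<nu> r F \<le> B" using c by (simp add: field_simps)
    then show ?thesis unfolding real(2) c_def[symmetric] using real(1) by (simp add: ennreal_leI)
  qed simp
qed

lemma poisson_transform_characterization:
  "(\<exists>F \<in> Lr_space \<nu> r. u = poisson z F) \<longleftrightarrow>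
   u \<in> hardy_space q \<mu> \<omega>0 r \<and> eigenfunction z u"
proof
  assume "\<exists>F \<in> Lr_space \<nu> r. u = poisson z F"
  then obtain F where F: "F \<in> Lr_space \<nu> r" and u: "u = poisson z F" by blast
  have Fi: "integrable \<nu> F" using Lr_integrable[OF F] r by simp
  have "u \<in> hardy_space q \<mu> \<omega>0 r"
    using poisson_transform_upper[OF F] by (simp add: hardy_space_def u le_less_trans)
  moreover have "eigenfunction z u"
    unfolding u poisson_transform_eigenmode[OF Fi] eigenmode_eigenfunction_iff
    by (rule ray_avg_tree_martingale[OF Fi])
  ultimately show "u \<in> hardy_space q \<mu> \<omega>0 r \<and> eigenfunction z u" ..
next
  assume u: "u \<in> hardy_space q \<mu> \<omega>0 r \<and> eigenfunction z u"
  obtain f where f: "eigenmode z f = u" using ex_eigenmode by blast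
  have m: "tree_martingale f" using u eigenmode_eigenfunction_iff[of z f] by (simp add: f)
  have "hardy_norm q \<mu> \<omega>0 r (eigenmode z f) < \<infinity>" using u by (simp add: hardy_space_def f)
  then obtain B where B: "0 \<le> B" "hardy_norm q \<mu> \<omega>0 r (eigenmode z f) = ennreal B"
    by (cases "hardy_norm q \<mu> \<omega>0 r (eigenmode z f)") auto
  obtain F where F: "F \<in> Lr_space \<nu> r" "ray_avg F = f"
    using Lr_bounded_martingale_closed[OF m r
        hardy_norm_eigenmode_lower[OF haar \<omega>0 r phase_neq_1 m B(1) eq_refl[OF B(2)]]] by blast
  have "integrable \<nu> F" using Lr_integrable[OF F(1)] r by simp
  then have "u = poisson z F"
    by (simp add: poisson_transform_eigenmode F(2) f)
  with F(1) show "\<exists>F \<in> Lr_space \<nu> r. u = poisson z F" by blast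
qed

end

end

theorem theorem1p3:
  fixes q :: nat
    and adj :: "'v \<Rightarrow> 'v \<Rightarrow> bool"
    and x0 :: 'v
    and \<nu> :: "(nat \<Rightarrow> 'v) measure"
    and \<mu> :: "('v \<Rightarrow> 'v) measure"
    and \<omega>0 :: "nat \<Rightarrow> 'v"
  assumes "q \<ge> 2"
    and "homogeneous_tree q adj"
    and "boundary_measure q adj x0 \<nu>"
    and "normalized_haar adj x0 \<mu>"
    and "\<omega>0 \<in> rays adj x0"
  shows "(\<forall>z::real. z \<notin> range (\<lambda>k::int. tau q / 2 * of_int k) \<longrightarrow>
           (\<forall>r::real. 1 < r \<longrightarrow> (\<forall>u :: 'v \<Rightarrow> complex.
             (\<exists>F \<in> Lr_space \<nu> r. u = poisson_transform q adj x0 \<nu> (of_real z) F) \<longleftrightarrow>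
             (u \<in> hardy_space q \<mu> \<omega>0 r \<and>
              laplacian q adj u = (\<lambda>x. laplace_gamma q (of_real z) * u x)))))
       \<and> (\<forall>r::real. 1 < r \<longrightarrow> (\<exists>C1 C2 :: real. 0 < C1 \<and> 0 < C2 \<and>
           (\<forall>z::real. z \<notin> range (\<lambda>k::int. tau q / 2 * of_int k) \<longrightarrow>
             (\<forall>F \<in> Lr_space \<nu> r.
               ennreal (C1 * norm (c_function q (of_real z)) * Lr_norm \<nu> r F)
                 \<le> hardy_norm q \<mu> \<omega>0 r (poisson_transform q adj x0 \<nu> (of_real z) F) \<and>
               hardy_norm q \<mu> \<omega>0 r (poisson_transform q adj x0 \<nu> (of_real z) F)
                 \<le> ennreal (C2 * norm (c_function q (of_real z)) * Lr_norm \<nu> r F)))))"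
proof -
  interpret tree_boundary q adj x0 \<nu>
    using assms by unfold_locales
  show ?thesis
  proof (intro conjI allI impI)
    fix z r :: real and u :: "'v \<Rightarrow> complex"
    assume "z \<notin> range (\<lambda>k::int. tau q / 2 * of_int k)" "1 < r"
    then show "(\<exists>F \<in> Lr_space \<nu> r. u = poisson_transform q adj x0 \<nu> (of_real z) F) \<longleftrightarrow>
       (u \<in> hardy_space q \<mu> \<omega>0 r \<and> laplacian q adj u = (\<lambda>x. laplace_gamma q (of_real z) * u x))"
      by (intro poisson_transform_characterization[OF assms(4,5)])
  next
    fix r :: real
    assume r: "1 < r"
    have "0 < upper_const r"
      by (auto simp: upper_const_def transform_const_def transform_const_ge2_def
          intro!: mult_pos_pos add_pos_nonneg)
    then have "0 < (1 / 4 :: real) \<and> 0 < upper_const r powr (1 / r)" by simp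
    moreover note poisson_transform_lower[OF assms(4,5) r] poisson_transform_upper[OF assms(4,5) r]
    ultimately show "\<exists>C1 C2 :: real. 0 < C1 \<and> 0 < C2 \<and>
           (\<forall>z::real. z \<notin> range (\<lambda>k::int. tau q / 2 * of_int k) \<longrightarrow>
             (\<forall>F \<in> Lr_space \<nu> r.
               ennreal (C1 * norm (c_function q (of_real z)) * Lr_norm \<nu> r F)
                 \<le> hardy_norm q \<mu> \<omega>0 r (poisson_transform q adj x0 \<nu> (of_real z) F) \<and>
               hardy_norm q \<mu> \<omega>0 r (poisson_transform q adj x0 \<nu> (of_real z) F)
                 \<le> ennreal (C2 * norm (c_function q (of_real z)) * Lr_norm \<nu> r F)))"
      by blast
  qed
qed

end
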